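(* Let $\mathbb{K}$ be an algebraically closed field. Every quasi-projective variety over $\mathbb{K}$ is a Grassmannian for an open fully exact subcategory in the category of quiver representations. That is, for every quasi-projective $\mathbb{K}$-variety $Y$ there exist a finite quiver $Q$ with finite-dimensional path algebra $\mathbb{K}Q$, an open fully exact subcategory $\mathcal{E}$ of the category $\mathbb{K}Q\text{-mod}$ of finite-dimensional representations of $Q$, a representation $V$ in $\mathcal{E}$ and a dimension vector $\mathbf{e}\in\mathbb{N}_0^{Q_0}$ such that $Y$ is isomorphic, as a variety, to the $\mathcal{E}$-Grassmannian $\mathrm{Gr}_{\mathcal{E}}(\mathbf{e},V)$.
   Context: A $\mathbb{K}$-variety means the $\mathbb{K}$-valued points of a reduced, separated scheme of finite type over $\mathrm{Spec}(\mathbb{K})$ (not necessarily irreducible); a quasi-projective variety is an open subvariety of a projective variety. For a finite quiver $Q$ with vertex set $Q_0$ and arrow set $Q_1$ (an arrow is written $\alpha:i\to j$), and $\mathbf{d}\in\mathbb{N}_0^{Q_0}$, $\mathrm{R}_{\mathbf{d}}(Q)=\bigoplus_{(\alpha:i\to j)\in Q_1}\mathbb{K}^{d_j\times d_i}$ is the affine space of $\mathbf{d}$-dimensional representations of $Q$. For a full subcategory $\mathcal{E}$ of $\mathbb{K}Q\text{-mod}$, put $\mathrm{R}_{\mathbf{d}}(\mathcal{E})=\{M\in \mathrm{R}_{\mathbf{d}}(Q): M\in\mathcal{E}\}$. An additively closed subcategory $\mathcal{E}$ (full, closed under isomorphisms, finite direct sums and direct summands) of $\mathbb{K}Q\text{-mod}$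 is called open if for every $\mathbf{d}\in\mathbb{N}_0^{Q_0}$ the subset $\mathrm{R}_{\mathbf{d}}(\mathcal{E})$ is Zariski open in $\mathrm{R}_{\mathbf{d}}(Q)$. An open fully exact subcategory is an open subcategory that is extension-closed, equipped with the exact structure restricted from $\mathbb{K}Q\text{-mod}$ (short exact sequences with all three terms in $\mathcal{E}$). For $M$ in $\mathcal{E}$ of dimension vector $\mathbf{e}+\mathbf{d}$ (with $\mathbf{e},\mathbf{d}\in\mathbb{N}_0^{Q_0}$), the $\mathcal{E}$-Grassmannian $\mathrm{Gr}_{\mathcal{E}}(\mathbf{e},M)$ is the set of $\mathbf{e}$-dimensional subrepresentations $U=(U_i)_{i\in Q_0}\in\prod_{i\in Q_0}\mathrm{Gr}_{\mathbb{K}}(e_i,M_i)$ of $M$ such that both the subrepresentation $M|_U$ and the quotient $M/U$ lie in $\mathcal{E}$. It is an open subset of the usual quiver Grassmannian of all $\mathbf{e}$-dimensional subrepresentations of $M$ (a closed subvariety of $\prod_{i\in Q_0}\mathrm{Gr}_{\mathbb{K}}(e_i,M_i)$) and carries the resulting structure of an open subvariety. *)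

theory Defs
  imports
    "HOL-Analysis.Abstract_Topology"
    "HOL-Computational_Algebra.Polynomial"
    "HOL-Library.Poly_Mapping"
    "Graph_Theory.Arc_Walk"
    "Jordan_Normal_Form.DL_Submatrix"
    "Jordan_Normal_Form.Matrix_Kernel"
begin

section \<open>Polynomials in several variables\<close>

text \<open>
  Polynomials with coefficients in \<open>'k\<close> and variables from \<open>'x\<close> are finitely supported
  functions on monomials, and monomials are finitely supported exponent functions; the ring
  structure is the one provided by \<^theory>\<open>HOL-Library.Poly_Mapping\<close>.
\<close>

type_synonym ('x, 'k) mpol = "('x \<Rightarrow>\<^sub>0 nat) \<Rightarrow>\<^sub>0 'k"

definition mon_eval :: "('x \<Rightarrow> 'k::comm_semiring_1) \<Rightarrow> ('x \<Rightarrow>\<^sub>0 nat) \<Rightarrow> 'k" where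
  "mon_eval c m = (\<Prod>x\<in>Poly_Mapping.keys m. c x ^ Poly_Mapping.lookup m x)"

definition mpol_eval :: "('x \<Rightarrow> 'k::comm_semiring_1) \<Rightarrow> ('x, 'k) mpol \<Rightarrow> 'k" where
  "mpol_eval c f = (\<Sum>m\<in>Poly_Mapping.keys f. Poly_Mapping.lookup f m * mon_eval c m)"

definition polynomials_in :: "'x set \<Rightarrow> ('x, 'k::zero) mpol set" where
  "polynomials_in X = {f. \<forall>m\<in>Poly_Mapping.keys f. Poly_Mapping.keys m \<subseteq> X}"

lemma mpol_eval_superset:
  assumes "finite K" "Poly_Mapping.keys f \<subseteq> K"
  shows "mpol_eval c f = (\<Sum>m\<in>K. Poly_Mapping.lookup f m * mon_eval c m)"
  unfolding mpol_eval_def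
  by (rule sum.mono_neutral_left) (use assms in \<open>auto simp: in_keys_iff\<close>)

lemma mpol_eval_add: "mpol_eval c (f + g) = mpol_eval c f + mpol_eval c g"
proof -
  let ?K = "Poly_Mapping.keys f \<union> Poly_Mapping.keys g"
  have "Poly_Mapping.keys (f + g) \<subseteq> ?K" by (rule Poly_Mapping.keys_add)
  then show ?thesis
    by (simp add: mpol_eval_superset[of ?K] lookup_add distrib_right sum.distrib)
qed

lemma mpol_eval_0 [simp]: "mpol_eval c 0 = 0"
  by (simp add: mpol_eval_def)

lemma mpol_eval_sum: "mpol_eval c (\<Sum>i\<in>I. f i) = (\<Sum>i\<in>I. mpol_eval c (f i))"
  by (induction I rule: infinite_finite_induct) (simp_all add: mpol_eval_add)

lemma mpol_eval_single: "mpol_eval c (Poly_Mapping.single m a) = a * mon_eval c m"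
  by (simp add: mpol_eval_def)

lemma mpol_eval_1 [simp]: "mpol_eval c 1 = 1"
  by (simp add: mpol_eval_def mon_eval_def lookup_one)

lemma mon_eval_superset:
  assumes "finite K" "Poly_Mapping.keys m \<subseteq> K"
  shows "mon_eval c m = (\<Prod>x\<in>K. c x ^ Poly_Mapping.lookup m x)"
  unfolding mon_eval_def
  by (rule prod.mono_neutral_left) (use assms in \<open>auto simp: in_keys_iff\<close>)

lemma mon_eval_add: "mon_eval c (m + n) = mon_eval c m * mon_eval c n"
proof -
  let ?K = "Poly_Mapping.keys m \<union> Poly_Mapping.keys n"
  have "Poly_Mapping.keys (m + n) \<subseteq> ?K" by (rule Poly_Mapping.keys_add)
  then show ?thesis
    by (simp add: mon_eval_superset[of ?K] lookup_add power_add prod.distrib)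
qed

lemma mpol_sum_monomials:
  "f = (\<Sum>m\<in>Poly_Mapping.keys f. Poly_Mapping.single m (Poly_Mapping.lookup f m))"
proof (rule poly_mapping_eqI)
  fix k
  show "Poly_Mapping.lookup f k = Poly_Mapping.lookup
    (\<Sum>m\<in>Poly_Mapping.keys f. Poly_Mapping.single m (Poly_Mapping.lookup f m)) k"
    by (simp add: lookup_sum lookup_single when_def in_keys_iff)
qed

lemma mpol_eval_mult: "mpol_eval c (f * g) = mpol_eval c f * mpol_eval c g"
proof -
  let ?l = Poly_Mapping.lookup
  have "f * g = (\<Sum>m\<in>Poly_Mapping.keys f. Poly_Mapping.single m (?l f m)) *
                (\<Sum>n\<in>Poly_Mapping.keys g. Poly_Mapping.single n (?l g n))"
    using mpol_sum_monomials[of f] mpol_sum_monomials[of g] by simp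
  also have "\<dots> = (\<Sum>m\<in>Poly_Mapping.keys f. \<Sum>n\<in>Poly_Mapping.keys g.
                    Poly_Mapping.single (m + n) (?l f m * ?l g n))"
    by (simp add: sum_product mult_single)
  finally have "mpol_eval c (f * g) = (\<Sum>m\<in>Poly_Mapping.keys f. \<Sum>n\<in>Poly_Mapping.keys g.
      (?l f m * mon_eval c m) * (?l g n * mon_eval c n))"
    by (simp add: mpol_eval_sum mpol_eval_single mon_eval_add mult_ac)
  also have "\<dots> = mpol_eval c f * mpol_eval c g"
    by (simp add: mpol_eval_def sum_product)
  finally show ?thesis .
qed

lemma one_in_polynomials_in: "(1 :: ('x, 'k::zero_neq_one) mpol) \<in> polynomials_in X"
  by (simp add: polynomials_in_def)

lemma mult_in_polynomials_in:
  fixes f g :: "('x, 'k::semiring_0) mpol"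
  assumes "f \<in> polynomials_in X" "g \<in> polynomials_in X"
  shows "f * g \<in> polynomials_in X"
  unfolding polynomials_in_def
proof safe
  fix k x assume k: "k \<in> Poly_Mapping.keys (f * g)" and x: "x \<in> Poly_Mapping.keys k"
  obtain m n where "k = m + n" "m \<in> Poly_Mapping.keys f" "n \<in> Poly_Mapping.keys g"
    using k Poly_Mapping.keys_mult[of f g] by blast
  with assms x show "x \<in> X"
    using Poly_Mapping.keys_add[of m n] unfolding polynomials_in_def by blast
qed

text \<open>
  The variables are grouped into blocks by \<open>blk\<close>.  A polynomial is multihomogeneous of
  multidegree \<open>\<delta>\<close> if each of its monomials has total degree \<open>\<delta> i\<close> in the variables of block
  \<open>i\<close>, for all \<open>i\<close>.  With a single block this is ordinary homogeneity.
\<close>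

definition block_degree :: "('x \<Rightarrow> 'i) \<Rightarrow> ('x \<Rightarrow>\<^sub>0 nat) \<Rightarrow> 'i \<Rightarrow> nat" where
  "block_degree blk m i = (\<Sum>x\<in>{x\<in>Poly_Mapping.keys m. blk x = i}. Poly_Mapping.lookup m x)"

definition multihomogeneous ::
    "'x set \<Rightarrow> ('x \<Rightarrow> 'i) \<Rightarrow> ('i \<Rightarrow> nat) \<Rightarrow> ('x, 'k::zero) mpol set" where
  "multihomogeneous X blk \<delta> =
     {f \<in> polynomials_in X. \<forall>m\<in>Poly_Mapping.keys f. block_degree blk m = \<delta>}"

lemma block_degree_superset:
  assumes "finite K" "Poly_Mapping.keys m \<subseteq> K"
  shows "block_degree blk m i = (\<Sum>x\<in>{x\<in>K. blk x = i}. Poly_Mapping.lookup m x)"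
  unfolding block_degree_def
  by (rule sum.mono_neutral_left) (use assms in \<open>auto simp: in_keys_iff\<close>)

lemma block_degree_add: "block_degree blk (m + n) i = block_degree blk m i + block_degree blk n i"
proof -
  let ?K = "Poly_Mapping.keys m \<union> Poly_Mapping.keys n"
  have "Poly_Mapping.keys (m + n) \<subseteq> ?K" by (rule Poly_Mapping.keys_add)
  then show ?thesis
    by (simp add: block_degree_superset[of ?K] lookup_add sum.distrib)
qed

lemma one_multihomogeneous: "(1 :: ('x, 'k::zero_neq_one) mpol) \<in> multihomogeneous X blk (\<lambda>_. 0)"
  by (auto simp: multihomogeneous_def one_in_polynomials_in block_degree_def fun_eq_iff)

lemma mult_multihomogeneous:
  fixes f g :: "('x, 'k::semiring_0) mpol"
  assumes "f \<in> multihomogeneous X blk \<delta>" "g \<in> multihomogeneous X blk \<epsilon>"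
  shows "f * g \<in> multihomogeneous X blk (\<lambda>i. \<delta> i + \<epsilon> i)"
proof -
  have "block_degree blk k = (\<lambda>i. \<delta> i + \<epsilon> i)" if k: "k \<in> Poly_Mapping.keys (f * g)" for k
  proof -
    obtain m n where "k = m + n" "m \<in> Poly_Mapping.keys f" "n \<in> Poly_Mapping.keys g"
      using k Poly_Mapping.keys_mult[of f g] by blast
    then show ?thesis
      using assms unfolding multihomogeneous_def by (auto simp: block_degree_add fun_eq_iff)
  qed
  then show ?thesis
    using assms mult_in_polynomials_in unfolding multihomogeneous_def by blast
qed

lemma multihomogeneous_scale:
  fixes f :: "('x, 'k::field) mpol"
  assumes f: "f \<in> multihomogeneous X blk \<delta>"
    and t: "\<And>i. t i \<noteq> 0" and c': "\<And>x. x \<in> X \<Longrightarrow> c' x = t (blk x) * c x"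
  shows "\<exists>s. s \<noteq> 0 \<and> mpol_eval c' f = s * mpol_eval c f"
proof -
  let ?l = Poly_Mapping.lookup
  define B where "B = blk ` (\<Union>m\<in>Poly_Mapping.keys f. Poly_Mapping.keys m)"
  define s where "s = (\<Prod>i\<in>B. t i ^ \<delta> i)"
  have fin: "finite B" by (simp add: B_def)
  have mon: "mon_eval c' m = s * mon_eval c m" if m: "m \<in> Poly_Mapping.keys f" for m
  proof -
    have sub: "Poly_Mapping.keys m \<subseteq> X" and deg: "block_degree blk m = \<delta>"
      using f m by (auto simp: multihomogeneous_def polynomials_in_def)
    have "mon_eval c' m = (\<Prod>x\<in>Poly_Mapping.keys m. t (blk x) ^ ?l m x * c x ^ ?l m x)"
      unfolding mon_eval_def by (rule prod.cong) (use c' sub in \<open>auto simp: power_mult_distrib\<close>)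
    also have "\<dots> = (\<Prod>x\<in>Poly_Mapping.keys m. t (blk x) ^ ?l m x) * mon_eval c m"
      by (simp add: prod.distrib mon_eval_def)
    also have "(\<Prod>x\<in>Poly_Mapping.keys m. t (blk x) ^ ?l m x) =
        (\<Prod>i\<in>B. \<Prod>x\<in>{x\<in>Poly_Mapping.keys m. blk x = i}. t (blk x) ^ ?l m x)"
      by (rule prod.group[symmetric]) (use fin m in \<open>auto simp: B_def\<close>)
    also have "\<dots> = (\<Prod>i\<in>B. t i ^ block_degree blk m i)"
      by (rule prod.cong) (auto simp: block_degree_def power_sum)
    finally show ?thesis by (simp add: s_def deg)
  qed
  have "mpol_eval c' f = s * mpol_eval c f"
    unfolding mpol_eval_def sum_distrib_left by (rule sum.cong) (auto simp: mon mult_ac)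
  moreover have "s \<noteq> 0" using fin t by (simp add: s_def)
  ultimately show ?thesis by blast
qed


section \<open>Zariski topologies and varieties\<close>

text \<open>
  A point \<open>p\<close> of \<open>P\<close> comes with the set \<open>crd p\<close> of its admissible coordinate tuples: a single
  tuple in the affine case, all tuples of homogeneous coordinates in the projective cases.
  \<open>H\<close> is the set of polynomials that may be used as equations.
\<close>

definition zero_locus ::
    "'p set \<Rightarrow> ('p \<Rightarrow> ('x \<Rightarrow> 'k::comm_semiring_1) set) \<Rightarrow> ('x, 'k) mpol set \<Rightarrow> 'p set" where
  "zero_locus P crd S = {p \<in> P. \<forall>f\<in>S. \<forall>c\<in>crd p. mpol_eval c f = 0}"

definition zariski_topology ::
    "'p set \<Rightarrow> ('p \<Rightarrow> ('x \<Rightarrow> 'k::comm_semiring_1) set) \<Rightarrow> ('x, 'k) mpol set \<Rightarrow> 'p topology" where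
  "zariski_topology P crd H = topology (\<lambda>U. \<exists>S\<subseteq>H. U = P - zero_locus P crd S)"

text \<open>
  The zero loci are the closed sets of a topology provided that \<open>H\<close> is closed under products
  and that the vanishing of \<open>f \<in> H\<close> at \<open>p\<close> does not depend on the chosen coordinates of \<open>p\<close>.
\<close>

lemma istopology_zariski:
  fixes H :: "('x, 'k::idom) mpol set"
  assumes mult: "\<And>f g. f \<in> H \<Longrightarrow> g \<in> H \<Longrightarrow> f * g \<in> H"
    and indep: "\<And>f p c c'. f \<in> H \<Longrightarrow> p \<in> P \<Longrightarrow> c \<in> crd p \<Longrightarrow> c' \<in> crd p \<Longrightarrow>
                  mpol_eval c f = 0 \<Longrightarrow> mpol_eval c' f = 0"
  shows "istopology (\<lambda>U. \<exists>S\<subseteq>H. U = P - zero_locus P crd S)"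
  unfolding istopology_def
proof (intro conjI allI impI)
  fix U1 U2
  assume "\<exists>S\<subseteq>H. U1 = P - zero_locus P crd S" "\<exists>S\<subseteq>H. U2 = P - zero_locus P crd S"
  then obtain S1 S2 where S: "S1 \<subseteq> H" "S2 \<subseteq> H"
    and U: "U1 = P - zero_locus P crd S1" "U2 = P - zero_locus P crd S2"
    by blast
  define S where "S = {f * g | f g. f \<in> S1 \<and> g \<in> S2}"
  have "S \<subseteq> H" using S mult by (auto simp: S_def)
  moreover have "U1 \<inter> U2 = P - zero_locus P crd S"
  proof (rule Set.set_eqI)
    fix p
    show "p \<in> U1 \<inter> U2 \<longleftrightarrow> p \<in> P - zero_locus P crd S"
    proof
      assume "p \<in> U1 \<inter> U2"
      then obtain f g c c' where p: "p \<in> P" and *: "f \<in> S1" "g \<in> S2" "c \<in> crd p" "c' \<in> crd p"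
        "mpol_eval c f \<noteq> 0" "mpol_eval c' g \<noteq> 0"
        unfolding U zero_locus_def by blast
      have "mpol_eval c g \<noteq> 0" using indep[of g p c c'] * p S by blast
      with * have "mpol_eval c (f * g) \<noteq> 0" by (simp add: mpol_eval_mult)
      moreover have "f * g \<in> S" using * by (auto simp: S_def)
      ultimately show "p \<in> P - zero_locus P crd S" using p * unfolding zero_locus_def by blast
    next
      assume "p \<in> P - zero_locus P crd S"
      then obtain f g c where "p \<in> P" "f \<in> S1" "g \<in> S2" "c \<in> crd p" "mpol_eval c (f * g) \<noteq> 0"
        unfolding zero_locus_def S_def by blast
      then show "p \<in> U1 \<inter> U2"
        unfolding U zero_locus_def by (auto simp: mpol_eval_mult)
    qed
  qed
  ultimately show "\<exists>S\<subseteq>H. U1 \<inter> U2 = P - zero_locus P crd S" by blast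
next
  fix \<K> assume "\<forall>K\<in>\<K>. \<exists>S\<subseteq>H. K = P - zero_locus P crd S"
  then obtain S where S: "\<And>K. K \<in> \<K> \<Longrightarrow> S K \<subseteq> H \<and> K = P - zero_locus P crd (S K)"
    by metis
  have "\<Union>\<K> = P - zero_locus P crd (\<Union>K\<in>\<K>. S K)"
  proof (rule Set.set_eqI)
    fix p
    have "p \<in> \<Union>\<K> \<longleftrightarrow> (\<exists>K\<in>\<K>. p \<in> P - zero_locus P crd (S K))" using S by blast
    also have "\<dots> \<longleftrightarrow> p \<in> P - zero_locus P crd (\<Union>K\<in>\<K>. S K)"
      unfolding zero_locus_def by blast
    finally show "p \<in> \<Union>\<K> \<longleftrightarrow> p \<in> P - zero_locus P crd (\<Union>K\<in>\<K>. S K)" .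
  qed
  moreover have "(\<Union>K\<in>\<K>. S K) \<subseteq> H" using S by blast
  ultimately show "\<exists>S\<subseteq>H. \<Union>\<K> = P - zero_locus P crd S" by blast
qed

lemma openin_zariski_multihomogeneous:
  fixes crd :: "'p \<Rightarrow> ('x \<Rightarrow> 'k::field) set"
  assumes scale: "\<And>p c c'. p \<in> P \<Longrightarrow> c \<in> crd p \<Longrightarrow> c' \<in> crd p \<Longrightarrow>
                    \<exists>t. (\<forall>i. t i \<noteq> 0) \<and> (\<forall>x\<in>X. c' x = t (blk x) * c x)"
  shows "openin (zariski_topology P crd (\<Union>\<delta>. multihomogeneous X blk \<delta>)) U \<longleftrightarrow>
           (\<exists>S\<subseteq>(\<Union>\<delta>. multihomogeneous X blk \<delta>). U = P - zero_locus P crd S)"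
proof -
  have "istopology (\<lambda>U. \<exists>S\<subseteq>(\<Union>\<delta>. multihomogeneous X blk \<delta>). U = P - zero_locus P crd S)"
  proof (rule istopology_zariski)
    fix f g :: "('x, 'k) mpol"
    assume "f \<in> (\<Union>\<delta>. multihomogeneous X blk \<delta>)" "g \<in> (\<Union>\<delta>. multihomogeneous X blk \<delta>)"
    then obtain \<delta> \<epsilon> where "f \<in> multihomogeneous X blk \<delta>" "g \<in> multihomogeneous X blk \<epsilon>"
      by blast
    then have "f * g \<in> multihomogeneous X blk (\<lambda>i. \<delta> i + \<epsilon> i)"
      by (rule mult_multihomogeneous)
    then show "f * g \<in> (\<Union>\<delta>. multihomogeneous X blk \<delta>)"
      by (rule UN_I[where B = "multihomogeneous X blk", OF UNIV_I])
  next
    fix f :: "('x, 'k) mpol" and p c c'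
    assume f: "f \<in> (\<Union>\<delta>. multihomogeneous X blk \<delta>)" and p: "p \<in> P" "c \<in> crd p" "c' \<in> crd p"
      and 0: "mpol_eval c f = 0"
    obtain \<delta> where \<delta>: "f \<in> multihomogeneous X blk \<delta>"
      using f by blast
    obtain t where t: "\<forall>i. t i \<noteq> 0" "\<forall>x\<in>X. c' x = t (blk x) * c x"
      using scale[OF p] by (elim exE conjE)
    obtain s where "mpol_eval c' f = s * mpol_eval c f"
      using multihomogeneous_scale[where t = t and c = c and c' = c', OF \<delta>] t by blast
    with 0 show "mpol_eval c' f = 0" by simp
  qed
  then show ?thesis by (simp add: zariski_topology_def)
qed

text \<open>
  Over an algebraically closed field \<open>'k\<close>, the \<open>'k\<close>-valued points of a reduced scheme of finite
  type are a topological space with a sheaf of \<open>'k\<close>-valued functions.  Only the values of a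
  member of \<open>regular X W\<close> on the open set \<open>W\<close> are relevant.
\<close>

record ('p, 'k) variety =
  zariski :: "'p topology"
  regular :: "'p set \<Rightarrow> ('p \<Rightarrow> 'k) set"

definition morphism :: "('p, 'k) variety \<Rightarrow> ('q, 'k) variety \<Rightarrow> ('p \<Rightarrow> 'q) \<Rightarrow> bool" where
  "morphism X Y \<phi> \<longleftrightarrow>
     continuous_map (zariski X) (zariski Y) \<phi> \<and>
     (\<forall>W h. openin (zariski Y) W \<longrightarrow> h \<in> regular Y W \<longrightarrow>
        h \<circ> \<phi> \<in> regular X {p \<in> topspace (zariski X). \<phi> p \<in> W})"

definition isomorphic_varieties :: "('p, 'k) variety \<Rightarrow> ('q, 'k) variety \<Rightarrow> bool" where
  "isomorphic_varieties X Y \<longleftrightarrow>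
     (\<exists>\<phi> \<psi>. morphism X Y \<phi> \<and> morphism Y X \<psi> \<and>
        (\<forall>p\<in>topspace (zariski X). \<psi> (\<phi> p) = p) \<and>
        (\<forall>q\<in>topspace (zariski Y). \<phi> (\<psi> q) = q))"

text \<open>The reduced induced structure on a (locally closed) subset.\<close>

definition subvariety :: "('p, 'k) variety \<Rightarrow> 'p set \<Rightarrow> ('p, 'k) variety" where
  "subvariety X Z =
     \<lparr>zariski = subtopology (zariski X) Z,
      regular = (\<lambda>W. {h. \<forall>p\<in>W. \<exists>N g. openin (zariski X) N \<and> p \<in> N \<and> g \<in> regular X N \<and>
                              (\<forall>q\<in>N \<inter> W. h q = g q)})\<rparr>"

text \<open>
  Varieties given by blocks of homogeneous coordinates, i.e. by an embedding into a product of
  projective spaces: closed sets are the zero loci of multihomogeneous polynomials, regular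
  functions are locally quotients of multihomogeneous polynomials of equal multidegree.
\<close>

definition multiprojective_variety ::
    "'x set \<Rightarrow> ('x \<Rightarrow> 'i) \<Rightarrow> 'p set \<Rightarrow> ('p \<Rightarrow> ('x \<Rightarrow> 'k::field) set) \<Rightarrow> ('p, 'k) variety" where
  "multiprojective_variety X blk P crd =
     (let T = zariski_topology P crd (\<Union>\<delta>. multihomogeneous X blk \<delta>) in
      \<lparr>zariski = T,
       regular = (\<lambda>W. {h. \<forall>p\<in>W. \<exists>N f g \<delta>. openin T N \<and> p \<in> N \<and> N \<subseteq> W \<and>
                          f \<in> multihomogeneous X blk \<delta> \<and> g \<in> multihomogeneous X blk \<delta> \<and>
                          (\<forall>q\<in>N. \<forall>c\<in>crd q. mpol_eval c g \<noteq> 0 \<and>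
                                              h q = mpol_eval c f / mpol_eval c g)})\<rparr>)"


section \<open>Grassmannians, projective space, quasi-projective varieties\<close>

definition mat_inj :: "'k::field mat \<Rightarrow> bool" where
  "mat_inj A \<longleftrightarrow> inj_on (\<lambda>v. A *\<^sub>v v) (carrier_vec (dim_col A))"

definition mat_range :: "'k::field mat \<Rightarrow> 'k vec set" where
  "mat_range A = (\<lambda>v. A *\<^sub>v v) ` carrier_vec (dim_col A)"

text \<open>The columns of \<open>A\<close> are a basis of the \<open>e\<close>-dimensional subspace \<open>U\<close> of \<open>K\<^sup>d\<close>.\<close>

definition basis_matrix :: "nat \<Rightarrow> nat \<Rightarrow> 'k::field vec set \<Rightarrow> 'k mat \<Rightarrow> bool" where
  "basis_matrix e d U A \<longleftrightarrow> A \<in> carrier_mat d e \<and> mat_inj A \<and> mat_range A = U"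

lemma basis_matrix_change:
  assumes A: "basis_matrix e d U A" and B: "basis_matrix e d U B"
  obtains g where "g \<in> carrier_mat e e" "det g \<noteq> 0" "B = A * g"
proof -
  have ex: "\<exists>g\<in>carrier_mat e e. B = A * g"
    if A: "basis_matrix e d U A" and B: "basis_matrix e d U B" for A B :: "'a mat"
  proof -
    have cA: "A \<in> carrier_mat d e" and cB: "B \<in> carrier_mat d e"
      using A B by (auto simp: basis_matrix_def)
    have "\<exists>v\<in>carrier_vec e. A *\<^sub>v v = col B j" if j: "j < e" for j
    proof -
      have "col B j = B *\<^sub>v unit_vec e j"
        by (rule eq_vecI) (use cB j in auto)
      then have "col B j \<in> mat_range B"
        using cB unfolding mat_range_def by auto
      then have "col B j \<in> mat_range A"
        using A B by (simp add: basis_matrix_def)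
      then show ?thesis
        using cA unfolding mat_range_def by auto
    qed
    then obtain v where v: "\<And>j. j < e \<Longrightarrow> v j \<in> carrier_vec e \<and> A *\<^sub>v v j = col B j"
      by metis
    define g where "g = mat e e (\<lambda>(i, j). v j $ i)"
    have cg: "g \<in> carrier_mat e e" by (simp add: g_def)
    have "col g j = v j" if "j < e" for j
      by (rule eq_vecI) (use v[OF that] that in \<open>auto simp: g_def\<close>)
    then have "col B j = col (A * g) j" if "j < e" for j
      using that v[OF that] cA cg by (metis col_mult2)
    then have "B = A * g"
      using cA cB cg by (intro mat_col_eqI) auto
    then show ?thesis using cg by blast
  qed
  obtain g where g: "g \<in> carrier_mat e e" "B = A * g" using ex[OF A B] by blast
  obtain h where h: "h \<in> carrier_mat e e" "A = B * h" using ex[OF B A] by blast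
  have cA: "A \<in> carrier_mat d e" and cB: "B \<in> carrier_mat d e"
    using A B by (simp_all add: basis_matrix_def)
  have gh: "(g * h) *\<^sub>v v = v" if v: "v \<in> carrier_vec e" for v
  proof -
    have "A *\<^sub>v v = B *\<^sub>v (h *\<^sub>v v)"
      using assoc_mult_mat_vec[OF cB h(1) v] h(2) by simp
    also have "\<dots> = A *\<^sub>v ((g * h) *\<^sub>v v)"
      using g h(1) cA v by simp
    finally have "A *\<^sub>v v = A *\<^sub>v ((g * h) *\<^sub>v v)" .
    moreover have "inj_on (\<lambda>v. A *\<^sub>v v) (carrier_vec e)"
      using A cA by (auto simp: basis_matrix_def mat_inj_def)
    moreover have "(g * h) *\<^sub>v v \<in> carrier_vec e"
      using g(1) h(1) v by auto
    ultimately show ?thesis using v by (metis inj_onD)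
  qed
  have "g * h = 1\<^sub>m e"
  proof (rule mat_col_eqI)
    fix j assume "j < dim_col (1\<^sub>m e :: 'a mat)"
    then have j: "j < e" by simp
    have "col C j = C *\<^sub>v unit_vec e j" if "C \<in> carrier_mat e e" for C :: "'a mat"
      by (rule eq_vecI) (use that j in auto)
    then have "col (g * h) j = (g * h) *\<^sub>v unit_vec e j"
      using g(1) h(1) by (metis mult_carrier_mat)
    then show "col (g * h) j = col (1\<^sub>m e) j" using gh[of "unit_vec e j"] j by simp
  qed (use g(1) h(1) in auto)
  then have "det g * det h = 1" using det_mult[OF g(1) h(1)] by simp
  then have "det g \<noteq> 0" by force
  then show thesis using that g by blast
qed

definition Gr :: "nat \<Rightarrow> nat \<Rightarrow> 'k::field vec set set" where
  "Gr e d = {U. \<exists>A. basis_matrix e d U A}"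

definition projective_space :: "nat \<Rightarrow> ('k::field vec set, 'k) variety" where
  "projective_space n =
     multiprojective_variety {..n} (\<lambda>_. ()) (Gr 1 (Suc n))
       (\<lambda>L. {(\<lambda>i. v $ i) | v. v \<in> L \<and> v \<noteq> 0\<^sub>v (Suc n)})"

lemma openin_projective_space:
  "openin (zariski (projective_space n :: ('k::field vec set, 'k) variety)) U \<longleftrightarrow>
     (\<exists>S\<subseteq>(\<Union>\<delta>. multihomogeneous {..n} (\<lambda>_. ()) \<delta>).
        U = Gr 1 (Suc n) - zero_locus (Gr 1 (Suc n))
              (\<lambda>L. {(\<lambda>i. v $ i) | v. v \<in> L \<and> v \<noteq> 0\<^sub>v (Suc n)}) S)"
proof -
  have *: "\<exists>t. (\<forall>i. t i \<noteq> 0) \<and> (\<forall>x\<in>{..n}. c' x = t ((\<lambda>_. ()) x) * c x)"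
    if L: "L \<in> Gr 1 (Suc n)" and c: "c \<in> {(\<lambda>i. v $ i) | v. v \<in> L \<and> v \<noteq> 0\<^sub>v (Suc n)}"
      and c': "c' \<in> {(\<lambda>i. v $ i) | v. v \<in> L \<and> v \<noteq> 0\<^sub>v (Suc n)}" for L and c c' :: "nat \<Rightarrow> 'k"
  proof -
    obtain A where A: "A \<in> carrier_mat (Suc n) 1" "mat_range A = L"
      using L by (auto simp: Gr_def basis_matrix_def)
    have *: "\<exists>t. t \<noteq> 0 \<and> (\<forall>i\<le>n. c i = t * A $$ (i, 0))"
      if c: "c \<in> {(\<lambda>i. v $ i) | v. v \<in> L \<and> v \<noteq> 0\<^sub>v (Suc n)}" for c
    proof -
      obtain v where v: "v \<in> mat_range A" "v \<noteq> 0\<^sub>v (Suc n)" "c = (\<lambda>i. v $ i)"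
        using c A(2) by blast
      then obtain w where w: "w \<in> carrier_vec 1" "v = A *\<^sub>v w"
        using A unfolding mat_range_def by auto
      have e: "\<forall>i\<le>n. v $ i = w $ 0 * A $$ (i, 0)"
        using A w by (auto simp: scalar_prod_def)
      moreover have "w $ 0 \<noteq> 0"
      proof
        assume "w $ 0 = 0"
        then have "v = 0\<^sub>v (Suc n)" using A w e by (intro eq_vecI) auto
        with v show False by simp
      qed
      ultimately show ?thesis using v by blast
    qed
    from *[OF c] *[OF c'] obtain t t' where t: "t \<noteq> 0" "t' \<noteq> 0"
        "\<forall>i\<le>n. c i = t * A $$ (i, 0)" "\<forall>i\<le>n. c' i = t' * A $$ (i, 0)"
      by blast
    show ?thesis by (rule exI[of _ "\<lambda>_. t' / t"]) (use t in auto)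
  qed
  show ?thesis
    unfolding projective_space_def multiprojective_variety_def Let_def variety.simps
    by (rule openin_zariski_multihomogeneous) (rule *)
qed

definition projective_variety :: "('p, 'k::field) variety \<Rightarrow> bool" where
  "projective_variety X \<longleftrightarrow>
     (\<exists>n C. closedin (zariski (projective_space n :: (_, 'k) variety)) C \<and>
        isomorphic_varieties X (subvariety (projective_space n) C))"

text \<open>
  An open subvariety of a projective variety.  The projective variety may be taken to be a
  closed subvariety of a projective space, which leaves the type \<open>'p\<close> of points of \<open>Y\<close> arbitrary.
\<close>

definition quasi_projective_variety :: "('p, 'k::field) variety \<Rightarrow> bool" where
  "quasi_projective_variety Y \<longleftrightarrow>
     (\<exists>(X :: ('k vec set, 'k) variety) W.
        projective_variety X \<and> openin (zariski X) W \<and>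
        isomorphic_varieties Y (subvariety X W))"

text \<open>
  The product of the Grassmannians \<open>Gr (e i) (d i)\<close> over \<open>i \<in> J\<close>.  The coordinates in block \<open>i\<close>
  are the Pluecker coordinates of the \<open>i\<close>-th factor: the maximal minors, indexed by sets of
  \<open>e i\<close> rows, of a basis matrix.
\<close>

definition Gr_product ::
    "'v set \<Rightarrow> ('v \<Rightarrow> nat) \<Rightarrow> ('v \<Rightarrow> nat) \<Rightarrow> ('v \<Rightarrow> 'k::field vec set, 'k) variety" where
  "Gr_product J e d =
     multiprojective_variety {(i, I). i \<in> J \<and> I \<subseteq> {..<d i} \<and> card I = e i} fst
       (\<Pi>\<^sub>E i\<in>J. Gr (e i) (d i))
       (\<lambda>U. {(\<lambda>(i, I). det (submatrix (A i) I UNIV)) | A.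
               \<forall>i\<in>J. basis_matrix (e i) (d i) (U i) (A i)})"

lemma det_submatrix_mult:
  assumes A: "A \<in> carrier_mat d e" and g: "(g :: 'k::field mat) \<in> carrier_mat e e"
    and I: "I \<subseteq> {..<d}" "card I = e"
  shows "det (submatrix (A * g) I UNIV) = det (submatrix A I UNIV) * det g"
proof -
  have I': "{i. i < d \<and> i \<in> I} = I" using I by auto
  have cs: "submatrix A I UNIV \<in> carrier_mat e e"
    using A I by (auto simp: submatrix_def I')
  have pick: "pick I i < d" if "i < e" for i
    using pick_in_set_le[of i I] that I by auto
  have "submatrix (A * g) I UNIV = submatrix A I UNIV * g"
    by (rule eq_matI)
       (use A g I I' pick in \<open>auto simp: submatrix_def pick_UNIV scalar_prod_def\<close>)
  then show ?thesis using det_mult[OF cs g] by simp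
qed

lemma openin_Gr_product:
  fixes d e :: "'v \<Rightarrow> nat"
  shows "openin (zariski (Gr_product J e d :: ('v \<Rightarrow> 'k::field vec set, 'k) variety)) V \<longleftrightarrow>
     (\<exists>S\<subseteq>(\<Union>\<delta>. multihomogeneous {(i, I). i \<in> J \<and> I \<subseteq> {..<d i} \<and> card I = e i} fst \<delta>).
        V = (\<Pi>\<^sub>E i\<in>J. Gr (e i) (d i)) - zero_locus (\<Pi>\<^sub>E i\<in>J. Gr (e i) (d i))
              (\<lambda>U. {(\<lambda>(i, I). det (submatrix (A i) I UNIV)) | A.
                      \<forall>i\<in>J. basis_matrix (e i) (d i) (U i) (A i)}) S)"
proof -
  let ?X = "{(i, I). i \<in> J \<and> I \<subseteq> {..<d i} \<and> card I = e i}"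
  let ?crd = "\<lambda>U :: 'v \<Rightarrow> 'k vec set. {(\<lambda>(i, I). det (submatrix (A i) I UNIV)) | A.
                      \<forall>i\<in>J. basis_matrix (e i) (d i) (U i) (A i)}"
  have *: "\<exists>t. (\<forall>i. t i \<noteq> 0) \<and> (\<forall>x\<in>?X. c' x = t (fst x) * c x)"
    if c: "c \<in> ?crd U" "c' \<in> ?crd U" for U c c'
  proof -
    obtain A B where A: "\<And>i. i \<in> J \<Longrightarrow> basis_matrix (e i) (d i) (U i) (A i)"
        "c = (\<lambda>(i, I). det (submatrix (A i) I UNIV))"
      and B: "\<And>i. i \<in> J \<Longrightarrow> basis_matrix (e i) (d i) (U i) (B i)"
        "c' = (\<lambda>(i, I). det (submatrix (B i) I UNIV))"
      using c by blast
    have "\<exists>g. g \<in> carrier_mat (e i) (e i) \<and> det g \<noteq> 0 \<and> B i = A i * g" if "i \<in> J" for i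
      using basis_matrix_change[OF A(1)[OF that] B(1)[OF that]] by metis
    then obtain g where g: "\<And>i. i \<in> J \<Longrightarrow>
        g i \<in> carrier_mat (e i) (e i) \<and> det (g i) \<noteq> 0 \<and> B i = A i * g i"
      by metis
    have "c' x = det (g (fst x)) * c x" if xX: "x \<in> ?X" for x
    proof -
      obtain i I where x: "x = (i, I)" "i \<in> J" "I \<subseteq> {..<d i}" "card I = e i"
        using xX by auto
      have "A i \<in> carrier_mat (d i) (e i)" using A(1)[OF x(2)] by (simp add: basis_matrix_def)
      from det_submatrix_mult[OF this _ x(3,4)] g[OF x(2)] show ?thesis
        by (simp add: A(2) B(2) x(1) mult.commute)
    qed
    then show ?thesis
      using g by (intro exI[of _ "\<lambda>i. if i \<in> J then det (g i) else 1"]) auto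
  qed
  show ?thesis
    unfolding Gr_product_def multiprojective_variety_def Let_def variety.simps
    by (rule openin_zariski_multihomogeneous) (rule *)
qed


section \<open>Quiver representations\<close>

text \<open>
  Finite quivers are \<^locale>\<open>fin_digraph\<close>s (loops and multiple arcs allowed).  A path is given by
  its starting vertex and its list of arcs.  The path algebra is represented by its underlying
  vector space with the paths as basis; the multiplication plays no role for its dimension.
\<close>

definition quiver_paths :: "('v, 'a) pre_digraph \<Rightarrow> ('v \<times> 'a list) set" where
  "quiver_paths Q = {(u, p). \<exists>v. pre_digraph.awalk Q u p v}"

definition path_algebra :: "('v, 'a) pre_digraph \<Rightarrow> ('v \<times> 'a list \<Rightarrow>\<^sub>0 'k::field) set" where
  "path_algebra Q = {f. Poly_Mapping.keys f \<subseteq> quiver_paths Q}"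

definition finite_dimensional :: "('b \<Rightarrow>\<^sub>0 'k::field) set \<Rightarrow> bool" where
  "finite_dimensional A \<longleftrightarrow>
     (\<exists>B. finite B \<and> B \<subseteq> A \<and>
        (\<forall>f\<in>A. \<exists>c. f = (\<Sum>b\<in>B. Poly_Mapping.map (\<lambda>t. c b * t) b)))"

text \<open>
  A representation is a pair of a dimension vector and a tuple of matrices.  Every
  finite-dimensional representation is isomorphic to one of this form, so full subcategories
  closed under isomorphisms are given by sets of such representations.
\<close>

type_synonym ('v, 'a, 'k) rep = "('v \<Rightarrow> nat) \<times> ('a \<Rightarrow> 'k mat)"

definition dim_vectors :: "('v, 'a) pre_digraph \<Rightarrow> ('v \<Rightarrow> nat) set" where
  "dim_vectors Q = verts Q \<rightarrow>\<^sub>E UNIV"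

definition rep_space :: "('v, 'a) pre_digraph \<Rightarrow> ('v \<Rightarrow> nat) \<Rightarrow> ('a \<Rightarrow> 'k::field mat) set" where
  "rep_space Q d = (\<Pi>\<^sub>E a\<in>arcs Q. carrier_mat (d (head Q a)) (d (tail Q a)))"

definition reps :: "('v, 'a) pre_digraph \<Rightarrow> ('v, 'a, 'k::field) rep set" where
  "reps Q = {(d, M). d \<in> dim_vectors Q \<and> M \<in> rep_space Q d}"

text \<open>The Zariski topology of the affine space of representations of dimension \<open>d\<close>.\<close>

definition rep_zariski ::
    "('v, 'a) pre_digraph \<Rightarrow> ('v \<Rightarrow> nat) \<Rightarrow> ('a \<Rightarrow> 'k::field mat) topology" where
  "rep_zariski Q d =
     zariski_topology (rep_space Q d) (\<lambda>M. {\<lambda>(a, r, s). M a $$ (r, s)})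
       (polynomials_in {(a, r, s). a \<in> arcs Q \<and> r < d (head Q a) \<and> s < d (tail Q a)})"

lemma openin_rep_zariski:
  "openin (rep_zariski Q d) U \<longleftrightarrow>
     (\<exists>S \<subseteq> polynomials_in {(a, r, s). a \<in> arcs Q \<and> r < d (head Q a) \<and> s < d (tail Q a)}.
        U = {M \<in> rep_space Q d. \<exists>f\<in>S. mpol_eval (\<lambda>(a, r, s). M a $$ (r, s)) f \<noteq> 0})"
proof -
  have eq: "rep_space Q d - zero_locus (rep_space Q d) (\<lambda>M. {\<lambda>(a, r, s). M a $$ (r, s)}) S =
        {M \<in> rep_space Q d. \<exists>f\<in>S. mpol_eval (\<lambda>(a, r, s). M a $$ (r, s)) f \<noteq> 0}" for S
    by (auto simp: zero_locus_def)
  have "istopology (\<lambda>U. \<exists>S \<subseteq> polynomials_in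
          {(a, r, s). a \<in> arcs Q \<and> r < d (head Q a) \<and> s < d (tail Q a)}.
        U = rep_space Q d - zero_locus (rep_space Q d) (\<lambda>M. {\<lambda>(a, r, s). M a $$ (r, s)}) S)"
    by (rule istopology_zariski) (auto intro: mult_in_polynomials_in)
  then show ?thesis
    unfolding rep_zariski_def zariski_topology_def eq
    by (rule fun_cong[OF topology_inverse'])
qed

definition rep_hom ::
    "('v, 'a) pre_digraph \<Rightarrow> ('v, 'a, 'k::field) rep \<Rightarrow> ('v, 'a, 'k) rep \<Rightarrow> ('v \<Rightarrow> 'k mat) set" where
  "rep_hom Q M N =
     {f \<in> \<Pi>\<^sub>E i\<in>verts Q. carrier_mat (fst N i) (fst M i).
        \<forall>a\<in>arcs Q. f (head Q a) * snd M a = snd N a * f (tail Q a)}"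

definition rep_iso ::
    "('v, 'a) pre_digraph \<Rightarrow> ('v, 'a, 'k::field) rep \<Rightarrow> ('v, 'a, 'k) rep \<Rightarrow> bool" where
  "rep_iso Q M N \<longleftrightarrow> (\<exists>f\<in>rep_hom Q M N. \<forall>i\<in>verts Q. invertible_mat (f i))"

definition short_exact ::
    "('v, 'a) pre_digraph \<Rightarrow> ('v, 'a, 'k::field) rep \<Rightarrow> ('v \<Rightarrow> 'k mat) \<Rightarrow> ('v, 'a, 'k) rep
      \<Rightarrow> ('v \<Rightarrow> 'k mat) \<Rightarrow> ('v, 'a, 'k) rep \<Rightarrow> bool" where
  "short_exact Q A f M g B \<longleftrightarrow>
     f \<in> rep_hom Q A M \<and> g \<in> rep_hom Q M B \<and>
     (\<forall>i\<in>verts Q. mat_inj (f i) \<and> mat_range (f i) = mat_kernel (g i) \<and>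
                   mat_range (g i) = carrier_vec (fst B i))"

definition zero_rep :: "('v, 'a) pre_digraph \<Rightarrow> ('v, 'a, 'k::field) rep" where
  "zero_rep Q = (\<lambda>i\<in>verts Q. 0, \<lambda>a\<in>arcs Q. 0\<^sub>m 0 0)"

definition direct_sum ::
    "('v, 'a) pre_digraph \<Rightarrow> ('v, 'a, 'k::field) rep \<Rightarrow> ('v, 'a, 'k) rep \<Rightarrow> ('v, 'a, 'k) rep" where
  "direct_sum Q M N =
     (\<lambda>i\<in>verts Q. fst M i + fst N i,
      \<lambda>a\<in>arcs Q. four_block_mat
        (snd M a) (0\<^sub>m (fst M (head Q a)) (fst N (tail Q a)))
        (0\<^sub>m (fst N (head Q a)) (fst M (tail Q a))) (snd N a))"

definition additively_closed ::
    "('v, 'a) pre_digraph \<Rightarrow> ('v, 'a, 'k::field) rep set \<Rightarrow> bool" where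
  "additively_closed Q E \<longleftrightarrow>
     E \<subseteq> reps Q \<and>
     (\<forall>M\<in>E. \<forall>N\<in>reps Q. rep_iso Q M N \<longrightarrow> N \<in> E) \<and>
     zero_rep Q \<in> E \<and>
     (\<forall>M\<in>E. \<forall>N\<in>E. direct_sum Q M N \<in> E) \<and>
     (\<forall>M\<in>reps Q. \<forall>N\<in>reps Q. direct_sum Q M N \<in> E \<longrightarrow> M \<in> E \<and> N \<in> E)"

definition open_subcategory ::
    "('v, 'a) pre_digraph \<Rightarrow> ('v, 'a, 'k::field) rep set \<Rightarrow> bool" where
  "open_subcategory Q E \<longleftrightarrow>
     additively_closed Q E \<and>
     (\<forall>d\<in>dim_vectors Q. openin (rep_zariski Q d) {M \<in> rep_space Q d. (d, M) \<in> E})"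

definition extension_closed ::
    "('v, 'a) pre_digraph \<Rightarrow> ('v, 'a, 'k::field) rep set \<Rightarrow> bool" where
  "extension_closed Q E \<longleftrightarrow>
     (\<forall>A\<in>E. \<forall>B\<in>E. \<forall>M\<in>reps Q. (\<exists>f g. short_exact Q A f M g B) \<longrightarrow> M \<in> E)"

text \<open>
  The exact structure (all short exact sequences with terms in \<open>E\<close>) is determined by \<open>E\<close>, so it
  is not part of the data.
\<close>

definition open_fully_exact ::
    "('v, 'a) pre_digraph \<Rightarrow> ('v, 'a, 'k::field) rep set \<Rightarrow> bool" where
  "open_fully_exact Q E \<longleftrightarrow> open_subcategory Q E \<and> extension_closed Q E"


section \<open>Grassmannians of subrepresentations\<close>

definition subrepresentations ::
    "('v, 'a) pre_digraph \<Rightarrow> ('v \<Rightarrow> nat) \<Rightarrow> ('v, 'a, 'k::field) rep \<Rightarrow> ('v \<Rightarrow> 'k vec set) set" where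
  "subrepresentations Q e M =
     {U \<in> \<Pi>\<^sub>E i\<in>verts Q. Gr (e i) (fst M i).
        \<forall>a\<in>arcs Q. \<forall>v\<in>U (tail Q a). snd M a *\<^sub>v v \<in> U (head Q a)}"

text \<open>
  \<open>A\<close> is a matrix form of the restriction of \<open>M\<close> to \<open>U\<close>, via an isomorphism onto \<open>U\<close>; \<open>B\<close> is a
  matrix form of \<open>M/U\<close>, via an epimorphism with kernel \<open>U\<close>.
\<close>

definition represents_sub ::
    "('v, 'a) pre_digraph \<Rightarrow> ('v, 'a, 'k::field) rep \<Rightarrow> ('v \<Rightarrow> 'k vec set) \<Rightarrow> ('v, 'a, 'k) rep \<Rightarrow> bool"
  where
  "represents_sub Q M U A \<longleftrightarrow>
     (\<exists>f\<in>rep_hom Q A M. \<forall>i\<in>verts Q. mat_inj (f i) \<and> mat_range (f i) = U i)"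

definition represents_quotient ::
    "('v, 'a) pre_digraph \<Rightarrow> ('v, 'a, 'k::field) rep \<Rightarrow> ('v \<Rightarrow> 'k vec set) \<Rightarrow> ('v, 'a, 'k) rep \<Rightarrow> bool"
  where
  "represents_quotient Q M U B \<longleftrightarrow>
     (\<exists>g\<in>rep_hom Q M B. \<forall>i\<in>verts Q. mat_range (g i) = carrier_vec (fst B i) \<and>
                                        mat_kernel (g i) = U i)"

definition E_Grassmannian ::
    "('v, 'a) pre_digraph \<Rightarrow> ('v, 'a, 'k::field) rep set \<Rightarrow> ('v \<Rightarrow> nat) \<Rightarrow> ('v, 'a, 'k) rep
      \<Rightarrow> ('v \<Rightarrow> 'k vec set, 'k) variety" where
  "E_Grassmannian Q E e M =
     subvariety (Gr_product (verts Q) e (fst M))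
       {U \<in> subrepresentations Q e M.
          (\<exists>A\<in>E. represents_sub Q M U A) \<and> (\<exists>B\<in>E. represents_quotient Q M U B)}"

end

theory Submission
  imports Defs
begin

text \<open>
  A quasi-projective variety \<open>Y\<close> is a locally closed subset of some projective space \<open>P\<^sup>n\<close>.  By
  Noetherianity it is the set of lines \<open>x\<close> at which finitely many forms \<open>f\<close> vanish and at least one
  of finitely many forms \<open>g\<close> does not, and after multiplication by powers of the coordinates all
  these forms have the same degree \<open>d\<close> (\<open>locally_closed_presentation\<close>).  On the Veronese image,
  the line spanned by the vector \<open>x\<^sup>d\<close> of all monomials of degree \<open>d\<close> in \<open>x\<close>, such forms are linear.

  As in Reineke's theorem on projective varieties, lines on the Veronese cone are described by a
  quiver.  It has vertices \<open>0, 1, 2, 3\<close>, and all arrows start at \<open>0\<close>; the representation \<open>V\<close> has the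
  spaces \<open>K\<^sup>N\<close> (with \<open>N\<close> the number of monomials of degree \<open>d\<close>), \<open>K\<^sup>n\<^sup>+\<^sup>1\<close>, \<open>K\<close>, \<open>K\<close>, and the
  subrepresentations of interest have dimension \<open>(1, 1, 0, 1)\<close>.  There is an arrow to \<open>1\<close> for each
  monomial \<open>m\<close> of degree \<open>d - 1\<close>, which takes \<open>w\<close> to the vector of its coordinates at the monomials
  \<open>m x\<^sub>i\<close>.  If all of these maps send a line \<open>\<langle>w\<rangle>\<close> into a line \<open>\<langle>x\<rangle>\<close>, then \<open>w\<close> is a multiple of \<open>x\<^sup>d\<close>
  (\<open>veronese_recognition\<close>).  The arrows to \<open>2\<close> are the forms \<open>f\<close>: as the subspace there is zero, a
  subrepresentation is a point at which they vanish.  The arrows to \<open>3\<close> are the forms \<open>g\<close>, and the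
  subspace there is everything, so that they impose no condition on a subrepresentation.

  The open condition comes from the category.  Let \<open>E\<close> consist of the representations whose space at
  \<open>3\<close> is spanned by the images of the arrows ending there, that is, of those without nonzero
  homomorphism to the simple representation at \<open>3\<close>.  It is closed under quotients and extensions,
  hence under direct sums and summands, and it is open, because having full rank is
  (\<open>open_fully_exact_arrow_generated\<close>).  A subrepresentation as above is in \<open>E\<close> iff some \<open>g\<close> does not
  vanish at \<open>x\<close>, while the quotient is zero at \<open>3\<close> and therefore always in \<open>E\<close>.  So the
  \<open>E\<close>-Grassmannian is, as a set, the given locus.

  The bijection is an isomorphism since both directions are restrictions of morphisms between the
  ambient varieties: the Pluecker coordinates of \<open>(x\<^sup>d, x, 0, K)\<close> are polynomials in the coordinates
  of \<open>x\<close> (\<open>morphism_subst\<close>), and the inverse is the projection to the factor at vertex \<open>1\<close>.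
  Having the line \<open>x\<close> itself as a component is what makes the inverse so simple.
\<close>

abbreviation (input) lookup :: "('a \<Rightarrow>\<^sub>0 'b::zero) \<Rightarrow> 'a \<Rightarrow> 'b" where "lookup \<equiv> Poly_Mapping.lookup"
abbreviation (input) keys :: "('a \<Rightarrow>\<^sub>0 'b::zero) \<Rightarrow> 'a set" where "keys \<equiv> Poly_Mapping.keys"
abbreviation (input) single :: "'a \<Rightarrow> 'b \<Rightarrow> 'a \<Rightarrow>\<^sub>0 'b::zero" where "single \<equiv> Poly_Mapping.single"

section \<open>Morphisms of varieties\<close>

lemma morphism_comp:
  assumes \<phi>: "morphism X Y \<phi>" and \<psi>: "morphism Y Z \<psi>"
  shows "morphism X Z (\<psi> \<circ> \<phi>)"
  unfolding morphism_def
proof (intro conjI allI impI)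
  show "continuous_map (zariski X) (zariski Z) (\<psi> \<circ> \<phi>)"
    using \<phi> \<psi> by (auto simp: morphism_def intro: continuous_map_compose)
  fix W h assume W: "openin (zariski Z) W" and h: "h \<in> regular Z W"
  let ?W = "{q \<in> topspace (zariski Y). \<psi> q \<in> W}"
  have "h \<circ> \<psi> \<in> regular Y ?W" using \<psi> W h by (auto simp: morphism_def)
  moreover have "openin (zariski Y) ?W"
    using \<psi> W by (auto simp: morphism_def intro: openin_continuous_map_preimage)
  ultimately have "h \<circ> \<psi> \<circ> \<phi> \<in> regular X {p \<in> topspace (zariski X). \<phi> p \<in> ?W}"
    using \<phi> by (auto simp: morphism_def)
  moreover have "{p \<in> topspace (zariski X). \<phi> p \<in> ?W} = {p \<in> topspace (zariski X). (\<psi> \<circ> \<phi>) p \<in> W}"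
    using \<phi> by (auto simp: morphism_def continuous_map_def)
  ultimately show "h \<circ> (\<psi> \<circ> \<phi>) \<in> regular X {p \<in> topspace (zariski X). (\<psi> \<circ> \<phi>) p \<in> W}"
    by (simp add: o_assoc)
qed

lemma isomorphic_varieties_trans:
  assumes "isomorphic_varieties X Y" "isomorphic_varieties Y Z"
  shows "isomorphic_varieties X Z"
proof -
  obtain \<phi> \<psi> where 1: "morphism X Y \<phi>" "morphism Y X \<psi>"
    "\<forall>p\<in>topspace (zariski X). \<psi> (\<phi> p) = p" "\<forall>q\<in>topspace (zariski Y). \<phi> (\<psi> q) = q"
    using assms(1) unfolding isomorphic_varieties_def by blast
  obtain \<phi>' \<psi>' where 2: "morphism Y Z \<phi>'" "morphism Z Y \<psi>'"
    "\<forall>p\<in>topspace (zariski Y). \<psi>' (\<phi>' p) = p" "\<forall>q\<in>topspace (zariski Z). \<phi>' (\<psi>' q) = q"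
    using assms(2) unfolding isomorphic_varieties_def by blast
  have "\<phi> p \<in> topspace (zariski Y)" if "p \<in> topspace (zariski X)" for p
    using 1(1) that by (auto simp: morphism_def continuous_map_def)
  moreover have "\<psi>' p \<in> topspace (zariski Y)" if "p \<in> topspace (zariski Z)" for p
    using 2(2) that by (auto simp: morphism_def continuous_map_def)
  ultimately show ?thesis
    unfolding isomorphic_varieties_def
    using 1 2 by (intro exI[of _ "\<phi>' \<circ> \<phi>"] exI[of _ "\<psi> \<circ> \<psi>'"]) (auto intro: morphism_comp)
qed

lemma topspace_subvariety:
  "topspace (zariski (subvariety X A)) = topspace (zariski X) \<inter> A"
  by (simp add: subvariety_def)

lemma morphism_subvariety:
  assumes \<phi>: "morphism X Y \<phi>" and AB: "\<And>p. p \<in> topspace (zariski X) \<inter> A \<Longrightarrow> \<phi> p \<in> B"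
  shows "morphism (subvariety X A) (subvariety Y B) \<phi>"
  unfolding morphism_def
proof (intro conjI allI impI)
  have c: "continuous_map (zariski X) (zariski Y) \<phi>" using \<phi> by (simp add: morphism_def)
  then show "continuous_map (zariski (subvariety X A)) (zariski (subvariety Y B)) \<phi>"
    using AB by (auto simp: subvariety_def continuous_map_in_subtopology
        intro: continuous_map_from_subtopology)
  fix W h
  assume h: "h \<in> regular (subvariety Y B) W"
  have "\<exists>N g. openin (zariski X) N \<and> p \<in> N \<and> g \<in> regular X N \<and>
           (\<forall>q\<in>N \<inter> {p \<in> topspace (zariski X) \<inter> A. \<phi> p \<in> W}. (h \<circ> \<phi>) q = g q)"
    if p: "p \<in> topspace (zariski X) \<inter> A" "\<phi> p \<in> W" for p
  proof -
    obtain N g where N: "openin (zariski Y) N" "\<phi> p \<in> N" "g \<in> regular Y N"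
      "\<forall>q\<in>N \<inter> W. h q = g q"
      using h p by (auto simp: subvariety_def)
    show ?thesis
    proof (intro exI conjI)
      show "openin (zariski X) {p \<in> topspace (zariski X). \<phi> p \<in> N}"
        by (rule openin_continuous_map_preimage[OF c N(1)])
      show "g \<circ> \<phi> \<in> regular X {p \<in> topspace (zariski X). \<phi> p \<in> N}"
        using \<phi> N by (auto simp: morphism_def)
    qed (use N p in auto)
  qed
  then show "h \<circ> \<phi> \<in> regular (subvariety X A) {p \<in> topspace (zariski (subvariety X A)). \<phi> p \<in> W}"
    unfolding topspace_subvariety by (auto simp: subvariety_def)
qed

text \<open>
  The two morphisms need to be defined on the ambient varieties, but inverse to each other only on
  the given subsets.
\<close>

lemma isomorphic_subvarieties:
  assumes "morphism X Y \<phi>" "morphism Y X \<psi>"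
    and "\<And>p. p \<in> topspace (zariski X) \<inter> A \<Longrightarrow> \<phi> p \<in> B \<and> \<psi> (\<phi> p) = p"
    and "\<And>q. q \<in> topspace (zariski Y) \<inter> B \<Longrightarrow> \<psi> q \<in> A \<and> \<phi> (\<psi> q) = q"
  shows "isomorphic_varieties (subvariety X A) (subvariety Y B)"
  unfolding isomorphic_varieties_def
  by (intro exI[of _ \<phi>] exI[of _ \<psi>]) (use assms in \<open>auto intro: morphism_subvariety simp: topspace_subvariety\<close>)

lemma regular_multiprojective_iff:
  "h \<in> regular (multiprojective_variety X blk P crd) W \<longleftrightarrow>
     (\<forall>p\<in>W. \<exists>N f g \<delta>. openin (zariski (multiprojective_variety X blk P crd)) N \<and> p \<in> N \<and> N \<subseteq> W \<and>
        f \<in> multihomogeneous X blk \<delta> \<and> g \<in> multihomogeneous X blk \<delta> \<and>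
        (\<forall>q\<in>N. \<forall>c\<in>crd q. mpol_eval c g \<noteq> 0 \<and> h q = mpol_eval c f / mpol_eval c g))"
  by (simp add: multiprojective_variety_def Let_def)

lemma regular_multiprojective_mono:
  assumes h: "h \<in> regular (multiprojective_variety X blk P crd) W"
    and W': "openin (zariski (multiprojective_variety X blk P crd)) W'" "W' \<subseteq> W"
  shows "h \<in> regular (multiprojective_variety X blk P crd) W'"
  unfolding regular_multiprojective_iff
proof
  fix p assume p: "p \<in> W'"
  with W'(2) have "p \<in> W" by blast
  from h[unfolded regular_multiprojective_iff, rule_format, OF this]
  obtain N f g \<delta> where N: "openin (zariski (multiprojective_variety X blk P crd)) N" "p \<in> N" "N \<subseteq> W"
      "f \<in> multihomogeneous X blk \<delta>" "g \<in> multihomogeneous X blk \<delta>"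
      "\<forall>q\<in>N. \<forall>c\<in>crd q. mpol_eval c g \<noteq> 0 \<and> h q = mpol_eval c f / mpol_eval c g"
    by (elim exE conjE)
  show "\<exists>N f g \<delta>. openin (zariski (multiprojective_variety X blk P crd)) N \<and> p \<in> N \<and> N \<subseteq> W' \<and>
        f \<in> multihomogeneous X blk \<delta> \<and> g \<in> multihomogeneous X blk \<delta> \<and>
        (\<forall>q\<in>N. \<forall>c\<in>crd q. mpol_eval c g \<noteq> 0 \<and> h q = mpol_eval c f / mpol_eval c g)"
    by (rule exI[of _ "N \<inter> W'"], rule exI[of _ f], rule exI[of _ g], rule exI[of _ \<delta>])
       (use N p W' in auto)
qed

text \<open>
  A regular function on an iterated subvariety is locally the restriction of a function on a locally
  closed set, which in turn is locally the restriction of a function \<open>g\<^sub>2\<close> on an open set of \<open>V\<close>.  Then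
  \<open>g\<^sub>2\<close> has to be restricted to a smaller open set; this is possible in a multiprojective variety, but
  not for the values of \<open>regular\<close> in an arbitrary record.
\<close>

lemma subvariety_subvariety_iso:
  fixes X blk P crd defines "V \<equiv> multiprojective_variety X blk P crd"
  shows "isomorphic_varieties (subvariety (subvariety V A) B) (subvariety V (A \<inter> B))"
proof -
  have top: "zariski (subvariety (subvariety V A) B) = zariski (subvariety V (A \<inter> B))"
    by (simp add: subvariety_def subtopology_subtopology)
  have "regular (subvariety (subvariety V A) B) W = regular (subvariety V (A \<inter> B)) W"
    if W: "openin (zariski (subvariety V (A \<inter> B))) W" for W
  proof
    show "regular (subvariety (subvariety V A) B) W \<subseteq> regular (subvariety V (A \<inter> B)) W"
    proof
      fix h assume h: "h \<in> regular (subvariety (subvariety V A) B) W"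
      have "\<exists>N g. openin (zariski V) N \<and> p \<in> N \<and> g \<in> regular V N \<and> (\<forall>q\<in>N \<inter> W. h q = g q)"
        if p: "p \<in> W" for p
      proof -
        obtain N g where N: "openin (subtopology (zariski V) A) N" "p \<in> N"
          "g \<in> regular (subvariety V A) N" "\<forall>q\<in>N \<inter> W. h q = g q"
          using h p by (auto simp: subvariety_def)
        obtain N2 g2 where N2: "openin (zariski V) N2" "p \<in> N2" "g2 \<in> regular V N2"
          "\<forall>q\<in>N2 \<inter> N. g q = g2 q"
          using N by (auto simp: subvariety_def)
        obtain N3 where N3: "openin (zariski V) N3" "N = N3 \<inter> A"
          using N(1) by (auto simp: openin_subtopology)
        have op: "openin (zariski V) (N2 \<inter> N3)" using N2 N3 by blast
        have WA: "W \<subseteq> A" using W by (auto simp: subvariety_def openin_subtopology)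
        show ?thesis
        proof (intro exI conjI)
          show "openin (zariski V) (N2 \<inter> N3)" by fact
          show "g2 \<in> regular V (N2 \<inter> N3)"
            using regular_multiprojective_mono[of g2 X blk P crd N2 "N2 \<inter> N3"] N2(3) op
            unfolding V_def by blast
        qed (use N N2 N3 WA p in auto)
      qed
      then show "h \<in> regular (subvariety V (A \<inter> B)) W" by (auto simp: subvariety_def)
    qed
    show "regular (subvariety V (A \<inter> B)) W \<subseteq> regular (subvariety (subvariety V A) B) W"
    proof
      fix h assume h: "h \<in> regular (subvariety V (A \<inter> B)) W"
      have WA: "W \<subseteq> A" using W by (auto simp: subvariety_def openin_subtopology)
      have "\<exists>N g. openin (subtopology (zariski V) A) N \<and> p \<in> N \<and>
          (\<forall>p\<in>N. \<exists>N' g'. openin (zariski V) N' \<and> p \<in> N' \<and> g' \<in> regular V N' \<and> (\<forall>q\<in>N' \<inter> N. g q = g' q)) \<and>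
          (\<forall>q\<in>N \<inter> W. h q = g q)"
        if p: "p \<in> W" for p
      proof -
        obtain N g where N: "openin (zariski V) N" "p \<in> N" "g \<in> regular V N" "\<forall>q\<in>N \<inter> W. h q = g q"
          using h p by (auto simp: subvariety_def)
        show ?thesis
        proof (rule exI[of _ "N \<inter> A"], rule exI[of _ g], intro conjI ballI)
          show "openin (subtopology (zariski V) A) (N \<inter> A)"
            using N(1) by (auto simp: openin_subtopology)
          fix q assume "q \<in> N \<inter> A"
          then show "\<exists>N' g'. openin (zariski V) N' \<and> q \<in> N' \<and> g' \<in> regular V N' \<and>
              (\<forall>r\<in>N' \<inter> (N \<inter> A). g r = g' r)"
            using N by blast
        qed (use N WA p in auto)
      qed
      then show "h \<in> regular (subvariety (subvariety V A) B) W" by (auto simp: subvariety_def)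
    qed
  qed
  note reg = this
  have *: "topspace (zariski (subvariety V (A \<inter> B))) = topspace (zariski V) \<inter> (A \<inter> B)"
    by (simp add: topspace_subvariety)
  have sub: "{p \<in> topspace (zariski (subvariety V (A \<inter> B))). p \<in> W} = W"
    if "openin (zariski (subvariety V (A \<inter> B))) W" for W
    using openin_subset[OF that] by blast
  show ?thesis unfolding isomorphic_varieties_def morphism_def top
    by (intro exI[of _ "\<lambda>p. p"]) (simp add: reg sub comp_def)
qed

section \<open>Morphisms given by polynomials\<close>

definition mpol_subst :: "('y \<Rightarrow> ('x, 'k::comm_semiring_1) mpol) \<Rightarrow> ('y, 'k) mpol \<Rightarrow> ('x, 'k) mpol" where
  "mpol_subst q f = (\<Sum>m\<in>keys f.
     single 0 (lookup f m) * mon_eval q m)"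

lemma mpol_eval_prod: "mpol_eval c (\<Prod>i\<in>I. f i) = (\<Prod>i\<in>I. mpol_eval c (f i))"
  by (induction I rule: infinite_finite_induct) (simp_all add: mpol_eval_mult)

lemma mpol_eval_power: "mpol_eval c (f ^ n) = mpol_eval c f ^ n"
  by (induction n) (simp_all add: mpol_eval_mult)

lemma mon_eval_0 [simp]: "mon_eval c 0 = 1"
  by (simp add: mon_eval_def)

lemma mon_eval_single: "mon_eval c (single x k) = c x ^ k"
  by (cases "k = 0") (simp_all add: mon_eval_def)

lemma block_degree_single: "block_degree blk (single x k) i = (if blk x = i then k else 0)"
proof (cases "blk x = i")
  case True
  then have "block_degree blk (single x k) i = (\<Sum>y\<in>{y\<in>{x}. blk y = i}. lookup (single x k) y)"
    by (intro block_degree_superset) (auto split: if_splits)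
  also have "{y\<in>{x}. blk y = i} = {x}" using True by auto
  finally show ?thesis using True by simp
next
  case False
  then have "block_degree blk (single x k) i = (\<Sum>y\<in>{y\<in>{x}. blk y = i}. lookup (single x k) y)"
    by (intro block_degree_superset) (auto split: if_splits)
  also have "{y\<in>{x}. blk y = i} = {}" using False by auto
  finally show ?thesis using False by simp
qed

lemma mpol_eval_subst: "mpol_eval c (mpol_subst q f) = mpol_eval (\<lambda>y. mpol_eval c (q y)) f"
  by (simp add: mpol_subst_def mpol_eval_sum mpol_eval_mult mpol_eval_single
      mpol_eval_prod mpol_eval_power mpol_eval_def[of _ f] mon_eval_def[where c = q]
      mon_eval_def[where c = "\<lambda>y. mpol_eval c (q y)"])

lemma zero_multihomogeneous: "0 \<in> multihomogeneous X blk \<delta>"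
  by (simp add: multihomogeneous_def polynomials_in_def)

lemma add_multihomogeneous:
  fixes f g :: "('x, 'k::comm_monoid_add) mpol"
  assumes "f \<in> multihomogeneous X blk \<delta>" "g \<in> multihomogeneous X blk \<delta>"
  shows "f + g \<in> multihomogeneous X blk \<delta>"
  using assms keys_add[of f g]
  unfolding multihomogeneous_def polynomials_in_def by blast

lemma sum_multihomogeneous:
  fixes f :: "'i \<Rightarrow> ('x, 'k::comm_monoid_add) mpol"
  assumes "\<And>i. i \<in> I \<Longrightarrow> f i \<in> multihomogeneous X blk \<delta>"
  shows "(\<Sum>i\<in>I. f i) \<in> multihomogeneous X blk \<delta>"
  using assms
  by (induction I rule: infinite_finite_induct) (auto intro: zero_multihomogeneous add_multihomogeneous)

lemma prod_multihomogeneous: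
  fixes f :: "'i \<Rightarrow> ('x, 'k::comm_semiring_1) mpol"
  assumes "\<And>i. i \<in> I \<Longrightarrow> f i \<in> multihomogeneous X blk (\<delta> i)"
  shows "(\<Prod>i\<in>I. f i) \<in> multihomogeneous X blk (\<lambda>b. \<Sum>i\<in>I. \<delta> i b)"
  using assms
  by (induction I rule: infinite_finite_induct)
     (auto intro: one_multihomogeneous mult_multihomogeneous)

lemma power_multihomogeneous:
  fixes f :: "('x, 'k::comm_semiring_1) mpol"
  assumes "f \<in> multihomogeneous X blk \<delta>"
  shows "f ^ n \<in> multihomogeneous X blk (\<lambda>b. n * \<delta> b)"
  using prod_multihomogeneous[of "{..<n}" "\<lambda>_. f" X blk "\<lambda>_. \<delta>"] assms by simp

lemma single_multihomogeneous:
  assumes "keys m \<subseteq> X"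
  shows "single m a \<in> multihomogeneous X blk (block_degree blk m)"
  using assms by (auto simp: multihomogeneous_def polynomials_in_def)

text \<open>
  Substituting for each variable of block \<open>j\<close> a form of multidegree \<open>D j\<close> turns multidegree \<open>\<delta>\<close> into
  \<open>\<Sum>j. \<delta> j * D j\<close>.  That this depends on \<open>\<delta>\<close> only is needed to pull back quotients of forms of equal
  multidegree.
\<close>

lemma mpol_subst_multihomogeneous:
  fixes f :: "('y, 'k::comm_semiring_1) mpol"
  assumes f: "f \<in> multihomogeneous Y blk' \<delta>" and J: "finite J" "blk' ` Y \<subseteq> J"
    and q: "\<And>y. y \<in> Y \<Longrightarrow> q y \<in> multihomogeneous X blk (D (blk' y))"
  shows "mpol_subst q f \<in> multihomogeneous X blk (\<lambda>b. \<Sum>j\<in>J. \<delta> j * D j b)"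
  unfolding mpol_subst_def
proof (rule sum_multihomogeneous)
  let ?l = lookup and ?k = keys
  fix m assume m: "m \<in> ?k f"
  have mY: "?k m \<subseteq> Y" and deg: "block_degree blk' m = \<delta>"
    using f m by (auto simp: multihomogeneous_def polynomials_in_def)
  have "mon_eval q m \<in> multihomogeneous X blk (\<lambda>b. \<Sum>y\<in>?k m. ?l m y * D (blk' y) b)"
    unfolding mon_eval_def by (intro prod_multihomogeneous power_multihomogeneous q) (use mY in auto)
  moreover have "(\<Sum>y\<in>?k m. ?l m y * D (blk' y) b) = (\<Sum>j\<in>J. \<delta> j * D j b)" for b
  proof -
    have "(\<Sum>y\<in>?k m. ?l m y * D (blk' y) b) = (\<Sum>j\<in>J. \<Sum>y\<in>{y\<in>?k m. blk' y = j}. ?l m y * D (blk' y) b)"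
      by (rule sum.group[symmetric]) (use J mY in auto)
    also have "\<dots> = (\<Sum>j\<in>J. \<delta> j * D j b)"
      by (rule sum.cong) (auto simp: deg[symmetric] block_degree_def sum_distrib_right)
    finally show ?thesis .
  qed
  moreover have "block_degree blk 0 = (\<lambda>_. 0)" by (simp add: block_degree_def fun_eq_iff)
  then have "single 0 (?l f m) \<in> multihomogeneous X blk (\<lambda>_. 0)"
    using single_multihomogeneous[of 0 X "?l f m" blk] by simp
  ultimately show "single 0 (?l f m) * mon_eval q m \<in>
      multihomogeneous X blk (\<lambda>b. \<Sum>j\<in>J. \<delta> j * D j b)"
    using mult_multihomogeneous by fastforce
qed

text \<open>
  The coordinate tuples of one point of a multiprojective variety: there is one, and it is unique up
  to a nonzero scalar for each block.
\<close>

definition block_scaled :: "'x set \<Rightarrow> ('x \<Rightarrow> 'i) \<Rightarrow> ('x \<Rightarrow> 'k::field) set \<Rightarrow> bool" where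
  "block_scaled X blk C \<longleftrightarrow> C \<noteq> {} \<and>
     (\<forall>c\<in>C. \<forall>c'\<in>C. \<exists>t. (\<forall>i. t i \<noteq> 0) \<and> (\<forall>x\<in>X. c' x = t (blk x) * c x))"

lemma openin_multiprojective:
  fixes crd :: "'p \<Rightarrow> ('x \<Rightarrow> 'k::field) set"
  assumes "\<And>p. p \<in> P \<Longrightarrow> block_scaled X blk (crd p)"
  shows "openin (zariski (multiprojective_variety X blk P crd)) U \<longleftrightarrow>
           (\<exists>S\<subseteq>(\<Union>\<delta>. multihomogeneous X blk \<delta>). U = P - zero_locus P crd S)"
  unfolding multiprojective_variety_def Let_def variety.simps
  by (rule openin_zariski_multihomogeneous) (use assms in \<open>auto simp: block_scaled_def\<close>)

lemma topspace_multiprojective: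
  fixes crd :: "'p \<Rightarrow> ('x \<Rightarrow> 'k::field) set"
  assumes crd: "\<And>p. p \<in> P \<Longrightarrow> block_scaled X blk (crd p)"
  shows "topspace (zariski (multiprojective_variety X blk P crd)) = P" (is "topspace ?T = P")
proof
  have op: "openin ?T U \<longleftrightarrow> (\<exists>S\<subseteq>(\<Union>\<delta>. multihomogeneous X blk \<delta>). U = P - zero_locus P crd S)" for U
    by (rule openin_multiprojective) (rule crd)
  have "openin ?T (topspace ?T)" by (rule openin_topspace)
  then obtain S where "topspace ?T = P - zero_locus P crd S" unfolding op by (elim exE conjE)
  then show "topspace ?T \<subseteq> P" by simp
  have "crd p \<noteq> {}" if "p \<in> P" for p using crd[OF that] by (simp add: block_scaled_def)
  then have "P = P - zero_locus P crd {1}"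
    by (auto simp: zero_locus_def)
  moreover have "{1 :: ('x, 'k) mpol} \<subseteq> (\<Union>\<delta>. multihomogeneous X blk \<delta>)"
    using UN_I[where B = "multihomogeneous X blk", OF UNIV_I one_multihomogeneous] by simp
  ultimately have "openin ?T P" unfolding op by (intro exI[of _ "{1}"] conjI)
  then show "P \<subseteq> topspace ?T"
    by (rule openin_subset)
qed

text \<open>
  A map that is given by multihomogeneous polynomials in the coordinates is a morphism, because the
  pullback of a form, and of a quotient of forms, is obtained by substitution.  It is enough that
  one of the coordinate tuples of the image point is computed by the polynomials: the vanishing of a
  form does not depend on the tuple, and a regular function is given by its quotient on all of them.
\<close>

lemma morphism_subst:
  fixes crd :: "'p \<Rightarrow> ('x \<Rightarrow> 'k::field) set" and crd' :: "'q \<Rightarrow> ('y \<Rightarrow> 'k) set"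
  assumes s: "\<And>p. p \<in> P \<Longrightarrow> block_scaled X blk (crd p)"
    and s': "\<And>p. p \<in> P' \<Longrightarrow> block_scaled Y blk' (crd' p)"
    and J: "finite J" "blk' ` Y \<subseteq> J"
    and q: "\<And>y. y \<in> Y \<Longrightarrow> q y \<in> multihomogeneous X blk (D (blk' y))"
    and \<phi>: "\<And>p. p \<in> P \<Longrightarrow> \<phi> p \<in> P'"
    and c: "\<And>p c. p \<in> P \<Longrightarrow> c \<in> crd p \<Longrightarrow> \<exists>c'\<in>crd' (\<phi> p). \<forall>y\<in>Y. c' y = mpol_eval c (q y)"
  shows "morphism (multiprojective_variety X blk P crd) (multiprojective_variety Y blk' P' crd') \<phi>"
    (is "morphism ?V ?V' \<phi>")
proof -
  define H where "H = (\<Union>\<delta>. multihomogeneous X blk \<delta> :: ('x, 'k) mpol set)"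
  define H' where "H' = (\<Union>\<delta>. multihomogeneous Y blk' \<delta> :: ('y, 'k) mpol set)"
  have op: "openin (zariski ?V) U \<longleftrightarrow> (\<exists>S\<subseteq>H. U = P - zero_locus P crd S)" for U
    unfolding H_def by (rule openin_multiprojective) (rule s)
  have op': "openin (zariski ?V') U \<longleftrightarrow> (\<exists>S\<subseteq>H'. U = P' - zero_locus P' crd' S)" for U
    unfolding H'_def by (rule openin_multiprojective) (rule s')
  have top: "topspace (zariski ?V) = P" by (rule topspace_multiprojective) (rule s)
  have top': "topspace (zariski ?V') = P'" by (rule topspace_multiprojective) (rule s')
  have eval: "\<exists>c'\<in>crd' (\<phi> p). \<forall>f\<in>polynomials_in Y. mpol_eval c' f = mpol_eval c (mpol_subst q f)"
    if p: "p \<in> P" "c \<in> crd p" for p c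
  proof -
    obtain c' where c': "c' \<in> crd' (\<phi> p)" "\<forall>y\<in>Y. c' y = mpol_eval c (q y)" using c[OF p] by blast
    have "mpol_eval c' f = mpol_eval c (mpol_subst q f)" if f: "f \<in> polynomials_in Y" for f
      unfolding mpol_eval_subst mpol_eval_def[of _ f] mon_eval_def
      by (intro sum.cong prod.cong refl arg_cong2[where f = "(*)"] arg_cong2[where f = "(^)"])
         (use f c' in \<open>auto simp: polynomials_in_def\<close>)
    with c' show ?thesis by blast
  qed
  have indep: "mpol_eval c2 f = 0"
    if a: "p \<in> P'" "c1 \<in> crd' p" "c2 \<in> crd' p" "f \<in> H'" "mpol_eval c1 f = 0" for p c1 c2 f
  proof -
    obtain \<delta> where \<delta>: "f \<in> multihomogeneous Y blk' \<delta>" using a(4) unfolding H'_def by (rule UN_E)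
    obtain t where t: "\<And>i. t i \<noteq> 0" "\<And>x. x \<in> Y \<Longrightarrow> c2 x = t (blk' x) * c1 x"
      using s'[OF a(1)] a(2,3) unfolding block_scaled_def by blast
    show ?thesis using multihomogeneous_scale[where t = t and c = c1 and c' = c2, OF \<delta> t] a(5) by force
  qed
  have H_poly: "f \<in> polynomials_in Y" if "f \<in> H'" for f
    using that unfolding H'_def by (auto simp: multihomogeneous_def)
  have sub_H: "mpol_subst q f \<in> H" if f: "f \<in> H'" for f
  proof -
    obtain \<delta> where "f \<in> multihomogeneous Y blk' \<delta>" using f unfolding H'_def by (rule UN_E)
    then have "mpol_subst q f \<in> multihomogeneous X blk (\<lambda>b. \<Sum>j\<in>J. \<delta> j * D j b)"
      by (rule mpol_subst_multihomogeneous[OF _ J]) (rule q)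
    then show ?thesis unfolding H_def by (rule UN_I[where B = "multihomogeneous X blk", OF UNIV_I])
  qed
  have pre: "\<exists>S'\<subseteq>H. {p \<in> P. \<phi> p \<in> U} = P - zero_locus P crd S'"
    if S: "S \<subseteq> H'" "U = P' - zero_locus P' crd' S" for U S
  proof (intro exI[of _ "mpol_subst q ` S"] conjI)
    show "mpol_subst q ` S \<subseteq> H" using sub_H S(1) by blast
    have "\<phi> p \<in> zero_locus P' crd' S \<longleftrightarrow> p \<in> zero_locus P crd (mpol_subst q ` S)" if p: "p \<in> P" for p
    proof
      assume a: "\<phi> p \<in> zero_locus P' crd' S"
      have "mpol_eval c (mpol_subst q f) = 0" if fc: "f \<in> S" "c \<in> crd p" for f c
      proof -
        obtain c' where "c' \<in> crd' (\<phi> p)"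
          "\<forall>f\<in>polynomials_in Y. mpol_eval c' f = mpol_eval c (mpol_subst q f)"
          using eval[OF p fc(2)] by blast
        moreover have "f \<in> polynomials_in Y" using fc(1) S(1) H_poly by blast
        moreover have "mpol_eval c' f = 0" if "c' \<in> crd' (\<phi> p)" for c'
          using a fc(1) that by (simp add: zero_locus_def)
        ultimately show ?thesis by fastforce
      qed
      then show "p \<in> zero_locus P crd (mpol_subst q ` S)" using p by (auto simp: zero_locus_def)
    next
      assume a: "p \<in> zero_locus P crd (mpol_subst q ` S)"
      obtain c0 where c0: "c0 \<in> crd p" using s[OF p] by (auto simp: block_scaled_def)
      obtain c' where c': "c' \<in> crd' (\<phi> p)"
        "\<forall>f\<in>polynomials_in Y. mpol_eval c' f = mpol_eval c0 (mpol_subst q f)"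
        using eval[OF p c0] by blast
      have "mpol_eval c f = 0" if "f \<in> S" "c \<in> crd' (\<phi> p)" for f c
      proof (rule indep[OF \<phi>[OF p] c'(1) that(2)])
        show "f \<in> H'" using that S(1) by blast
        then show "mpol_eval c' f = 0" using c' a c0 that H_poly by (simp add: zero_locus_def)
      qed
      then show "\<phi> p \<in> zero_locus P' crd' S" using \<phi>[OF p] by (auto simp: zero_locus_def)
    qed
    then show "{p \<in> P. \<phi> p \<in> U} = P - zero_locus P crd (mpol_subst q ` S)" using S(2) \<phi> by blast
  qed
  have cont: "continuous_map (zariski ?V) (zariski ?V') \<phi>"
    unfolding continuous_map_def top top'
  proof (intro conjI allI impI funcsetI \<phi>)
    fix U assume "openin (zariski ?V') U"
    then obtain S where "S \<subseteq> H'" "U = P' - zero_locus P' crd' S" unfolding op' by (elim exE conjE)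
    then show "openin (zariski ?V) {p \<in> P. \<phi> p \<in> U}" unfolding op by (rule pre)
  qed
  have "h \<circ> \<phi> \<in> regular ?V {p \<in> P. \<phi> p \<in> W}" if W: "openin (zariski ?V') W" "h \<in> regular ?V' W" for W h
    unfolding regular_multiprojective_iff
  proof
    fix p assume p: "p \<in> {p \<in> P. \<phi> p \<in> W}"
    then have "\<phi> p \<in> W" by simp
    from W(2)[unfolded regular_multiprojective_iff, rule_format, OF this]
    obtain N f g \<delta> where N: "openin (zariski ?V') N" "\<phi> p \<in> N" "N \<subseteq> W"
        "f \<in> multihomogeneous Y blk' \<delta>" "g \<in> multihomogeneous Y blk' \<delta>"
        "\<forall>q\<in>N. \<forall>c\<in>crd' q. mpol_eval c g \<noteq> 0 \<and> h q = mpol_eval c f / mpol_eval c g"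
      by (elim exE conjE)
    show "\<exists>N f g \<delta>. openin (zariski ?V) N \<and> p \<in> N \<and> N \<subseteq> {p \<in> P. \<phi> p \<in> W} \<and>
          f \<in> multihomogeneous X blk \<delta> \<and> g \<in> multihomogeneous X blk \<delta> \<and>
          (\<forall>q\<in>N. \<forall>c\<in>crd q. mpol_eval c g \<noteq> 0 \<and> (h \<circ> \<phi>) q = mpol_eval c f / mpol_eval c g)"
    proof (intro exI conjI ballI)
      show "openin (zariski ?V) {p \<in> P. \<phi> p \<in> N}"
        using openin_continuous_map_preimage[OF cont N(1)] unfolding top .
      show "mpol_subst q f \<in> multihomogeneous X blk (\<lambda>b. \<Sum>j\<in>J. \<delta> j * D j b)"
        by (rule mpol_subst_multihomogeneous[OF N(4) J]) (rule q)
      show "mpol_subst q g \<in> multihomogeneous X blk (\<lambda>b. \<Sum>j\<in>J. \<delta> j * D j b)"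
        by (rule mpol_subst_multihomogeneous[OF N(5) J]) (rule q)
      fix r c assume r: "r \<in> {p \<in> P. \<phi> p \<in> N}" "c \<in> crd r"
      then obtain c' where c': "c' \<in> crd' (\<phi> r)"
        "\<forall>f\<in>polynomials_in Y. mpol_eval c' f = mpol_eval c (mpol_subst q f)"
        using eval[of r c] by blast
      have "f \<in> polynomials_in Y" "g \<in> polynomials_in Y"
        using N(4,5) by (simp_all add: multihomogeneous_def)
      with c' N(6) r show "mpol_eval c (mpol_subst q g) \<noteq> 0"
          "(h \<circ> \<phi>) r = mpol_eval c (mpol_subst q f) / mpol_eval c (mpol_subst q g)"
        by auto
    qed (use p N in auto)
  qed
  with cont show ?thesis unfolding morphism_def top by blast
qed

section \<open>Zero loci are defined by finitely many equations\<close>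

lemma mono_subsequence_nat:
  fixes s :: "nat \<Rightarrow> nat"
  shows "\<exists>r :: nat \<Rightarrow> nat. strict_mono r \<and> mono (s \<circ> r)"
proof -
  obtain r :: "nat \<Rightarrow> nat" where r: "strict_mono r" "monoseq (\<lambda>n. s (r n))"
    using seq_monosub[of s] by blast
  show ?thesis
  proof (cases "\<forall>m. \<forall>n\<ge>m. s (r m) \<le> s (r n)")
    case True
    with r show ?thesis by (intro exI[of _ r]) (auto simp: mono_def)
  next
    case False
    then have dec: "\<forall>m. \<forall>n\<ge>m. s (r n) \<le> s (r m)" using r(2) by (auto simp: monoseq_def)
    obtain N where N: "\<And>n. s (r N) \<le> s (r n)"
      using ex_has_least_nat[of "\<lambda>_. True" 0 "\<lambda>n. s (r n)"] by auto
    have "s (r (N + n)) = s (r N)" for n using N dec by (simp add: order_antisym)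
    then have "mono (s \<circ> (\<lambda>n. r (N + n)))" by (simp add: mono_def)
    moreover have "strict_mono (\<lambda>n. r (N + n))" using r(1) by (simp add: strict_mono_def)
    ultimately show ?thesis by blast
  qed
qed

text \<open>
  Thinning out the sequence once for each coordinate.
\<close>

lemma mono_subsequence_family:
  fixes s :: "nat \<Rightarrow> 'x \<Rightarrow> nat"
  assumes "finite X"
  shows "\<exists>r :: nat \<Rightarrow> nat. strict_mono r \<and> (\<forall>x\<in>X. mono (\<lambda>n. s (r n) x))"
  using assms
proof induction
  case empty
  show ?case by (intro exI[of _ "\<lambda>n. n"]) (simp add: strict_mono_def)
next
  case (insert x X)
  then obtain r :: "nat \<Rightarrow> nat" where r: "strict_mono r" "\<forall>x\<in>X. mono (\<lambda>n. s (r n) x)" by blast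
  obtain r' :: "nat \<Rightarrow> nat" where r': "strict_mono r'" "mono ((\<lambda>n. s (r n) x) \<circ> r')"
    using mono_subsequence_nat by blast
  have "strict_mono (r \<circ> r')" using r(1) r'(1) by (simp add: strict_mono_def)
  moreover have "\<forall>y\<in>insert x X. mono (\<lambda>n. s ((r \<circ> r') n) y)"
    using r(2) r' by (auto simp: mono_def strict_mono_less_eq)
  ultimately show ?case by blast
qed

text \<open>
  Dickson's lemma: in a sequence of monomials in finitely many variables some term divides a later
  one, since a subsequence is monotone in all exponents.
\<close>

lemma dickson:
  fixes s :: "nat \<Rightarrow> ('x \<Rightarrow>\<^sub>0 nat)"
  assumes X: "finite X" "\<And>n. keys (s n) \<subseteq> X"
  shows "\<exists>i j m. i < j \<and> s j = s i + m"
proof -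
  obtain r :: "nat \<Rightarrow> nat" where r: "strict_mono r" "\<forall>x\<in>X. mono (\<lambda>n. lookup (s (r n)) x)"
    using mono_subsequence_family[OF X(1), of "\<lambda>n. lookup (s n)"] by blast
  have le: "lookup (s (r 0)) x \<le> lookup (s (r 1)) x" for x
  proof (cases "x \<in> X")
    case True then show ?thesis using r(2) by (auto simp: mono_def)
  next
    case False
    then have "lookup (s (r 0)) x = 0" using X(2) by (metis in_keys_iff subsetD)
    then show ?thesis by simp
  qed
  have "s (r 1) = s (r 0) + (s (r 1) - s (r 0))"
    by (rule poly_mapping_eqI) (use le in \<open>simp add: lookup_add lookup_minus\<close>)
  moreover have "r 0 < r 1" using r(1) by (simp add: strict_mono_def)
  ultimately show ?thesis by blast
qed

text \<open>
  The elements of \<open>L\<close> that are minimal for divisibility form an antichain, which is finite by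
  Dickson's lemma.
\<close>

lemma finite_divisor_basis:
  fixes L :: "('x \<Rightarrow>\<^sub>0 nat) set"
  assumes X: "finite X" "\<And>l. l \<in> L \<Longrightarrow> keys l \<subseteq> X"
  shows "\<exists>B\<subseteq>L. finite B \<and> (\<forall>l\<in>L. \<exists>b\<in>B. \<exists>m. l = b + m)"
proof -
  define B where "B = {b\<in>L. \<forall>l\<in>L. (\<exists>m. b = l + m) \<longrightarrow> l = b}"
  have "finite B"
  proof (rule ccontr)
    assume "infinite B"
    then obtain s :: "nat \<Rightarrow> _" where s: "inj s" "range s \<subseteq> B"
      using infinite_countable_subset by blast
    obtain i j m where ij: "i < j" "s j = s i + m"
    proof -
      have "keys (s n) \<subseteq> X" for n using X(2) s(2) by (auto simp: B_def)
      with dickson[OF X(1), of s] show ?thesis using that by blast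
    qed
    have "s i \<in> L" "s j \<in> B" using s(2) by (auto simp: B_def)
    then have "s i = s j" using ij(2) by (auto simp: B_def)
    then show False using s(1) ij(1) by (auto simp: inj_def)
  qed
  moreover have "\<exists>b\<in>B. \<exists>m. l = b + m" if l: "l \<in> L" for l
  proof -
    let ?deg = "\<lambda>m :: 'x \<Rightarrow>\<^sub>0 nat. \<Sum>x\<in>X. lookup m x"
    have "l \<in> L \<and> (\<exists>m. l = l + m)" using l by (metis add.right_neutral)
    then obtain b where b: "b \<in> L" "\<exists>m. l = b + m"
      and min: "\<And>b'. b' \<in> L \<Longrightarrow> \<exists>m. l = b' + m \<Longrightarrow> ?deg b \<le> ?deg b'"
      using ex_has_least_nat[of "\<lambda>b. b \<in> L \<and> (\<exists>m. l = b + m)" l ?deg] by blast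
    have "l' = b" if l': "l' \<in> L" "b = l' + m" for l' m
    proof -
      have "\<exists>m. l = l' + m" using b(2) l'(2) by (metis add.assoc)
      then have "?deg b \<le> ?deg l'" using min l'(1) by blast
      then have "?deg m = 0" by (simp add: l'(2) lookup_add sum.distrib)
      then have z: "\<forall>x\<in>X. lookup m x = 0" using X(1) by simp
      have "lookup m x = 0" for x
      proof (cases "x \<in> X")
        case False
        then have "lookup b x = 0" using X(2)[OF b(1)] by (metis in_keys_iff subsetD)
        then show ?thesis by (simp add: l'(2) lookup_add)
      qed (use z in auto)
      then have "m = 0" by (intro poly_mapping_eqI) simp
      then show ?thesis using l'(2) by simp
    qed
    then have "b \<in> B" using b(1) by (auto simp: B_def)
    with b(2) show ?thesis by blast
  qed
  ultimately show ?thesis unfolding B_def by blast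
qed

text \<open>
  The linear order on finitely supported functions compares at the least argument where they differ,
  so it is a monomial order.
\<close>

lemma monomial_nonneg:
  fixes m :: "'x::linorder \<Rightarrow>\<^sub>0 nat"
  shows "0 \<le> m"
proof (cases "m = 0")
  case False
  define k where "k = Min (keys m)"
  have ne: "keys m \<noteq> {}" using False by simp
  have k: "k \<in> keys m" unfolding k_def by (rule Min_in) (use ne in auto)
  have "lookup m k' = 0" if "k' < k" for k'
    using that Min_le[of "keys m" k'] unfolding k_def
    by (meson finite_keys in_keys_iff leD)
  then have "0 < m"
    unfolding less_poly_mapping.rep_eq less_fun_def
    using k by (intro exI[of _ k]) (auto simp: in_keys_iff)
  then show ?thesis by simp
qed simp

text \<open>
  A monomial order refines divisibility, so that Dickson's lemma rules out infinite descent.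
\<close>

lemma wf_monomials:
  fixes X :: "'x::linorder set"
  assumes X: "finite X"
  shows "wf {(m, n :: 'x \<Rightarrow>\<^sub>0 nat). m < n \<and> keys m \<subseteq> X \<and> keys n \<subseteq> X}"
  unfolding wf_iff_no_infinite_down_chain
proof
  assume "\<exists>s. \<forall>i. (s (Suc i), s i) \<in>
    {(m, n :: 'x \<Rightarrow>\<^sub>0 nat). m < n \<and> keys m \<subseteq> X \<and> keys n \<subseteq> X}"
  then obtain s :: "nat \<Rightarrow> ('x \<Rightarrow>\<^sub>0 nat)"
    where s: "\<And>i. s (Suc i) < s i" "\<And>i. keys (s i) \<subseteq> X" by blast
  obtain i j m where ij: "i < j" "s j = s i + m" using dickson[OF X s(2)] by blast
  have "s j < s i" using ij(1)
    by (induction rule: less_Suc_induct) (use s(1) in \<open>auto intro: less_trans\<close>)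
  then show False using ij(2) add_left_mono[OF monomial_nonneg[of m], of "s i"] by simp
qed

lemma lookup_single_times:
  fixes g :: "('x \<Rightarrow>\<^sub>0 nat) \<Rightarrow>\<^sub>0 'k::comm_semiring_1"
  shows "lookup (single m a * g) (m + n) = a * lookup g n"
proof -
  let ?l = lookup
  have "single m a * g =
      single m a * (\<Sum>k\<in>keys g. single k (?l g k))"
    using mpol_sum_monomials[of g] by simp
  also have "\<dots> = (\<Sum>k\<in>keys g. single (m + k) (a * ?l g k))"
    by (simp add: sum_distrib_left mult_single)
  finally have "single m a * g =
    (\<Sum>k\<in>keys g. single (m + k) (a * ?l g k))" .
  then show ?thesis
    by (simp add: lookup_sum lookup_single when_def in_keys_iff)
qed

inductive_set generated_ideal :: "'x set \<Rightarrow> ('x, 'k::comm_ring_1) mpol set \<Rightarrow> ('x, 'k) mpol set"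
  for X S where
  gen: "s \<in> S \<Longrightarrow> s \<in> generated_ideal X S"
| add: "f \<in> generated_ideal X S \<Longrightarrow> g \<in> generated_ideal X S \<Longrightarrow> f + g \<in> generated_ideal X S"
| mult: "f \<in> generated_ideal X S \<Longrightarrow> h \<in> polynomials_in X \<Longrightarrow> h * f \<in> generated_ideal X S"

lemma add_in_polynomials_in:
  fixes f g :: "('x, 'k::comm_monoid_add) mpol"
  assumes "f \<in> polynomials_in X" "g \<in> polynomials_in X"
  shows "f + g \<in> polynomials_in X"
  using assms keys_add[of f g] unfolding polynomials_in_def by blast

lemma generated_ideal_polynomials_in:
  assumes "S \<subseteq> polynomials_in X" "f \<in> generated_ideal X S"
  shows "f \<in> polynomials_in X"
  using assms(2)
  by induction (use assms(1) in \<open>auto intro: add_in_polynomials_in mult_in_polynomials_in\<close>)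

lemma generated_ideal_zeros:
  assumes "f \<in> generated_ideal X S"
  shows "\<exists>S0\<subseteq>S. finite S0 \<and> (\<forall>c. (\<forall>s\<in>S0. mpol_eval c s = 0) \<longrightarrow> mpol_eval c f = 0)"
  using assms
proof induction
  case (gen s)
  then show ?case by (intro exI[of _ "{s}"]) auto
next
  case (add f g)
  then obtain S0 S1 where "S0 \<subseteq> S" "finite S0" "\<forall>c. (\<forall>s\<in>S0. mpol_eval c s = 0) \<longrightarrow> mpol_eval c f = 0"
    "S1 \<subseteq> S" "finite S1" "\<forall>c. (\<forall>s\<in>S1. mpol_eval c s = 0) \<longrightarrow> mpol_eval c g = 0" by blast
  then show ?case by (intro exI[of _ "S0 \<union> S1"]) (auto simp: mpol_eval_add)
next
  case (mult f h)
  then show ?case by (auto simp: mpol_eval_mult)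
qed

text \<open>
  This is Hilbert's basis theorem in the form needed here.  The leading monomials of the ideal are
  multiples of those of finitely many members \<open>g b\<close>; by induction on the leading monomial, every
  member of the ideal reduces to zero modulo the \<open>g b\<close> and so vanishes wherever they do.  Each \<open>g b\<close>
  in turn involves only finitely many of the given generators.
\<close>

theorem finite_subset_same_zeros:
  fixes S :: "('x::linorder, 'k::field) mpol set"
  assumes X: "finite X" and S: "S \<subseteq> polynomials_in X"
  shows "\<exists>S0\<subseteq>S. finite S0 \<and> (\<forall>c. (\<forall>f\<in>S0. mpol_eval c f = 0) \<longrightarrow> (\<forall>f\<in>S. mpol_eval c f = 0))"
proof -
  let ?l = lookup and ?k = keys
  define I where "I = generated_ideal X S"
  define lead where "lead f = Max (?k f)" for f :: "('x, 'k) mpol"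
  have lead_in: "lead f \<in> ?k f" if "f \<noteq> 0" for f
    unfolding lead_def by (rule Max_in) (use that in auto)
  have lead_le: "n \<le> lead f" if "n \<in> ?k f" for n f
    unfolding lead_def by (rule Max_ge) (use that in auto)
  have IX: "?k n \<subseteq> X" if "f \<in> I" "n \<in> ?k f" for f n
    using generated_ideal_polynomials_in[OF S] that by (auto simp: I_def polynomials_in_def)
  obtain B where B: "B \<subseteq> lead ` (I - {0})" "finite B" "\<forall>l\<in>lead ` (I - {0}). \<exists>b\<in>B. \<exists>m. l = b + m"
    using finite_divisor_basis[OF X, of "lead ` (I - {0})"] IX lead_in by blast
  have "\<forall>b\<in>B. \<exists>g. g \<in> I - {0} \<and> lead g = b" using B(1) by blast
  then obtain g where g: "\<And>b. b \<in> B \<Longrightarrow> g b \<in> I" "\<And>b. b \<in> B \<Longrightarrow> g b \<noteq> 0" "\<And>b. b \<in> B \<Longrightarrow> lead (g b) = b"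
    by (metis DiffE singletonI)
  have "\<forall>b\<in>B. \<exists>S0\<subseteq>S. finite S0 \<and> (\<forall>c. (\<forall>s\<in>S0. mpol_eval c s = 0) \<longrightarrow> mpol_eval c (g b) = 0)"
    using generated_ideal_zeros g(1) unfolding I_def by blast
  then obtain T where T: "\<And>b. b \<in> B \<Longrightarrow> T b \<subseteq> S" "\<And>b. b \<in> B \<Longrightarrow> finite (T b)"
    "\<And>b c. b \<in> B \<Longrightarrow> \<forall>s\<in>T b. mpol_eval c s = 0 \<Longrightarrow> mpol_eval c (g b) = 0" by metis
  have "mpol_eval c f = 0" if c: "\<forall>s\<in>\<Union>(T ` B). mpol_eval c s = 0" and f: "f \<in> S" for c f
  proof -
    have gb: "mpol_eval c (g b) = 0" if "b \<in> B" for b using T(3)[OF that] c that by blast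
    have *: "\<forall>f. f \<in> I \<longrightarrow> f \<noteq> 0 \<longrightarrow> lead f = n \<longrightarrow> mpol_eval c f = 0" for n
    proof (induction n rule: wf_induct_rule[OF wf_monomials[OF X]])
      case (1 n)
      show ?case
      proof (intro allI impI)
        fix f assume f: "f \<in> I" "f \<noteq> 0" "lead f = n"
        obtain b m where b: "b \<in> B" "n = b + m" using B(3) f by blast
        define a where "a = ?l f n / ?l (g b) b"
        \<comment> \<open>adding \<open>h\<close> cancels the leading term of \<open>f\<close>\<close>
        define h where "h = single m (- a) * g b"
        have nz: "?l (g b) b \<noteq> 0" using lead_in[OF g(2)[OF b(1)]] g(3)[OF b(1)] by (simp add: in_keys_iff)
        have "?k m \<subseteq> ?k n" by (auto simp: b(2) in_keys_iff lookup_add)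
        then have "?k m \<subseteq> X" using IX[OF f(1)] lead_in[OF f(2)] f(3) by blast
        then have "h \<in> I" using g(1)[OF b(1)] unfolding h_def I_def
          by (intro generated_ideal.mult) (auto simp: polynomials_in_def)
        then have fh: "f + h \<in> I" using f(1) unfolding I_def by (rule generated_ideal.add[rotated])
        have "?l h n = - a * ?l (g b) b"
          unfolding h_def b(2) add.commute[of b m] by (rule lookup_single_times)
        then have n0: "n \<notin> ?k (f + h)" using nz by (simp add: in_keys_iff lookup_add a_def)
        have lt: "k < n" if k: "k \<in> ?k (f + h)" for k
        proof -
          have "k \<in> ?k f \<or> k \<in> ?k h" using k keys_add[of f h] by blast
          moreover have "k \<le> n" if kh: "k \<in> ?k h"
          proof -
            obtain m' k' where "m' \<in> ?k (single m (- a))" "k' \<in> ?k (g b)" "k = m' + k'"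
              using kh keys_mult[of "single m (- a)" "g b"] unfolding h_def by blast
            then have "k' \<in> ?k (g b)" "k = m + k'" by (auto split: if_splits)
            then show ?thesis using lead_le[of k' "g b"] g(3)[OF b(1)] b(2)
              by (metis add.commute add_left_mono)
          qed
          moreover have "k \<le> n" if "k \<in> ?k f" using lead_le[OF that] f(3) by simp
          moreover have "k \<noteq> n" using n0 k by blast
          ultimately show ?thesis by force
        qed
        have "mpol_eval c (f + h) = 0"
        proof (cases "f + h = 0")
          case False
          have "(lead (f + h), n) \<in> {(m, n). m < n \<and> ?k m \<subseteq> X \<and> ?k n \<subseteq> X}"
            using lt[OF lead_in[OF False]] IX[OF fh lead_in[OF False]] IX[OF f(1) lead_in[OF f(2)]] f(3)
            by simp
          from 1[OF this] show ?thesis using fh False by blast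
        qed simp
        moreover have "mpol_eval c h = 0" unfolding h_def by (simp add: mpol_eval_mult gb b(1))
        ultimately show "mpol_eval c f = 0" by (simp add: mpol_eval_add)
      qed
    qed
    have "f \<in> I" using f unfolding I_def by (rule generated_ideal.gen)
    then show ?thesis using * by (cases "f = 0") auto
  qed
  moreover have "\<Union>(T ` B) \<subseteq> S" "finite (\<Union>(T ` B))" using T B(2) by auto
  ultimately show ?thesis by blast
qed

section \<open>Representations generated at a vertex by incoming arrows\<close>

lemma reps_carrier:
  assumes "M \<in> reps Q" "a \<in> arcs Q"
  shows "snd M a \<in> carrier_mat (fst M (head Q a)) (fst M (tail Q a))"
  using assms by (auto simp: reps_def rep_space_def)

lemma rep_hom_carrier:
  assumes "f \<in> rep_hom Q M N" "i \<in> verts Q"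
  shows "f i \<in> carrier_mat (fst N i) (fst M i)"
  using assms by (auto simp: rep_hom_def)

lemma rep_hom_apply:
  assumes Q: "wf_digraph Q" and MN: "M \<in> reps Q" "N \<in> reps Q" and f: "f \<in> rep_hom Q M N"
    and a: "a \<in> arcs Q" and x: "x \<in> carrier_vec (fst M (tail Q a))"
  shows "f (head Q a) *\<^sub>v (snd M a *\<^sub>v x) = snd N a *\<^sub>v (f (tail Q a) *\<^sub>v x)"
proof -
  interpret wf_digraph Q by fact
  note c = reps_carrier[OF MN(1) a] reps_carrier[OF MN(2) a]
    rep_hom_carrier[OF f tail_in_verts[OF a]] rep_hom_carrier[OF f head_in_verts[OF a]]
  have "f (head Q a) * snd M a = snd N a * f (tail Q a)" using f a by (auto simp: rep_hom_def)
  then show ?thesis using c x by (metis assoc_mult_mat_vec)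
qed

lemma mult_unit_vec:
  fixes A :: "'k::semiring_1 mat"
  assumes "A \<in> carrier_mat n m" "j < m"
  shows "A *\<^sub>v unit_vec m j = col A j"
  by (rule eq_vecI) (use assms in auto)

lemma mat_eq_by_vec:
  fixes A B :: "'k::semiring_1 mat"
  assumes "A \<in> carrier_mat n m" "B \<in> carrier_mat n m"
    and eq: "\<And>x. x \<in> carrier_vec m \<Longrightarrow> A *\<^sub>v x = B *\<^sub>v x"
  shows "A = B"
proof (rule mat_col_eqI)
  fix j assume "j < dim_col B"
  then have j: "j < m" using assms by simp
  show "col A j = col B j"
    using eq[of "unit_vec m j"] mult_unit_vec[OF assms(1) j] mult_unit_vec[OF assms(2) j] by simp
qed (use assms in auto)

lemma rep_homI:
  assumes Q: "wf_digraph Q" and MN: "M \<in> reps Q" "N \<in> reps Q"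
    and f: "f \<in> extensional (verts Q)" "\<And>i. i \<in> verts Q \<Longrightarrow> f i \<in> carrier_mat (fst N i) (fst M i)"
    and eq: "\<And>a x. a \<in> arcs Q \<Longrightarrow> x \<in> carrier_vec (fst M (tail Q a)) \<Longrightarrow>
      f (head Q a) *\<^sub>v (snd M a *\<^sub>v x) = snd N a *\<^sub>v (f (tail Q a) *\<^sub>v x)"
  shows "f \<in> rep_hom Q M N"
proof -
  interpret wf_digraph Q by fact
  have "f (head Q a) * snd M a = snd N a * f (tail Q a)" if a: "a \<in> arcs Q" for a
  proof -
    note c = reps_carrier[OF MN(1) a] reps_carrier[OF MN(2) a]
      f(2)[OF tail_in_verts[OF a]] f(2)[OF head_in_verts[OF a]]
    show ?thesis
      by (rule mat_eq_by_vec[of _ "fst N (head Q a)" "fst M (tail Q a)"])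
         (use c eq[OF a] in \<open>auto simp: assoc_mult_mat_vec[OF c(4) c(1)] assoc_mult_mat_vec[OF c(2) c(3)]\<close>)
  qed
  then show ?thesis using f by (auto simp: rep_hom_def PiE_def)
qed

definition vec_subspace :: "nat \<Rightarrow> 'k::field vec set \<Rightarrow> bool" where
  "vec_subspace n W \<longleftrightarrow> W \<subseteq> carrier_vec n \<and> 0\<^sub>v n \<in> W \<and>
     (\<forall>v\<in>W. \<forall>w\<in>W. v + w \<in> W) \<and> (\<forall>c. \<forall>v\<in>W. c \<cdot>\<^sub>v v \<in> W)"

lemma vec_subspaceD:
  assumes "vec_subspace n W"
  shows "W \<subseteq> carrier_vec n" "0\<^sub>v n \<in> W" "v \<in> W \<Longrightarrow> w \<in> W \<Longrightarrow> v + w \<in> W" "v \<in> W \<Longrightarrow> c \<cdot>\<^sub>v v \<in> W"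
  using assms unfolding vec_subspace_def by simp_all

lemma vec_subspace_vimage:
  assumes W: "vec_subspace n W" and f: "f \<in> carrier_mat n m"
  shows "vec_subspace m {x \<in> carrier_vec m. f *\<^sub>v x \<in> W}"
  unfolding vec_subspace_def
proof (intro conjI)
  have "f *\<^sub>v 0\<^sub>v m = 0\<^sub>v n" using f by auto
  then show "0\<^sub>v m \<in> {x \<in> carrier_vec m. f *\<^sub>v x \<in> W}" using W by (simp add: vec_subspaceD)
qed (use W f in \<open>auto simp: vec_subspaceD mult_add_distrib_mat_vec[OF f] mult_mat_vec[OF f]\<close>)

lemma vec_subspace_image:
  assumes W: "vec_subspace m W" and f: "f \<in> carrier_mat n m"
  shows "vec_subspace n ((\<lambda>x. f *\<^sub>v x) ` W)"
  unfolding vec_subspace_def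
proof (intro conjI ballI allI)
  note c = vec_subspaceD(1)[OF W]
  show "(\<lambda>x. f *\<^sub>v x) ` W \<subseteq> carrier_vec n" using f c by auto
  have "f *\<^sub>v 0\<^sub>v m = 0\<^sub>v n" using f by auto
  then show "0\<^sub>v n \<in> (\<lambda>x. f *\<^sub>v x) ` W" using vec_subspaceD(2)[OF W] by (metis image_eqI)
  fix v assume "v \<in> (\<lambda>x. f *\<^sub>v x) ` W"
  then obtain x where x: "x \<in> W" "v = f *\<^sub>v x" by blast
  show "k \<cdot>\<^sub>v v \<in> (\<lambda>x. f *\<^sub>v x) ` W" for k
    using x c vec_subspaceD(4)[OF W x(1), of k] mult_mat_vec[OF f, of x k]
    by (intro image_eqI[of _ _ "k \<cdot>\<^sub>v x"]) auto
  fix w assume "w \<in> (\<lambda>x. f *\<^sub>v x) ` W"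
  then obtain y where y: "y \<in> W" "w = f *\<^sub>v y" by blast
  show "v + w \<in> (\<lambda>x. f *\<^sub>v x) ` W"
    using x y c vec_subspaceD(3)[OF W x(1) y(1)] mult_add_distrib_mat_vec[OF f, of x y]
    by (intro image_eqI[of _ _ "x + y"]) (simp_all add: subset_iff)
qed

lemma vec_subspace_sum:
  assumes W: "vec_subspace n W" and "finite I" "\<And>i. i \<in> I \<Longrightarrow> v i \<in> W"
  shows "vec n (\<lambda>r. \<Sum>i\<in>I. c i * v i $ r) \<in> W"
  using assms(2,3)
proof (induction I)
  case empty
  have "vec n (\<lambda>r. \<Sum>i\<in>{}. c i * v i $ r) = 0\<^sub>v n" by auto
  then show ?case using vec_subspaceD(2)[OF W] by simp
next
  case (insert j I)
  have "v j \<in> carrier_vec n" using insert.prems vec_subspaceD(1)[OF W] by auto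
  then have "vec n (\<lambda>r. \<Sum>i\<in>insert j I. c i * v i $ r) = c j \<cdot>\<^sub>v v j + vec n (\<lambda>r. \<Sum>i\<in>I. c i * v i $ r)"
    using insert.hyps by (intro eq_vecI) auto
  also have "\<dots> \<in> W" using insert by (intro vec_subspaceD(3,4)[OF W]) auto
  finally show ?case .
qed

text \<open>
  The representations \<open>M\<close> for which the images of the arrows ending at \<open>s\<close> span \<open>M\<^sub>s\<close>.  Equivalently,
  there is no nonzero homomorphism from \<open>M\<close> to the simple representation at \<open>s\<close> on which all arrows
  act by zero, so these form a torsion class.  The formulation by
  subspaces \<open>W\<close> avoids sums over arrows: in the closure proofs one only takes images and preimages.
\<close>

definition arrow_generated :: "('v, 'a) pre_digraph \<Rightarrow> 'v \<Rightarrow> ('v, 'a, 'k::field) rep set" where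
  "arrow_generated Q s = {M \<in> reps Q.
     \<forall>W. vec_subspace (fst M s) W \<longrightarrow>
       (\<forall>a\<in>arcs Q. head Q a = s \<longrightarrow> (\<forall>x\<in>carrier_vec (fst M (tail Q a)). snd M a *\<^sub>v x \<in> W)) \<longrightarrow>
       W = carrier_vec (fst M s)}"

lemma arrow_generatedD:
  assumes "M \<in> arrow_generated Q s" "vec_subspace (fst M s) W"
    "\<And>a x. a \<in> arcs Q \<Longrightarrow> head Q a = s \<Longrightarrow> x \<in> carrier_vec (fst M (tail Q a)) \<Longrightarrow> snd M a *\<^sub>v x \<in> W"
  shows "W = carrier_vec (fst M s)"
proof -
  have "vec_subspace (fst M s) W \<longrightarrow>
      (\<forall>a\<in>arcs Q. head Q a = s \<longrightarrow> (\<forall>x\<in>carrier_vec (fst M (tail Q a)). snd M a *\<^sub>v x \<in> W)) \<longrightarrow>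
      W = carrier_vec (fst M s)"
    using assms(1) by (simp add: arrow_generated_def)
  then show ?thesis using assms(2,3) by simp
qed

lemma arrow_generatedI:
  assumes "M \<in> reps Q"
    "\<And>W. vec_subspace (fst M s) W \<Longrightarrow>
      (\<And>a x. a \<in> arcs Q \<Longrightarrow> head Q a = s \<Longrightarrow> x \<in> carrier_vec (fst M (tail Q a)) \<Longrightarrow> snd M a *\<^sub>v x \<in> W)
      \<Longrightarrow> carrier_vec (fst M s) \<subseteq> W"
  shows "M \<in> arrow_generated Q s"
  unfolding arrow_generated_def
proof (intro CollectI conjI allI impI assms(1))
  fix W assume W: "vec_subspace (fst M s) W"
    and "\<forall>a\<in>arcs Q. head Q a = s \<longrightarrow> (\<forall>x\<in>carrier_vec (fst M (tail Q a)). snd M a *\<^sub>v x \<in> W)"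
  then have "carrier_vec (fst M s) \<subseteq> W" by (intro assms(2)) simp_all
  then show "W = carrier_vec (fst M s)" using vec_subspaceD(1)[OF W] by (rule equalityI[rotated])
qed

lemma carrier_vec_0: "carrier_vec 0 = {0\<^sub>v 0}"
proof -
  have "x = 0\<^sub>v 0" if "x \<in> carrier_vec 0" for x :: "'a vec" by (rule eq_vecI) (use that in auto)
  then show ?thesis by auto
qed

lemma arrow_generated_dim_0:
  assumes M: "(M :: ('v, 'a, 'k::field) rep) \<in> reps Q" and "fst M s = 0"
  shows "M \<in> arrow_generated Q s"
proof (rule arrow_generatedI[OF M], unfold assms(2) carrier_vec_0)
  fix W :: "'k vec set" assume "vec_subspace 0 W"
  then have "0\<^sub>v 0 \<in> W" by (rule vec_subspaceD(2))
  then show "{0\<^sub>v 0} \<subseteq> W" by blast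
qed

text \<open>
  A homomorphism from a generated representation maps into \<open>W\<close> as soon as the arrows do so on its
  image: apply the generation of \<open>A\<close> to the preimage of \<open>W\<close>.
\<close>

lemma arrow_generated_hom:
  fixes A M :: "('v, 'a, 'k::field) rep"
  assumes Q: "wf_digraph Q" and s: "s \<in> verts Q"
    and A: "A \<in> arrow_generated Q s" and M: "M \<in> reps Q" and f: "f \<in> rep_hom Q A M"
    and W: "vec_subspace (fst M s) W"
    and im: "\<And>a x. a \<in> arcs Q \<Longrightarrow> head Q a = s \<Longrightarrow> x \<in> carrier_vec (fst A (tail Q a)) \<Longrightarrow>
      snd M a *\<^sub>v (f (tail Q a) *\<^sub>v x) \<in> W"
    and x: "x \<in> carrier_vec (fst A s)"
  shows "f s *\<^sub>v x \<in> W"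
proof -
  have AQ: "A \<in> reps Q" using A by (simp add: arrow_generated_def)
  have "{x \<in> carrier_vec (fst A s). f s *\<^sub>v x \<in> W} = carrier_vec (fst A s)"
  proof (rule arrow_generatedD[OF A vec_subspace_vimage[OF W rep_hom_carrier[OF f s]]])
    fix a and x :: "'k vec" assume a: "a \<in> arcs Q" "head Q a = s" "x \<in> carrier_vec (fst A (tail Q a))"
    have "f s *\<^sub>v (snd A a *\<^sub>v x) \<in> W"
      using rep_hom_apply[OF Q AQ M f a(1,3)] im[OF a] a(2) by simp
    moreover have "snd A a *\<^sub>v x \<in> carrier_vec (fst A s)" using reps_carrier[OF AQ a(1)] a(2,3) by auto
    ultimately show "snd A a *\<^sub>v x \<in> {x \<in> carrier_vec (fst A s). f s *\<^sub>v x \<in> W}" by simp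
  qed
  with x show ?thesis by blast
qed

lemma arrow_generated_quotient:
  fixes M N :: "('v, 'a, 'k::field) rep"
  assumes Q: "wf_digraph Q" and s: "s \<in> verts Q"
    and M: "M \<in> arrow_generated Q s" and N: "N \<in> reps Q" and g: "g \<in> rep_hom Q M N"
    and surj: "\<And>i. i \<in> verts Q \<Longrightarrow> mat_range (g i) = carrier_vec (fst N i)"
  shows "N \<in> arrow_generated Q s"
proof (rule arrow_generatedI[OF N])
  interpret wf_digraph Q by fact
  have MQ: "M \<in> reps Q" using M by (simp add: arrow_generated_def)
  note gc = rep_hom_carrier[OF g]
  fix W assume W: "vec_subspace (fst N s) W"
    and im: "\<And>a x. a \<in> arcs Q \<Longrightarrow> head Q a = s \<Longrightarrow> x \<in> carrier_vec (fst N (tail Q a)) \<Longrightarrow> snd N a *\<^sub>v x \<in> W"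
  have "g (tail Q a) *\<^sub>v x \<in> carrier_vec (fst N (tail Q a))"
    if "a \<in> arcs Q" "x \<in> carrier_vec (fst M (tail Q a))" for a x
    using gc[of "tail Q a"] that by auto
  then have "g s *\<^sub>v x \<in> W" if "x \<in> carrier_vec (fst M s)" for x
    using arrow_generated_hom[OF Q s M N g W _ that] im by blast
  then show "carrier_vec (fst N s) \<subseteq> W"
    using gc[OF s] unfolding surj[OF s, symmetric] mat_range_def by auto
qed

text \<open>
  Let \<open>W\<close> contain the images of all arrows ending at \<open>s\<close>.  Its preimage in \<open>A\<close> is everything, so \<open>W\<close>
  contains the kernel of \<open>g\<close>; its image in \<open>B\<close> is everything as well.  Hence \<open>W\<close> is everything.
\<close>

lemma arrow_generated_extension:
  fixes A B M :: "('v, 'a, 'k::field) rep"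
  assumes Q: "wf_digraph Q" and s: "s \<in> verts Q"
    and A: "A \<in> arrow_generated Q s" and B: "B \<in> arrow_generated Q s" and M: "M \<in> reps Q"
    and ex: "short_exact Q A f M g B"
  shows "M \<in> arrow_generated Q s"
proof (rule arrow_generatedI[OF M])
  interpret wf_digraph Q by fact
  have AQ: "A \<in> reps Q" and BQ: "B \<in> reps Q" using A B by (simp_all add: arrow_generated_def)
  have f: "f \<in> rep_hom Q A M" and g: "g \<in> rep_hom Q M B" using ex by (simp_all add: short_exact_def)
  have ker: "mat_range (f s) = mat_kernel (g s)"
    and surj: "\<And>i. i \<in> verts Q \<Longrightarrow> mat_range (g i) = carrier_vec (fst B i)"
    using ex s by (simp_all add: short_exact_def)
  note fc = rep_hom_carrier[OF f] and gc = rep_hom_carrier[OF g]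
  fix W assume W: "vec_subspace (fst M s) W"
    and im: "\<And>a x. a \<in> arcs Q \<Longrightarrow> head Q a = s \<Longrightarrow> x \<in> carrier_vec (fst M (tail Q a)) \<Longrightarrow> snd M a *\<^sub>v x \<in> W"
  have "f (tail Q a) *\<^sub>v x \<in> carrier_vec (fst M (tail Q a))"
    if "a \<in> arcs Q" "x \<in> carrier_vec (fst A (tail Q a))" for a x
    using fc[of "tail Q a"] that by auto
  then have "f s *\<^sub>v x \<in> W" if "x \<in> carrier_vec (fst A s)" for x
    using arrow_generated_hom[OF Q s A M f W _ that] im by blast
  then have kerW: "mat_kernel (g s) \<subseteq> W" using fc[OF s] unfolding ker[symmetric] mat_range_def by auto
  have gW: "(\<lambda>x. g s *\<^sub>v x) ` W = carrier_vec (fst B s)"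
  proof (rule arrow_generatedD[OF B vec_subspace_image[OF W gc[OF s]]])
    fix a and z :: "'k vec" assume a: "a \<in> arcs Q" "head Q a = s" "z \<in> carrier_vec (fst B (tail Q a))"
    then obtain x where x: "x \<in> carrier_vec (fst M (tail Q a))" "z = g (tail Q a) *\<^sub>v x"
      using surj[of "tail Q a"] gc[of "tail Q a"] unfolding mat_range_def by auto
    have "snd B a *\<^sub>v z = g s *\<^sub>v (snd M a *\<^sub>v x)"
      using rep_hom_apply[OF Q M BQ g a(1) x(1)] a(2) x(2) by simp
    then show "snd B a *\<^sub>v z \<in> (\<lambda>x. g s *\<^sub>v x) ` W" using im[OF a(1,2) x(1)] by blast
  qed
  show "carrier_vec (fst M s) \<subseteq> W"
  proof
    fix y :: "'k vec" assume y: "y \<in> carrier_vec (fst M s)"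
    have "g s *\<^sub>v y \<in> carrier_vec (fst B s)" using gc[OF s] y by auto
    then obtain w where w: "w \<in> W" "g s *\<^sub>v y = g s *\<^sub>v w" using gW by (metis (no_types, lifting) imageE)
    have wc: "w \<in> carrier_vec (fst M s)" using w(1) vec_subspaceD(1)[OF W] by blast
    have "g s *\<^sub>v (y - w) = 0\<^sub>v (fst B s)"
      using mult_minus_distrib_mat_vec[OF gc[OF s] y wc] w(2) gc[OF s] wc by simp
    then have "y - w \<in> mat_kernel (g s)" using gc[OF s] y wc by (simp add: mat_kernel_def)
    then have "(y - w) + w \<in> W" using kerW w(1) vec_subspaceD(3)[OF W] by blast
    moreover have "(y - w) + w = y" using y wc by auto
    ultimately show "y \<in> W" by simp
  qed
qed

lemma zero_rep_reps:
  assumes "wf_digraph Q"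
  shows "zero_rep Q \<in> reps Q"
proof -
  interpret wf_digraph Q by fact
  show ?thesis by (auto simp: zero_rep_def reps_def dim_vectors_def rep_space_def)
qed

lemma direct_sum_reps:
  assumes Q: "wf_digraph Q" and "M \<in> reps Q" "N \<in> reps Q"
  shows "direct_sum Q M N \<in> reps Q"
proof -
  interpret wf_digraph Q by fact
  show ?thesis using assms(2,3)[THEN reps_carrier]
    by (auto simp: direct_sum_def reps_def dim_vectors_def rep_space_def intro!: four_block_carrier_mat)
qed

lemma direct_sum_apply:
  assumes Q: "wf_digraph Q" and MN: "M \<in> reps Q" "N \<in> reps Q" and a: "a \<in> arcs Q"
    and x: "x \<in> carrier_vec (fst M (tail Q a))" and y: "y \<in> carrier_vec (fst N (tail Q a))"
  shows "snd (direct_sum Q M N) a *\<^sub>v (x @\<^sub>v y) = (snd M a *\<^sub>v x) @\<^sub>v (snd N a *\<^sub>v y)"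
proof -
  note c = reps_carrier[OF MN(1) a] reps_carrier[OF MN(2) a]
  show ?thesis using a c x y
    by (simp add: direct_sum_def)
       (subst four_block_mat_mult_vec[OF c(1) _ _ c(2) x y], auto)
qed

definition inl_mat :: "nat \<Rightarrow> nat \<Rightarrow> 'k::field mat" where
  "inl_mat m n = four_block_mat (1\<^sub>m m) (0\<^sub>m m 0) (0\<^sub>m n m) (0\<^sub>m n 0)"
definition prl_mat :: "nat \<Rightarrow> nat \<Rightarrow> 'k::field mat" where
  "prl_mat m n = four_block_mat (1\<^sub>m m) (0\<^sub>m m n) (0\<^sub>m 0 m) (0\<^sub>m 0 n)"
definition prr_mat :: "nat \<Rightarrow> nat \<Rightarrow> 'k::field mat" where
  "prr_mat m n = four_block_mat (0\<^sub>m n m) (1\<^sub>m n) (0\<^sub>m 0 m) (0\<^sub>m 0 n)"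

lemma sum_mats_dim [simp]:
  "dim_row (inl_mat m n) = m + n" "dim_col (inl_mat m n) = m"
  "dim_row (prl_mat m n) = m" "dim_col (prl_mat m n) = m + n"
  "dim_row (prr_mat m n) = n" "dim_col (prr_mat m n) = m + n"
  by (simp_all add: inl_mat_def prl_mat_def prr_mat_def)

lemma sum_mats_carrier [simp]:
  "inl_mat m n \<in> carrier_mat (m + n) m" "prl_mat m n \<in> carrier_mat m (m + n)"
  "prr_mat m n \<in> carrier_mat n (m + n)"
  by (rule carrier_matI; simp)+

lemma append_vec_0 [simp]:
  assumes "v \<in> carrier_vec 0"
  shows "w @\<^sub>v v = w"
  by (rule eq_vecI) (use assms in auto)

lemma inl_mat_apply:
  assumes x: "x \<in> carrier_vec m"
  shows "inl_mat m n *\<^sub>v x = x @\<^sub>v 0\<^sub>v n"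
proof -
  have "inl_mat m n *\<^sub>v (x @\<^sub>v 0\<^sub>v 0) = x @\<^sub>v 0\<^sub>v n"
    unfolding inl_mat_def by (subst four_block_mat_mult_vec[of _ m m _ 0 _ n]) (use x in auto)
  then show ?thesis by simp
qed

lemma pr_mat_apply:
  assumes x: "x \<in> carrier_vec m" and y: "y \<in> carrier_vec n"
  shows "prl_mat m n *\<^sub>v (x @\<^sub>v y) = x" "prr_mat m n *\<^sub>v (x @\<^sub>v y) = y"
proof -
  show "prl_mat m n *\<^sub>v (x @\<^sub>v y) = x"
    unfolding prl_mat_def by (subst four_block_mat_mult_vec[of _ m m _ n _ 0]) (use x y in auto)
  show "prr_mat m n *\<^sub>v (x @\<^sub>v y) = y"
    unfolding prr_mat_def by (subst four_block_mat_mult_vec[of _ n m _ n _ 0]) (use x y in auto)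
qed

lemma append_vecE:
  assumes "v \<in> carrier_vec (m + n)"
  obtains x y where "x \<in> carrier_vec m" "y \<in> carrier_vec n" "v = x @\<^sub>v y"
  using that[of "vec_first v m" "vec_last v n"] vec_first_last_append[OF assms] by simp

lemma direct_sum_exact:
  fixes M N :: "('v, 'a, 'k::field) rep"
  assumes Q: "wf_digraph Q" and M: "M \<in> reps Q" and N: "N \<in> reps Q"
  shows "short_exact Q M (\<lambda>i\<in>verts Q. inl_mat (fst M i) (fst N i)) (direct_sum Q M N)
           (\<lambda>i\<in>verts Q. prr_mat (fst M i) (fst N i)) N" (is ?ex)
    and "(\<lambda>i\<in>verts Q. prl_mat (fst M i) (fst N i)) \<in> rep_hom Q (direct_sum Q M N) M" (is ?prl)
    and "i \<in> verts Q \<Longrightarrow> mat_range (prl_mat (fst M i) (fst N i) :: 'k mat) = carrier_vec (fst M i)"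
    and "i \<in> verts Q \<Longrightarrow> mat_range (prr_mat (fst M i) (fst N i) :: 'k mat) = carrier_vec (fst N i)"
proof -
  interpret wf_digraph Q by fact
  note S = direct_sum_reps[OF Q M N]
  have dim: "fst (direct_sum Q M N) i = fst M i + fst N i" if "i \<in> verts Q" for i
    using that by (simp add: direct_sum_def)
  have c: "snd M a *\<^sub>v x \<in> carrier_vec (fst M (head Q a))" "snd N a *\<^sub>v y \<in> carrier_vec (fst N (head Q a))"
    if "a \<in> arcs Q" for a x y
    using reps_carrier[OF M that] reps_carrier[OF N that]
    by (intro carrier_vecI; simp)+
  have zero: "snd N a *\<^sub>v 0\<^sub>v (fst N (tail Q a)) = 0\<^sub>v (fst N (head Q a))" if "a \<in> arcs Q" for a
    using reps_carrier[OF N that] by auto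
  have inl: "(\<lambda>i\<in>verts Q. inl_mat (fst M i) (fst N i)) \<in> rep_hom Q M (direct_sum Q M N)"
  proof (rule rep_homI[OF Q M S])
    fix a and x :: "'k vec" assume a: "a \<in> arcs Q" "x \<in> carrier_vec (fst M (tail Q a))"
    then show "(\<lambda>i\<in>verts Q. inl_mat (fst M i) (fst N i)) (head Q a) *\<^sub>v (snd M a *\<^sub>v x) =
        snd (direct_sum Q M N) a *\<^sub>v ((\<lambda>i\<in>verts Q. inl_mat (fst M i) (fst N i)) (tail Q a) *\<^sub>v x)"
      using c[OF a(1)] by (simp add: inl_mat_apply pr_mat_apply direct_sum_apply[OF Q M N] zero)
  qed (auto simp: dim)
  have prr: "(\<lambda>i\<in>verts Q. prr_mat (fst M i) (fst N i)) \<in> rep_hom Q (direct_sum Q M N) N"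
  proof (rule rep_homI[OF Q S N])
    fix a and v :: "'k vec" assume a: "a \<in> arcs Q" and "v \<in> carrier_vec (fst (direct_sum Q M N) (tail Q a))"
    then obtain x y where "x \<in> carrier_vec (fst M (tail Q a))" "y \<in> carrier_vec (fst N (tail Q a))" "v = x @\<^sub>v y"
      using append_vecE dim[OF tail_in_verts[OF a]] by metis
    then show "(\<lambda>i\<in>verts Q. prr_mat (fst M i) (fst N i)) (head Q a) *\<^sub>v (snd (direct_sum Q M N) a *\<^sub>v v) =
        snd N a *\<^sub>v ((\<lambda>i\<in>verts Q. prr_mat (fst M i) (fst N i)) (tail Q a) *\<^sub>v v)"
      using a c[OF a] by (simp add: inl_mat_apply pr_mat_apply direct_sum_apply[OF Q M N])
  qed (auto simp: dim)
  show ?prl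
  proof (rule rep_homI[OF Q S M])
    fix a and v :: "'k vec" assume a: "a \<in> arcs Q" and "v \<in> carrier_vec (fst (direct_sum Q M N) (tail Q a))"
    then obtain x y where "x \<in> carrier_vec (fst M (tail Q a))" "y \<in> carrier_vec (fst N (tail Q a))" "v = x @\<^sub>v y"
      using append_vecE dim[OF tail_in_verts[OF a]] by metis
    then show "(\<lambda>i\<in>verts Q. prl_mat (fst M i) (fst N i)) (head Q a) *\<^sub>v (snd (direct_sum Q M N) a *\<^sub>v v) =
        snd M a *\<^sub>v ((\<lambda>i\<in>verts Q. prl_mat (fst M i) (fst N i)) (tail Q a) *\<^sub>v v)"
      using a c[OF a] by (simp add: inl_mat_apply pr_mat_apply direct_sum_apply[OF Q M N])
  qed (auto simp: dim)
  have rl: "mat_range (prl_mat m n :: 'k mat) = carrier_vec m" for m n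
  proof
    show "carrier_vec m \<subseteq> mat_range (prl_mat m n :: 'k mat)"
    proof
      fix x :: "'k vec" assume "x \<in> carrier_vec m"
      then have "x = prl_mat m n *\<^sub>v (x @\<^sub>v 0\<^sub>v n)" "x @\<^sub>v 0\<^sub>v n \<in> carrier_vec (m + n)"
        by (simp_all add: pr_mat_apply)
      then show "x \<in> mat_range (prl_mat m n)" unfolding mat_range_def sum_mats_dim by (rule image_eqI)
    qed
  qed (auto simp: mat_range_def intro: carrier_vecI)
  have rr: "mat_range (prr_mat m n :: 'k mat) = carrier_vec n" for m n
  proof
    show "carrier_vec n \<subseteq> mat_range (prr_mat m n :: 'k mat)"
    proof
      fix x :: "'k vec" assume "x \<in> carrier_vec n"
      then have "x = prr_mat m n *\<^sub>v (0\<^sub>v m @\<^sub>v x)" "0\<^sub>v m @\<^sub>v x \<in> carrier_vec (m + n)"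
        by (simp_all add: pr_mat_apply)
      then show "x \<in> mat_range (prr_mat m n)" unfolding mat_range_def sum_mats_dim by (rule image_eqI)
    qed
  qed (auto simp: mat_range_def intro: carrier_vecI)
  show "mat_range (prl_mat (fst M i) (fst N i) :: 'k mat) = carrier_vec (fst M i)" by (rule rl)
  show "mat_range (prr_mat (fst M i) (fst N i) :: 'k mat) = carrier_vec (fst N i)" by (rule rr)
  have inj: "mat_inj (inl_mat m n :: 'k mat)" for m n
    unfolding mat_inj_def by (rule inj_onI) (auto simp: inl_mat_apply)
  have ker: "mat_range (inl_mat m n :: 'k mat) = mat_kernel (prr_mat m n)" for m n
  proof
    show "mat_range (inl_mat m n :: 'k mat) \<subseteq> mat_kernel (prr_mat m n)"
      by (auto simp: mat_range_def mat_kernel_def inl_mat_apply pr_mat_apply[where m = m and n = n])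
    show "mat_kernel (prr_mat m n) \<subseteq> mat_range (inl_mat m n :: 'k mat)"
    proof
      fix v :: "'k vec" assume v: "v \<in> mat_kernel (prr_mat m n)"
      then have "v \<in> carrier_vec (m + n)" by (simp add: mat_kernel_def)
      then obtain x y where xy: "x \<in> carrier_vec m" "y \<in> carrier_vec n" "v = x @\<^sub>v y" by (rule append_vecE)
      then have "y = 0\<^sub>v n" using v by (simp add: mat_kernel_def inl_mat_apply pr_mat_apply)
      then show "v \<in> mat_range (inl_mat m n)"
        using xy inl_mat_apply[OF xy(1), of n] unfolding mat_range_def sum_mats_dim
        by (intro image_eqI[of _ _ x]) simp_all
    qed
  qed
  show ?ex unfolding short_exact_def using inl prr inj ker rr by auto
qed

lemma invertible_mat_range:
  fixes A :: "'k::field mat"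
  assumes A: "A \<in> carrier_mat n m" "invertible_mat A"
  shows "mat_range A = carrier_vec n"
proof -
  obtain B where B: "square_mat A" "A * B = 1\<^sub>m (dim_row A)" "B * A = 1\<^sub>m (dim_row B)"
    using A(2) by (auto simp: invertible_mat_def inverts_mat_def)
  have nm: "m = n" using A(1) B(1) by simp
  have "dim_col (A * B) = n" unfolding B(2) using A(1) by simp
  then have dc: "dim_col B = n" by simp
  have "dim_col (B * A) = dim_row B" unfolding B(3) by simp
  then have dr: "dim_row B = n" using A(1) nm by simp
  have Bc: "B \<in> carrier_mat n n" using dc dr by auto
  have "x \<in> mat_range A" if x: "x \<in> carrier_vec n" for x
  proof -
    have "A *\<^sub>v (B *\<^sub>v x) = (A * B) *\<^sub>v x" using A(1) Bc x nm by simp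
    also have "\<dots> = x" unfolding B(2) using A(1) x by simp
    finally show ?thesis unfolding mat_range_def using A(1) Bc x nm
      by (intro image_eqI[of _ _ "B *\<^sub>v x"]) auto
  qed
  then show ?thesis using A(1) by (auto simp: mat_range_def)
qed

text \<open>
  A direct sum is an extension of its summands, and summands and isomorphic copies are quotients.
\<close>

lemma additively_closed_arrow_generated:
  assumes Q: "wf_digraph Q" and s: "s \<in> verts Q"
  shows "additively_closed Q (arrow_generated Q s :: ('v, 'a, 'k::field) rep set)"
  unfolding additively_closed_def
proof (intro conjI ballI impI)
  let ?E = "arrow_generated Q s :: ('v, 'a, 'k) rep set"
  show "?E \<subseteq> reps Q" by (auto simp: arrow_generated_def)
  show "zero_rep Q \<in> ?E"
    by (rule arrow_generated_dim_0[OF zero_rep_reps[OF Q]]) (use s in \<open>simp add: zero_rep_def\<close>)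
  show "N \<in> ?E" if MN: "M \<in> ?E" "N \<in> reps Q" "rep_iso Q M N" for M N
  proof -
    obtain f where f: "f \<in> rep_hom Q M N" "\<forall>i\<in>verts Q. invertible_mat (f i)"
      using MN(3) by (auto simp: rep_iso_def)
    show ?thesis
      using arrow_generated_quotient[OF Q s MN(1,2) f(1)] invertible_mat_range[OF rep_hom_carrier[OF f(1)]] f(2)
      by blast
  qed
  show "direct_sum Q M N \<in> ?E" if MN: "M \<in> ?E" "N \<in> ?E" for M N
  proof -
    have r: "M \<in> reps Q" "N \<in> reps Q" using MN by (simp_all add: arrow_generated_def)
    show ?thesis by (rule arrow_generated_extension[OF Q s MN direct_sum_reps[OF Q r] direct_sum_exact(1)[OF Q r]])
  qed
  fix M N :: "('v, 'a, 'k) rep" assume r: "M \<in> reps Q" "N \<in> reps Q" and D: "direct_sum Q M N \<in> ?E"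
  show "M \<in> ?E"
    by (rule arrow_generated_quotient[OF Q s D r(1) direct_sum_exact(2)[OF Q r]])
       (use direct_sum_exact(3)[OF Q r] in simp)
  have "(\<lambda>i\<in>verts Q. prr_mat (fst M i) (fst N i)) \<in> rep_hom Q (direct_sum Q M N) N"
    using direct_sum_exact(1)[OF Q r] by (simp add: short_exact_def)
  then show "N \<in> ?E"
    by (rule arrow_generated_quotient[OF Q s D r(2)])
       (use direct_sum_exact(4)[OF Q r] in simp)
qed

lemma extension_closed_arrow_generated:
  assumes Q: "wf_digraph Q" and s: "s \<in> verts Q"
  shows "extension_closed Q (arrow_generated Q s :: ('v, 'a, 'k::field) rep set)"
  unfolding extension_closed_def
proof (intro ballI impI)
  fix A B M :: "('v, 'a, 'k) rep"
  assume AB: "A \<in> arrow_generated Q s" "B \<in> arrow_generated Q s" "M \<in> reps Q"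
    and "\<exists>f g. short_exact Q A f M g B"
  then obtain f g where "short_exact Q A f M g B" by (elim exE)
  then show "M \<in> arrow_generated Q s" by (rule arrow_generated_extension[OF Q s AB])
qed

section \<open>Openness of the generation condition\<close>

lemma sum_in_polynomials_in:
  fixes f :: "'i \<Rightarrow> ('x, 'k::comm_monoid_add) mpol"
  assumes "\<And>i. i \<in> I \<Longrightarrow> f i \<in> polynomials_in X"
  shows "(\<Sum>i\<in>I. f i) \<in> polynomials_in X"
  using assms
  by (induction I rule: infinite_finite_induct) (auto intro: add_in_polynomials_in, auto simp: polynomials_in_def)

lemma prod_in_polynomials_in:
  fixes f :: "'i \<Rightarrow> ('x, 'k::comm_semiring_1) mpol"
  assumes "\<And>i. i \<in> I \<Longrightarrow> f i \<in> polynomials_in X"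
  shows "(\<Prod>i\<in>I. f i) \<in> polynomials_in X"
  using assms
  by (induction I rule: infinite_finite_induct)
     (auto intro: mult_in_polynomials_in one_in_polynomials_in)

lemma signof_in_polynomials_in: "(signof p :: ('x, 'k::comm_ring_1) mpol) \<in> polynomials_in X"
  using one_in_polynomials_in[of X] by (auto simp: sign_def polynomials_in_def)

lemma det_in_polynomials_in:
  fixes P :: "('x, 'k::comm_ring_1) mpol mat"
  assumes P: "P \<in> carrier_mat n n" and "\<And>r c. r < n \<Longrightarrow> c < n \<Longrightarrow> P $$ (r, c) \<in> polynomials_in X"
  shows "det P \<in> polynomials_in X"
  unfolding det_def'[OF P]
proof (intro sum_in_polynomials_in mult_in_polynomials_in prod_in_polynomials_in signof_in_polynomials_in)
  fix p i assume "p \<in> {p. p permutes {0..<n}}" "i \<in> {0..<n}"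
  then have "i < n" "p i < n" using permutes_in_image[of p "{0..<n}" i] by auto
  then show "P $$ (i, p i) \<in> polynomials_in X" by (rule assms(2))
qed

lemma mpol_eval_det:
  fixes P :: "('x, 'k::comm_ring_1) mpol mat"
  shows "mpol_eval c (det P) = det (map_mat (mpol_eval c) P)"
proof -
  interpret comm_ring_hom "mpol_eval c"
    by unfold_locales (simp_all add: mpol_eval_add mpol_eval_mult)
  show ?thesis by simp
qed

lemma det_nonzero_solve:
  fixes D :: "'k::field mat"
  assumes D: "D \<in> carrier_mat n n" "det D \<noteq> 0" and y: "y \<in> carrier_vec n"
  shows "\<exists>z\<in>carrier_vec n. y = D *\<^sub>v z"
proof
  note adj = adj_mat[OF D(1)]
  show "inverse (det D) \<cdot>\<^sub>v (adj_mat D *\<^sub>v y) \<in> carrier_vec n" using adj(1) y by auto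
  have "D *\<^sub>v (inverse (det D) \<cdot>\<^sub>v (adj_mat D *\<^sub>v y)) = inverse (det D) \<cdot>\<^sub>v (D *\<^sub>v (adj_mat D *\<^sub>v y))"
    using adj(1) y by (intro mult_mat_vec[OF D(1)]) auto
  also have "D *\<^sub>v (adj_mat D *\<^sub>v y) = (D * adj_mat D) *\<^sub>v y"
    using D(1) adj(1) y by (simp add: assoc_mult_mat_vec)
  also have "\<dots> = det D \<cdot>\<^sub>v y"
    unfolding adj(2) by (rule eq_vecI) (use y in auto)
  also have "inverse (det D) \<cdot>\<^sub>v (det D \<cdot>\<^sub>v y) = y"
    using D(2) by (rule_tac eq_vecI) auto
  finally show "y = D *\<^sub>v (inverse (det D) \<cdot>\<^sub>v (adj_mat D *\<^sub>v y))" by simp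
qed

lemma factor_through_range:
  fixes F B :: "'k::field mat"
  assumes F: "F \<in> carrier_mat n k" and B: "B \<in> carrier_mat n m"
    and sub: "\<And>x. x \<in> carrier_vec m \<Longrightarrow> B *\<^sub>v x \<in> mat_range F"
  shows "\<exists>A\<in>carrier_mat k m. F * A = B"
proof -
  have "\<exists>v\<in>carrier_vec k. F *\<^sub>v v = col B j" if j: "j < m" for j
  proof -
    have "col B j \<in> mat_range F" using sub[of "unit_vec m j"] mult_unit_vec[OF B j] by simp
    then show ?thesis using F unfolding mat_range_def by auto
  qed
  then have "\<forall>j\<in>{..<m}. \<exists>v. v \<in> carrier_vec k \<and> F *\<^sub>v v = col B j" by blast
  from bchoice[OF this] obtain v where v: "\<forall>j\<in>{..<m}. v j \<in> carrier_vec k \<and> F *\<^sub>v v j = col B j"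
    by (elim exE)
  define A where "A = mat k m (\<lambda>(i, j). v j $ i)"
  have A: "A \<in> carrier_mat k m" by (simp add: A_def)
  have "F * A = B"
  proof (rule mat_col_eqI)
    fix j assume "j < dim_col B"
    then have j: "j < m" using B by simp
    have "v j \<in> carrier_vec k" using v j by simp
    then have "col A j = v j" by (intro eq_vecI) (use j in \<open>auto simp: A_def\<close>)
    then show "col (F * A) j = col B j" using col_mult2[OF F A j] v j by simp
  qed (use F A B in auto)
  with A show ?thesis by blast
qed

lemma mult_mat_vec_in_subspace:
  assumes W: "vec_subspace n W" and A: "A \<in> carrier_mat n m"
    and col: "\<And>j. j < m \<Longrightarrow> col A j \<in> W" and x: "x \<in> carrier_vec m"
  shows "A *\<^sub>v x \<in> W"
proof -
  have "vec n (\<lambda>r. \<Sum>j\<in>{..<m}. x $ j * col A j $ r) \<in> W"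
    by (rule vec_subspace_sum[OF W]) (auto intro: col)
  also have "vec n (\<lambda>r. \<Sum>j\<in>{..<m}. x $ j * col A j $ r) = A *\<^sub>v x"
    by (rule eq_vecI) (use A x in \<open>auto simp: scalar_prod_def lessThan_atLeast0 mult.commute intro!: sum.cong\<close>)
  finally show ?thesis .
qed

text \<open>
  The matrices of all arrows ending at \<open>s\<close>, written side by side; a column is given by an arrow and
  a basis vector of its source.
\<close>

definition incoming_index :: "('v, 'a) pre_digraph \<Rightarrow> 'v \<Rightarrow> ('v \<Rightarrow> nat) \<Rightarrow> ('a \<times> nat) list" where
  "incoming_index Q s d = (SOME L. set L = {(a, t). a \<in> arcs Q \<and> head Q a = s \<and> t < d (tail Q a)})"

definition incoming_matrix :: "('v, 'a) pre_digraph \<Rightarrow> 'v \<Rightarrow> ('v \<Rightarrow> nat) \<Rightarrow> ('a \<Rightarrow> 'k mat) \<Rightarrow> 'k mat" where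
  "incoming_matrix Q s d M = mat (d s) (length (incoming_index Q s d))
     (\<lambda>(r, k). case incoming_index Q s d ! k of (a, t) \<Rightarrow> M a $$ (r, t))"

lemma incoming_index:
  assumes "fin_digraph Q"
  shows "set (incoming_index Q s d) = {(a, t). a \<in> arcs Q \<and> head Q a = s \<and> t < d (tail Q a)}"
proof -
  interpret fin_digraph Q by fact
  have "{(a, t). a \<in> arcs Q \<and> head Q a = s \<and> t < d (tail Q a)} \<subseteq> (SIGMA a:arcs Q. {..<d (tail Q a)})"
    by auto
  then have "finite {(a, t). a \<in> arcs Q \<and> head Q a = s \<and> t < d (tail Q a)}"
    by (rule finite_subset) auto
  from someI_ex[OF finite_list[OF this]] show ?thesis by (simp add: incoming_index_def)
qed

text \<open>
  The matrix of all arrows ending at \<open>s\<close> has full row rank iff it has a right inverse.  Using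
  arbitrary matrices \<open>X\<close> in place of the choice of a minor makes the condition a union of the sets
  where a polynomial in the entries of \<open>M\<close> does not vanish, one for each \<open>X\<close>.
\<close>

lemma arrow_generated_iff_det:
  fixes M :: "'a \<Rightarrow> 'k::field mat"
  assumes Q: "fin_digraph Q" and s: "s \<in> verts Q" and d: "d \<in> dim_vectors Q" and M: "M \<in> rep_space Q d"
  shows "(d, M) \<in> arrow_generated Q s \<longleftrightarrow>
    (\<exists>X\<in>carrier_mat (length (incoming_index Q s d)) (d s). det (incoming_matrix Q s d M * X) \<noteq> 0)"
proof
  let ?L = "incoming_index Q s d" and ?C = "incoming_matrix Q s d M"
  have MQ: "(d, M) \<in> reps Q" using d M by (simp add: reps_def)
  have Mc: "M a \<in> carrier_mat (d s) (d (tail Q a))" if "a \<in> arcs Q" "head Q a = s" for a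
    using reps_carrier[OF MQ that(1)] that(2) by simp
  have C: "?C \<in> carrier_mat (d s) (length ?L)" by (simp add: incoming_matrix_def)
  have colC: "col ?C k = col (M a) t" if "k < length ?L" "?L ! k = (a, t)" for k a t
  proof -
    have "(a, t) \<in> set ?L" using that by (metis nth_mem)
    then have at: "a \<in> arcs Q" "head Q a = s" "t < d (tail Q a)" unfolding incoming_index[OF Q] by simp_all
    show ?thesis
      by (rule eq_vecI) (use that Mc[OF at(1,2)] at(3) in \<open>auto simp: incoming_matrix_def\<close>)
  qed
  {
    assume gen: "(d, M) \<in> arrow_generated Q s"
    have sub: "vec_subspace (d s) ((\<lambda>x. ?C *\<^sub>v x) ` carrier_vec (length ?L))"
      by (rule vec_subspace_image[OF _ C]) (auto simp: vec_subspace_def)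
    have "(\<lambda>x. ?C *\<^sub>v x) ` carrier_vec (length ?L) = carrier_vec (fst (d, M) s)"
    proof (rule arrow_generatedD[OF gen], unfold fst_conv snd_conv, rule sub)
      fix a and x :: "'k vec"
      assume a: "a \<in> arcs Q" "head Q a = s" and x: "x \<in> carrier_vec (d (tail Q a))"
      show "M a *\<^sub>v x \<in> (\<lambda>x. ?C *\<^sub>v x) ` carrier_vec (length ?L)"
      proof (rule mult_mat_vec_in_subspace[OF sub Mc[OF a] _ x])
        fix t assume "t < d (tail Q a)"
        then have "(a, t) \<in> set ?L" unfolding incoming_index[OF Q] using a by simp
        then obtain k where k: "k < length ?L" "?L ! k = (a, t)" by (metis in_set_conv_nth)
        then have "col (M a) t = ?C *\<^sub>v unit_vec (length ?L) k" using colC mult_unit_vec[OF C] by simp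
        then show "col (M a) t \<in> (\<lambda>x. ?C *\<^sub>v x) ` carrier_vec (length ?L)" by (rule image_eqI) simp
      qed
    qed
    then have "mat_range ?C = carrier_vec (d s)" using C by (simp add: mat_range_def)
    then obtain X where X: "X \<in> carrier_mat (length ?L) (d s)" "?C * X = 1\<^sub>m (d s)"
      using factor_through_range[OF C, of "1\<^sub>m (d s)" "d s"] by auto
    then show "\<exists>X\<in>carrier_mat (length ?L) (d s). det (?C * X) \<noteq> 0" by (intro bexI[of _ X]) simp_all
  }
  assume "\<exists>X\<in>carrier_mat (length ?L) (d s). det (?C * X) \<noteq> 0"
  then obtain X where X: "X \<in> carrier_mat (length ?L) (d s)" "det (?C * X) \<noteq> 0" by (elim bexE)
  show "(d, M) \<in> arrow_generated Q s"
  proof (rule arrow_generatedI[OF MQ], unfold fst_conv snd_conv)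
    fix W assume W: "vec_subspace (d s) W"
      and im: "\<And>a x. a \<in> arcs Q \<Longrightarrow> head Q a = s \<Longrightarrow> x \<in> carrier_vec (d (tail Q a)) \<Longrightarrow> M a *\<^sub>v x \<in> W"
    have col: "col ?C k \<in> W" if k: "k < length ?L" for k
    proof -
      obtain a t where at: "?L ! k = (a, t)" by (cases "?L ! k")
      then have "(a, t) \<in> set ?L" using k by (metis nth_mem)
      then have a: "a \<in> arcs Q" "head Q a = s" "t < d (tail Q a)" unfolding incoming_index[OF Q] by simp_all
      have "M a *\<^sub>v unit_vec (d (tail Q a)) t \<in> W" using im[OF a(1,2)] by simp
      then show ?thesis unfolding colC[OF k at] mult_unit_vec[OF Mc[OF a(1,2)] a(3)] .
    qed
    show "carrier_vec (d s) \<subseteq> W"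
    proof
      fix y :: "'k vec" assume "y \<in> carrier_vec (d s)"
      then obtain z where z: "z \<in> carrier_vec (d s)" "y = (?C * X) *\<^sub>v z"
        using det_nonzero_solve[OF mult_carrier_mat[OF C X(1)] X(2)] by blast
      have "?C *\<^sub>v (X *\<^sub>v z) \<in> W"
        by (rule mult_mat_vec_in_subspace[OF W C col]) (use X(1) z(1) in auto)
      then show "y \<in> W" using z(2) assoc_mult_mat_vec[OF C X(1) z(1)] by simp
    qed
  qed
qed

lemma open_fully_exact_arrow_generated:
  assumes Q: "fin_digraph Q" and s: "s \<in> verts Q"
  shows "open_fully_exact Q (arrow_generated Q s :: ('v, 'a, 'k::field) rep set)"
proof -
  interpret fin_digraph Q by fact
  have "openin (rep_zariski Q d) {M \<in> rep_space Q d. (d, M) \<in> (arrow_generated Q s :: ('v, 'a, 'k) rep set)}"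
    if d: "d \<in> dim_vectors Q" for d
    unfolding openin_rep_zariski
  proof -
    let ?V = "{(a, r, t). a \<in> arcs Q \<and> r < d (head Q a) \<and> t < d (tail Q a)}"
    let ?L = "incoming_index Q s d"
    let ?ev = "\<lambda>M :: 'a \<Rightarrow> 'k mat. mpol_eval (\<lambda>(a, r, t). M a $$ (r, t))"
    define P :: "'k mat \<Rightarrow> ('a \<times> nat \<times> nat, 'k) mpol mat" where
      "P X = mat (d s) (d s) (\<lambda>(r, c). \<Sum>k<length ?L. case ?L ! k of (a, t) \<Rightarrow>
        single (single (a, r, t) 1) (X $$ (k, c)))" for X
    have Pc: "P X \<in> carrier_mat (d s) (d s)" for X by (simp add: P_def)
    have "det (P X) \<in> polynomials_in ?V" for X
    proof (rule det_in_polynomials_in[OF Pc])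
      fix r c assume rc: "r < d s" "c < d s"
      have "(case ?L ! k of (a, t) \<Rightarrow> single (single (a, r, t) 1) (X $$ (k, c))) \<in> polynomials_in ?V"
        if k: "k < length ?L" for k
      proof -
        obtain a t where at: "?L ! k = (a, t)" by (cases "?L ! k")
        then have "(a, t) \<in> set ?L" using k by (metis nth_mem)
        then have "a \<in> arcs Q" "head Q a = s" "t < d (tail Q a)"
          unfolding incoming_index[OF Q] by simp_all
        then show ?thesis unfolding at using rc by (simp add: polynomials_in_def)
      qed
      then have "(\<Sum>k<length ?L. case ?L ! k of (a, t) \<Rightarrow> single (single (a, r, t) 1) (X $$ (k, c)))
          \<in> polynomials_in ?V"
        by (intro sum_in_polynomials_in) simp
      then show "P X $$ (r, c) \<in> polynomials_in ?V" using rc by (simp add: P_def)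
    qed
    moreover have "?ev M (det (P X)) = det (incoming_matrix Q s d M * X)"
      if X: "X \<in> carrier_mat (length ?L) (d s)" for M X
    proof -
      have "map_mat (?ev M) (P X) = incoming_matrix Q s d M * X"
        by (rule eq_matI)
           (use X in \<open>auto simp: P_def incoming_matrix_def mpol_eval_sum mpol_eval_single mon_eval_single
             scalar_prod_def lessThan_atLeast0 split: prod.split intro!: sum.cong\<close>)
      then show ?thesis by (simp add: mpol_eval_det)
    qed
    ultimately show "\<exists>S\<subseteq>polynomials_in ?V.
       {M \<in> rep_space Q d. (d, M) \<in> (arrow_generated Q s :: ('v, 'a, 'k) rep set)} =
       {M \<in> rep_space Q d. \<exists>f\<in>S. mpol_eval (\<lambda>(a, r, s). M a $$ (r, s)) f \<noteq> 0}"
      by (intro exI[of _ "(\<lambda>X. det (P X)) ` carrier_mat (length ?L) (d s)"])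
         (auto simp: arrow_generated_iff_det[OF Q s d])
  qed
  then show ?thesis
    unfolding open_fully_exact_def open_subcategory_def
    using additively_closed_arrow_generated[OF wf_digraph s] extension_closed_arrow_generated[OF wf_digraph s]
    by blast
qed

section \<open>Lines and points of projective space\<close>

definition line :: "'k::field vec \<Rightarrow> 'k vec set" where
  "line v = range (\<lambda>t. t \<cdot>\<^sub>v v)"

lemma line_self [simp]: "v \<in> line v"
  by (simp add: line_def image_iff) (metis one_smult_vec)

lemma line_carrier: "v \<in> carrier_vec n \<Longrightarrow> w \<in> line v \<Longrightarrow> w \<in> carrier_vec n"
  by (auto simp: line_def)

lemma line_smult:
  assumes "t \<noteq> 0"
  shows "line (t \<cdot>\<^sub>v v) = line v"
proof
  show "line (t \<cdot>\<^sub>v v) \<subseteq> line v" by (auto simp: line_def smult_smult_assoc)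
  have "s \<cdot>\<^sub>v v = (s / t) \<cdot>\<^sub>v (t \<cdot>\<^sub>v v)" for s using assms by (simp add: smult_smult_assoc)
  then show "line v \<subseteq> line (t \<cdot>\<^sub>v v)" unfolding line_def by blast
qed

lemma vec_nonzero_index:
  assumes "v \<in> carrier_vec n" "v \<noteq> 0\<^sub>v n"
  obtains i where "i < n" "v $ i \<noteq> 0"
proof (rule ccontr)
  assume "\<not> thesis"
  then have "v $ i = 0" if "i < n" for i using that \<open>\<And>i. i < n \<Longrightarrow> v $ i \<noteq> 0 \<Longrightarrow> thesis\<close> by blast
  then have "v = 0\<^sub>v n" using assms(1) by (intro eq_vecI) simp_all
  then show False using assms(2) by simp
qed

lemma line_eqD:
  assumes "line v = line w" "w \<in> carrier_vec n" "w \<noteq> 0\<^sub>v n"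
  obtains t where "t \<noteq> 0" "w = t \<cdot>\<^sub>v v"
proof -
  have "w \<in> line v" using assms(1) by simp
  then obtain t where t: "w = t \<cdot>\<^sub>v v" by (auto simp: line_def)
  have "t \<noteq> 0"
  proof
    assume "t = 0"
    then have "w = 0\<^sub>v n" using t assms(2) by (intro eq_vecI) auto
    then show False using assms(3) by simp
  qed
  with t show thesis by (rule that[rotated])
qed

lemma column_mult_vec:
  fixes A :: "'k::field mat"
  assumes "A \<in> carrier_mat n 1" "w \<in> carrier_vec 1"
  shows "A *\<^sub>v w = w $ 0 \<cdot>\<^sub>v col A 0"
  by (rule eq_vecI) (use assms in \<open>auto simp: scalar_prod_def\<close>)

lemma mat_range_column:
  fixes A :: "'k::field mat"
  assumes A: "A \<in> carrier_mat n 1"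
  shows "mat_range A = line (col A 0)"
proof
  show "mat_range A \<subseteq> line (col A 0)"
    using A column_mult_vec[OF A] by (auto simp: mat_range_def line_def)
  show "line (col A 0) \<subseteq> mat_range A"
  proof
    fix v assume "v \<in> line (col A 0)"
    then obtain t where "v = t \<cdot>\<^sub>v col A 0" by (auto simp: line_def)
    then have "v = A *\<^sub>v vec 1 (\<lambda>_. t)" using column_mult_vec[OF A, of "vec 1 (\<lambda>_. t)"] by simp
    then show "v \<in> mat_range A" using A unfolding mat_range_def by auto
  qed
qed

lemma mat_inj_column:
  fixes A :: "'k::field mat"
  assumes A: "A \<in> carrier_mat n 1"
  shows "mat_inj A \<longleftrightarrow> col A 0 \<noteq> 0\<^sub>v n"
proof
  assume inj: "mat_inj A"
  show "col A 0 \<noteq> 0\<^sub>v n"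
  proof
    assume "col A 0 = 0\<^sub>v n"
    then have "A *\<^sub>v w = 0\<^sub>v n" if "w \<in> carrier_vec 1" for w
      unfolding column_mult_vec[OF A that] by (intro eq_vecI) auto
    then have "A *\<^sub>v vec 1 (\<lambda>_. 1) = A *\<^sub>v vec 1 (\<lambda>_. 0)" by simp
    then have "vec 1 (\<lambda>_. 1 :: 'k) = vec 1 (\<lambda>_. 0)"
      using inj A unfolding mat_inj_def by (auto dest: inj_onD)
    then have "vec 1 (\<lambda>_. 1 :: 'k) $ 0 = vec 1 (\<lambda>_. 0) $ 0" by simp
    then show False by simp
  qed
next
  assume ne: "col A 0 \<noteq> 0\<^sub>v n"
  have "col A 0 \<in> carrier_vec n" using A by (intro carrier_vecI) simp
  from this ne obtain i where i: "i < n" "col A 0 $ i \<noteq> 0" by (rule vec_nonzero_index)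
  show "mat_inj A" unfolding mat_inj_def
  proof (rule inj_onI)
    fix v w assume vw: "v \<in> carrier_vec (dim_col A)" "w \<in> carrier_vec (dim_col A)" "A *\<^sub>v v = A *\<^sub>v w"
    then have c: "v \<in> carrier_vec 1" "w \<in> carrier_vec 1" using A by auto
    have "(v $ 0 \<cdot>\<^sub>v col A 0) $ i = (w $ 0 \<cdot>\<^sub>v col A 0) $ i"
      using vw(3) column_mult_vec[OF A c(1)] column_mult_vec[OF A c(2)] by simp
    then have "v $ 0 = w $ 0" using i A by simp
    then show "v = w" using c by (intro eq_vecI) auto
  qed
qed

text \<open>
  A point of \<open>Gr 1 n\<close> is a line, and its basis matrices are the nonzero vectors on it.
\<close>

lemma basis_matrix_1:
  "basis_matrix 1 n L A \<longleftrightarrow> A \<in> carrier_mat n 1 \<and> col A 0 \<noteq> 0\<^sub>v n \<and> L = line (col A 0)"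
  by (cases "A \<in> carrier_mat n 1") (auto simp add: basis_matrix_def mat_inj_column mat_range_column simp del: One_nat_def)

lemma basis_matrix_line:
  assumes "v \<in> carrier_vec n" "v \<noteq> 0\<^sub>v n"
  shows "basis_matrix 1 n (line v) (mat n 1 (\<lambda>(i, _). v $ i))"
proof -
  have c: "col (mat n 1 (\<lambda>(i, _). v $ i)) 0 = v" by (rule eq_vecI) (use assms in auto)
  show ?thesis unfolding basis_matrix_1 c using assms by simp
qed

lemma Gr_1_iff: "L \<in> Gr 1 n \<longleftrightarrow> (\<exists>v\<in>carrier_vec n. v \<noteq> 0\<^sub>v n \<and> L = line v)"
proof
  assume "L \<in> Gr 1 n"
  then obtain A where A: "A \<in> carrier_mat n 1" "col A 0 \<noteq> 0\<^sub>v n" "L = line (col A 0)"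
    unfolding Gr_def mem_Collect_eq basis_matrix_1 by (elim exE conjE)
  moreover have "col A 0 \<in> carrier_vec n" using A(1) by (intro carrier_vecI) simp
  ultimately show "\<exists>v\<in>carrier_vec n. v \<noteq> 0\<^sub>v n \<and> L = line v" by blast
qed (use basis_matrix_line in \<open>auto simp: Gr_def\<close>)

definition hom_coords :: "nat \<Rightarrow> 'k::field vec set \<Rightarrow> (nat \<Rightarrow> 'k) set" where
  "hom_coords n L = {(\<lambda>i. v $ i) | v. v \<in> L \<and> v \<noteq> 0\<^sub>v (Suc n)}"

lemma projective_space_alt:
  "projective_space n = multiprojective_variety {..n} (\<lambda>_. ()) (Gr 1 (Suc n)) (hom_coords n)"
  unfolding projective_space_def hom_coords_def[abs_def] ..

lemma hom_coordsE:
  assumes "L \<in> Gr 1 (Suc n)" "c \<in> hom_coords n L"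
  obtains v where "v \<in> carrier_vec (Suc n)" "v \<noteq> 0\<^sub>v (Suc n)" "L = line v" "c = (\<lambda>i. v $ i)"
proof -
  obtain w where w: "w \<in> carrier_vec (Suc n)" "w \<noteq> 0\<^sub>v (Suc n)" "L = line w" using assms(1) Gr_1_iff by blast
  obtain v where v: "v \<in> L" "v \<noteq> 0\<^sub>v (Suc n)" "c = (\<lambda>i. v $ i)" using assms(2) by (auto simp: hom_coords_def)
  obtain t where t: "v = t \<cdot>\<^sub>v w" using v(1) w(3) by (auto simp: line_def)
  have "t \<noteq> 0"
  proof
    assume "t = 0"
    then have "v = 0\<^sub>v (Suc n)" using t w(1) by (intro eq_vecI) auto
    then show False using v(2) by simp
  qed
  then have "L = line v" using t w(3) line_smult by metis
  moreover have "v \<in> carrier_vec (Suc n)" using t w(1) by simp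
  ultimately show thesis using v that by blast
qed

lemma hom_coords_line:
  assumes "v \<noteq> 0\<^sub>v (Suc n)"
  shows "(\<lambda>i. v $ i) \<in> hom_coords n (line v)"
  using assms by (auto simp: hom_coords_def)

lemma block_scaled_hom_coords:
  assumes L: "L \<in> Gr 1 (Suc n)"
  shows "block_scaled {..n} (\<lambda>_. ()) (hom_coords n L)"
  unfolding block_scaled_def
proof (intro conjI ballI)
  obtain v where "v \<noteq> 0\<^sub>v (Suc n)" "L = line v" using L Gr_1_iff by blast
  then show "hom_coords n L \<noteq> {}" using hom_coords_line by blast
  fix c c' assume c: "c \<in> hom_coords n L" "c' \<in> hom_coords n L"
  obtain v where v: "v \<in> carrier_vec (Suc n)" "L = line v" "c = (\<lambda>i. v $ i)"
    using hom_coordsE[OF L c(1)] by metis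
  obtain w where w: "w \<in> carrier_vec (Suc n)" "w \<noteq> 0\<^sub>v (Suc n)" "L = line w" "c' = (\<lambda>i. w $ i)"
    using hom_coordsE[OF L c(2)] by metis
  obtain t where t: "t \<noteq> 0" "w = t \<cdot>\<^sub>v v" using line_eqD[OF _ w(1,2)] v(2) w(3) by metis
  show "\<exists>t. (\<forall>i. t i \<noteq> 0) \<and> (\<forall>x\<in>{..n}. c' x = t () * c x)"
    by (rule exI[of _ "\<lambda>_. t"]) (use t v(1) in \<open>auto simp: v(3) w(4)\<close>)
qed

lemma topspace_projective_space:
  "topspace (zariski (projective_space n)) = (Gr 1 (Suc n) :: 'k::field vec set set)"
  unfolding projective_space_alt by (rule topspace_multiprojective) (rule block_scaled_hom_coords)

abbreviation homogeneous :: "nat \<Rightarrow> nat \<Rightarrow> (nat, 'k::zero) mpol set" where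
  "homogeneous n d \<equiv> multihomogeneous {..n} (\<lambda>_. ()) (\<lambda>_. d)"

section \<open>Locally closed subsets of projective space\<close>

text \<open>
  Multiplying a form by the powers \<open>x\<^sub>i\<^sup>k\<close> of all the coordinates does not change its zeros in
  projective space, since one of the coordinates of a point is nonzero.
\<close>

lemma same_degree_equations:
  fixes S :: "(nat, 'k::field) mpol set"
  assumes S: "finite S" "\<And>f. f \<in> S \<Longrightarrow> f \<in> homogeneous n (\<delta> f)" "\<And>f. f \<in> S \<Longrightarrow> \<delta> f \<le> d"
  shows "\<exists>F\<subseteq>homogeneous n d. finite F \<and>
    (\<forall>c. (\<exists>i\<le>n. c i \<noteq> 0) \<longrightarrow> (\<forall>f\<in>F. mpol_eval c f = 0) = (\<forall>f\<in>S. mpol_eval c f = 0))"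
proof -
  let ?x = "\<lambda>(i, f :: (nat, 'k) mpol). single (single i (d - \<delta> f)) 1 * f"
  let ?F = "?x ` ({..n} \<times> S)"
  have fin: "finite ?F" using S(1) by simp
  have ev: "mpol_eval c (?x (i, f)) = c i ^ (d - \<delta> f) * mpol_eval c f" for c i f
    by (simp add: mpol_eval_mult mpol_eval_single mon_eval_def)
  have "?F \<subseteq> homogeneous n d"
  proof
    fix h assume "h \<in> ?F"
    then obtain i f where i: "i \<in> {..n}" "f \<in> S"
      and h: "h = single (single i (d - \<delta> f)) 1 * f" by auto
    have "block_degree (\<lambda>_. ()) (single i (d - \<delta> f)) = (\<lambda>_. d - \<delta> f)"
      by (auto simp: block_degree_def fun_eq_iff)
    then have "single (single i (d - \<delta> f)) (1 :: 'k) \<in> homogeneous n (d - \<delta> f)"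
      using single_multihomogeneous[of "single i (d - \<delta> f)" "{..n}" "1 :: 'k" "\<lambda>_. ()"] i
      by (auto split: if_splits)
    from mult_multihomogeneous[OF this S(2)[OF i(2)]]
    show "h \<in> homogeneous n d"
      using S(3)[OF i(2)] h by simp
  qed
  moreover have "\<forall>c. (\<exists>i\<le>n. c i \<noteq> 0) \<longrightarrow> (\<forall>f\<in>?F. mpol_eval c f = 0) = (\<forall>f\<in>S. mpol_eval c f = 0)"
  proof (intro allI impI iffI ballI)
    fix c :: "nat \<Rightarrow> 'k" and f assume "\<exists>i\<le>n. c i \<noteq> 0" and F: "\<forall>f\<in>?F. mpol_eval c f = 0" and f: "f \<in> S"
    then obtain i where i: "i \<le> n" "c i \<noteq> 0" by blast
    then have "mpol_eval c (?x (i, f)) = 0" using F f by blast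
    then show "mpol_eval c f = 0" using i(2) unfolding ev by simp
  next
    fix c :: "nat \<Rightarrow> 'k" and h assume "\<forall>f\<in>S. mpol_eval c f = 0" "h \<in> ?F"
    then show "mpol_eval c h = 0" using ev by fastforce
  qed
  ultimately show ?thesis using fin by (intro exI[of _ ?F] conjI)
qed

lemma finite_homogeneous_subset:
  fixes S :: "(nat, 'k::field) mpol set"
  assumes "S \<subseteq> (\<Union>\<delta>. multihomogeneous {..n} (\<lambda>_. ()) \<delta>)"
  shows "\<exists>S0\<subseteq>S. finite S0 \<and> (\<forall>f\<in>S0. \<exists>e. f \<in> homogeneous n e) \<and>
    (\<forall>c. (\<forall>f\<in>S0. mpol_eval c f = 0) = (\<forall>f\<in>S. mpol_eval c f = 0))"
proof -
  have hom: "\<exists>e. f \<in> homogeneous n e" if f: "f \<in> S" for f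
  proof -
    have "f \<in> (\<Union>\<delta>. multihomogeneous {..n} (\<lambda>_. ()) \<delta>)" using f assms by (rule subsetD[rotated])
    then obtain \<delta> where "f \<in> multihomogeneous {..n} (\<lambda>_. ()) \<delta>" by (rule UN_E)
    moreover have "\<delta> = (\<lambda>_. \<delta> ())" by (rule ext) simp
    ultimately show ?thesis by metis
  qed
  then have "S \<subseteq> polynomials_in {..n}" by (auto simp: multihomogeneous_def)
  from finite_subset_same_zeros[OF _ this] obtain S0 where "S0 \<subseteq> S" "finite S0"
    "\<forall>c. (\<forall>f\<in>S0. mpol_eval c f = 0) \<longrightarrow> (\<forall>f\<in>S. mpol_eval c f = 0)" by blast
  with hom show ?thesis by (intro exI[of _ S0]) blast
qed

text \<open>
  A closed set and the complement of an open set are zero loci of finite sets of forms, which are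
  then brought to a common degree.  The requirement that \<open>G\<close> contains a nonzero form makes sure
  that the representation constructed from \<open>F\<close> and \<open>G\<close> is in the category.
\<close>

lemma locally_closed_presentation:
  assumes C: "closedin (zariski (projective_space n :: (_, 'k::field) variety)) C"
    and U: "openin (zariski (projective_space n :: (_, 'k) variety)) U"
  shows "\<exists>d F G. set F \<subseteq> homogeneous n d \<and> set G \<subseteq> homogeneous n d \<and> (\<exists>g\<in>set G. g \<noteq> 0) \<and>
    (\<forall>L\<in>Gr 1 (Suc n). \<forall>c\<in>hom_coords n L. L \<in> C \<inter> U \<longleftrightarrow>
       (\<forall>f\<in>set F. mpol_eval c f = 0) \<and> (\<exists>g\<in>set G. mpol_eval c g \<noteq> 0))"
proof (cases "C \<inter> U = {}")
  case True
  \<comment> \<open>the forms found in the other case could all be zero here, so the empty set is described by \<open>1 = 0\<close>\<close>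
  show ?thesis
    by (rule exI[of _ 0], rule exI[of _ "[1]"], rule exI[of _ "[1]"])
       (use one_multihomogeneous[of "{..n}" "\<lambda>_. ()"] True in \<open>auto simp del: zero_neq_one\<close>)
next
  case False
  let ?P = "Gr 1 (Suc n) :: 'k vec set set" and ?crd = "hom_coords n :: 'k vec set \<Rightarrow> _"
  have op: "openin (zariski (projective_space n)) V \<longleftrightarrow>
      (\<exists>S\<subseteq>(\<Union>\<delta>. multihomogeneous {..n} (\<lambda>_. ()) \<delta>). V = ?P - zero_locus ?P ?crd S)" for V
    unfolding openin_projective_space hom_coords_def ..
  have top: "topspace (zariski (projective_space n)) = ?P"
    unfolding projective_space_alt by (rule topspace_multiprojective) (rule block_scaled_hom_coords)
  obtain S where S: "S \<subseteq> (\<Union>\<delta>. multihomogeneous {..n} (\<lambda>_. ()) \<delta>)" "?P - C = ?P - zero_locus ?P ?crd S"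
    using C unfolding closedin_def top op by (elim exE conjE)
  obtain S' where S': "S' \<subseteq> (\<Union>\<delta>. multihomogeneous {..n} (\<lambda>_. ()) \<delta>)" "U = ?P - zero_locus ?P ?crd S'"
    using U unfolding op by (elim exE conjE)
  obtain S0 where S0: "finite S0" "\<forall>f\<in>S0. \<exists>e. f \<in> homogeneous n e"
    "\<forall>c. (\<forall>f\<in>S0. mpol_eval c f = 0) = (\<forall>f\<in>S. mpol_eval c f = 0)"
    using finite_homogeneous_subset[OF S(1)] by blast
  obtain S0' where S0': "finite S0'" "\<forall>f\<in>S0'. \<exists>e. f \<in> homogeneous n e"
    "\<forall>c. (\<forall>f\<in>S0'. mpol_eval c f = 0) = (\<forall>f\<in>S'. mpol_eval c f = 0)"
    using finite_homogeneous_subset[OF S'(1)] by blast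
  have "\<forall>f\<in>S0 \<union> S0'. \<exists>e. f \<in> homogeneous n e" using S0(2) S0'(2) by blast
  from bchoice[OF this] obtain \<delta> where \<delta>: "\<forall>f\<in>S0 \<union> S0'. f \<in> homogeneous n (\<delta> f)" by (elim exE)
  define d where "d = (\<Sum>f\<in>S0 \<union> S0'. \<delta> f)"
  have d: "\<delta> f \<le> d" if "f \<in> S0 \<union> S0'" for f
    unfolding d_def by (rule member_le_sum) (use that S0(1) S0'(1) in auto)
  obtain F0 where F0: "F0 \<subseteq> homogeneous n d" "finite F0"
    "\<forall>c. (\<exists>i\<le>n. c i \<noteq> 0) \<longrightarrow> (\<forall>f\<in>F0. mpol_eval c f = 0) = (\<forall>f\<in>S0. mpol_eval c f = 0)"
    using same_degree_equations[of S0 n \<delta> d] S0(1) \<delta> d by auto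
  obtain G0 where G0: "G0 \<subseteq> homogeneous n d" "finite G0"
    "\<forall>c. (\<exists>i\<le>n. c i \<noteq> 0) \<longrightarrow> (\<forall>f\<in>G0. mpol_eval c f = 0) = (\<forall>f\<in>S0'. mpol_eval c f = 0)"
    using same_degree_equations[of S0' n \<delta> d] S0'(1) \<delta> d by auto
  obtain F G where FG: "set F = F0" "set G = G0" using finite_list[OF F0(2)] finite_list[OF G0(2)] by blast
  have main: "L \<in> C \<inter> U \<longleftrightarrow> (\<forall>f\<in>F0. mpol_eval c f = 0) \<and> (\<exists>g\<in>G0. mpol_eval c g \<noteq> 0)"
    if L: "L \<in> ?P" and c: "c \<in> ?crd L" for L c
  proof -
    obtain v where v: "v \<in> carrier_vec (Suc n)" "v \<noteq> 0\<^sub>v (Suc n)" "c = (\<lambda>i. v $ i)"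
      using hom_coordsE[OF L c] by metis
    obtain i where "i < Suc n" "v $ i \<noteq> 0" using vec_nonzero_index[OF v(1,2)] by metis
    then have nz: "\<exists>i\<le>n. c i \<noteq> 0" unfolding v(3) by (intro exI[of _ i]) simp
    have zl: "L \<in> zero_locus ?P ?crd T \<longleftrightarrow> (\<forall>f\<in>T. mpol_eval c f = 0)"
      if T: "T \<subseteq> (\<Union>\<delta>. multihomogeneous {..n} (\<lambda>_. ()) \<delta>)" for T
    proof -
      have "mpol_eval c' f = 0" if f: "f \<in> T" "mpol_eval c f = 0" "c' \<in> ?crd L" for f c'
      proof -
        have "f \<in> (\<Union>\<delta>. multihomogeneous {..n} (\<lambda>_. ()) \<delta>)" using f(1) T by (rule subsetD[rotated])
        then obtain \<delta> where \<delta>: "f \<in> multihomogeneous {..n} (\<lambda>_. ()) \<delta>" by (rule UN_E)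
        obtain t where t: "\<forall>i. t i \<noteq> 0" "\<forall>x\<in>{..n}. c' x = t () * c x"
          using block_scaled_hom_coords[OF L] c f(3) unfolding block_scaled_def by blast
        show ?thesis
          using multihomogeneous_scale[where t = t and c = c and c' = c', OF \<delta>] t f(2) by force
      qed
      then show ?thesis using L c unfolding zero_locus_def by blast
    qed
    have "L \<in> C \<longleftrightarrow> L \<in> zero_locus ?P ?crd S" using S(2) L by blast
    also have "\<dots> \<longleftrightarrow> (\<forall>f\<in>F0. mpol_eval c f = 0)" using zl[OF S(1)] S0(3) F0(3) nz by simp
    finally have 1: "L \<in> C \<longleftrightarrow> (\<forall>f\<in>F0. mpol_eval c f = 0)" .
    have "L \<in> U \<longleftrightarrow> L \<notin> zero_locus ?P ?crd S'" using S'(2) L by blast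
    also have "\<dots> \<longleftrightarrow> \<not> (\<forall>g\<in>G0. mpol_eval c g = 0)" using zl[OF S'(1)] S0'(3) G0(3) nz by simp
    finally show ?thesis using 1 by blast
  qed
  obtain L where L: "L \<in> C" "L \<in> U" using False by blast
  have LP: "L \<in> ?P" using L(2) S'(2) by blast
  obtain c where "c \<in> ?crd L" using block_scaled_hom_coords[OF LP] by (auto simp: block_scaled_def)
  then have "\<exists>g\<in>G0. mpol_eval c g \<noteq> 0" using main[OF LP] L by blast
  then have nz: "\<exists>g\<in>G0. g \<noteq> 0" by (metis mpol_eval_0)
  show ?thesis
    by (rule exI[of _ d], rule exI[of _ F], rule exI[of _ G], unfold FG, intro conjI ballI F0(1) G0(1) nz main)
qed

section \<open>Matrix forms of subrepresentations and quotients\<close>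

lemma subrepresentation_representable:
  fixes M :: "('v, 'a, 'k::field) rep"
  assumes Q: "wf_digraph Q" and M: "M \<in> reps Q" and e: "e \<in> dim_vectors Q"
    and U: "U \<in> subrepresentations Q e M"
  shows "\<exists>A\<in>reps Q. represents_sub Q M U A"
proof -
  interpret wf_digraph Q by fact
  have Ui: "U i \<in> Gr (e i) (fst M i)" if "i \<in> verts Q" for i
    using U that by (auto simp: subrepresentations_def)
  have UM: "snd M a *\<^sub>v v \<in> U (head Q a)" if "a \<in> arcs Q" "v \<in> U (tail Q a)" for a v
    using U that by (auto simp: subrepresentations_def)
  have "\<forall>i\<in>verts Q. \<exists>f. basis_matrix (e i) (fst M i) (U i) f" using Ui by (auto simp: Gr_def)
  from bchoice[OF this] obtain f where f: "\<forall>i\<in>verts Q. basis_matrix (e i) (fst M i) (U i) (f i)" by (elim exE)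
  have fc: "f i \<in> carrier_mat (fst M i) (e i)" "mat_inj (f i)" "mat_range (f i) = U i" if "i \<in> verts Q" for i
    using f that by (auto simp: basis_matrix_def)
  have "\<exists>A. A \<in> carrier_mat (e (head Q a)) (e (tail Q a)) \<and> f (head Q a) * A = snd M a * f (tail Q a)"
    if a: "a \<in> arcs Q" for a
  proof -
    note c = reps_carrier[OF M a] and t = fc[OF tail_in_verts[OF a]] and h = fc[OF head_in_verts[OF a]]
    have im: "(snd M a * f (tail Q a)) *\<^sub>v x \<in> mat_range (f (head Q a))" if x: "x \<in> carrier_vec (e (tail Q a))" for x
    proof -
      have "f (tail Q a) *\<^sub>v x \<in> U (tail Q a)" using t x unfolding mat_range_def by auto
      then show ?thesis using UM[OF a] h(3) assoc_mult_mat_vec[OF c t(1) x] by simp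
    qed
    show ?thesis using factor_through_range[OF h(1) mult_carrier_mat[OF c t(1)] im] by blast
  qed
  then have "\<forall>a\<in>arcs Q. \<exists>A. A \<in> carrier_mat (e (head Q a)) (e (tail Q a)) \<and>
      f (head Q a) * A = snd M a * f (tail Q a)" by blast
  from bchoice[OF this] obtain A where A: "\<forall>a\<in>arcs Q. A a \<in> carrier_mat (e (head Q a)) (e (tail Q a)) \<and>
      f (head Q a) * A a = snd M a * f (tail Q a)" by (elim exE)
  have "(e, restrict A (arcs Q)) \<in> reps Q" using e A by (auto simp: reps_def rep_space_def)
  moreover have "restrict f (verts Q) \<in> rep_hom Q (e, restrict A (arcs Q)) M"
    using fc(1) A by (auto simp: rep_hom_def)
  then have "represents_sub Q M U (e, restrict A (arcs Q))"
    unfolding represents_sub_def by (rule bexI[rotated]) (use fc in auto)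
  ultimately show ?thesis by blast
qed

lemma vec_minus_eq_zeroD:
  fixes a b :: "'k::ab_group_add vec"
  assumes "a \<in> carrier_vec k" "b \<in> carrier_vec k" and z: "a - b = 0\<^sub>v k"
  shows "a = b"
proof (rule eq_vecI)
  fix i assume "i < dim_vec b"
  then have i: "i < k" using assms(2) by simp
  have "(a - b) $ i = 0" unfolding z using i by simp
  then show "a $ i = b $ i" using i assms(1,2) by simp
qed (use assms in simp)

text \<open>
  With a right inverse \<open>s\<close> of \<open>g\<close> at the source of an arrow, the induced map on the quotients is
  \<open>g M s\<close>: for all \<open>x\<close> the vector \<open>x - s (g x)\<close> lies in the kernel \<open>U\<close>, which \<open>M\<close> preserves.
\<close>

lemma quotient_representable:
  fixes M :: "('v, 'a, 'k::field) rep"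
  assumes Q: "wf_digraph Q" and M: "M \<in> reps Q" and k: "k \<in> dim_vectors Q"
    and U: "U \<in> subrepresentations Q e M"
    and g: "\<And>i. i \<in> verts Q \<Longrightarrow> g i \<in> carrier_mat (k i) (fst M i)"
      "\<And>i. i \<in> verts Q \<Longrightarrow> mat_range (g i) = carrier_vec (k i)"
      "\<And>i. i \<in> verts Q \<Longrightarrow> mat_kernel (g i) = U i"
  shows "\<exists>B\<in>reps Q. fst B = k \<and> represents_quotient Q M U B"
proof -
  interpret wf_digraph Q by fact
  have UM: "snd M a *\<^sub>v v \<in> U (head Q a)" if "a \<in> arcs Q" "v \<in> U (tail Q a)" for a v
    using U that by (auto simp: subrepresentations_def)
  have "\<forall>i\<in>verts Q. \<exists>s. s \<in> carrier_mat (fst M i) (k i) \<and> g i * s = 1\<^sub>m (k i)"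
  proof
    fix i assume i: "i \<in> verts Q"
    show "\<exists>s. s \<in> carrier_mat (fst M i) (k i) \<and> g i * s = 1\<^sub>m (k i)"
      using factor_through_range[OF g(1)[OF i], of "1\<^sub>m (k i)" "k i"] g(2)[OF i] by auto
  qed
  from bchoice[OF this] obtain s where s: "\<forall>i\<in>verts Q. s i \<in> carrier_mat (fst M i) (k i) \<and> g i * s i = 1\<^sub>m (k i)"
    by (elim exE)
  define B where "B a = g (head Q a) * snd M a * s (tail Q a)" for a
  have B: "B a \<in> carrier_mat (k (head Q a)) (k (tail Q a)) \<and> g (head Q a) * snd M a = B a * g (tail Q a)"
    if a: "a \<in> arcs Q" for a
  proof
    let ?t = "tail Q a" and ?h = "head Q a"
    note c = reps_carrier[OF M a] and t = g[OF tail_in_verts[OF a]] and h = g[OF head_in_verts[OF a]]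
    have st: "s ?t \<in> carrier_mat (fst M ?t) (k ?t)" "g ?t * s ?t = 1\<^sub>m (k ?t)"
      using s tail_in_verts[OF a] by auto
    show Bc: "B a \<in> carrier_mat (k ?h) (k ?t)" unfolding B_def using h(1) c st(1) by simp
    show "g ?h * snd M a = B a * g ?t"
    proof (rule mat_eq_by_vec[of _ "k ?h" "fst M ?t"])
      show "g ?h * snd M a \<in> carrier_mat (k ?h) (fst M ?t)" using h(1) c by simp
      show "B a * g ?t \<in> carrier_mat (k ?h) (fst M ?t)" using Bc t(1) by simp
      fix x :: "'k vec" assume x: "x \<in> carrier_vec (fst M ?t)"
      define y where "y = s ?t *\<^sub>v (g ?t *\<^sub>v x)"
      have gx: "g ?t *\<^sub>v x \<in> carrier_vec (k ?t)" using t(1) x by simp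
      have y: "y \<in> carrier_vec (fst M ?t)" unfolding y_def using st(1) gx by simp
      have "g ?t *\<^sub>v y = (g ?t * s ?t) *\<^sub>v (g ?t *\<^sub>v x)"
        unfolding y_def using assoc_mult_mat_vec[OF t(1) st(1) gx] by simp
      then have gy: "g ?t *\<^sub>v y = g ?t *\<^sub>v x" unfolding st(2) using gx by simp
      have "g ?t *\<^sub>v (x - y) = 0\<^sub>v (k ?t)"
        using mult_minus_distrib_mat_vec[OF t(1) x y] gy gx by simp
      then have "x - y \<in> U ?t" using t(1) x y unfolding t(3)[symmetric] mat_kernel_def by auto
      then have "snd M a *\<^sub>v (x - y) \<in> mat_kernel (g ?h)" using UM[OF a] h(3) by simp
      then have "g ?h *\<^sub>v (snd M a *\<^sub>v (x - y)) = 0\<^sub>v (k ?h)" using h(1) by (auto simp: mat_kernel_def)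
      moreover have Mx: "snd M a *\<^sub>v x \<in> carrier_vec (fst M ?h)" and My: "snd M a *\<^sub>v y \<in> carrier_vec (fst M ?h)"
        using c x y by auto
      moreover have "snd M a *\<^sub>v (x - y) = snd M a *\<^sub>v x - snd M a *\<^sub>v y"
        by (rule mult_minus_distrib_mat_vec[OF c x y])
      ultimately have z: "g ?h *\<^sub>v (snd M a *\<^sub>v x) - g ?h *\<^sub>v (snd M a *\<^sub>v y) = 0\<^sub>v (k ?h)"
        using mult_minus_distrib_mat_vec[OF h(1) Mx My] by simp
      have gc: "g ?h *\<^sub>v (snd M a *\<^sub>v x) \<in> carrier_vec (k ?h)" "g ?h *\<^sub>v (snd M a *\<^sub>v y) \<in> carrier_vec (k ?h)"
        using h(1) Mx My by auto
      have eq: "g ?h *\<^sub>v (snd M a *\<^sub>v x) = g ?h *\<^sub>v (snd M a *\<^sub>v y)"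
        by (rule vec_minus_eq_zeroD[OF gc z])
      have "(g ?h * snd M a) *\<^sub>v x = g ?h *\<^sub>v (snd M a *\<^sub>v y)"
        using assoc_mult_mat_vec[OF h(1) c x] eq by simp
      also have "\<dots> = (g ?h * snd M a) *\<^sub>v (s ?t *\<^sub>v (g ?t *\<^sub>v x))"
        unfolding y_def using assoc_mult_mat_vec[OF h(1) c y] y_def by simp
      also have "\<dots> = B a *\<^sub>v (g ?t *\<^sub>v x)"
        unfolding B_def using assoc_mult_mat_vec[OF mult_carrier_mat[OF h(1) c] st(1) gx] by simp
      also have "\<dots> = (B a * g ?t) *\<^sub>v x" using assoc_mult_mat_vec[OF Bc t(1) x] by simp
      finally show "(g ?h * snd M a) *\<^sub>v x = (B a * g ?t) *\<^sub>v x" .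
    qed
  qed
  have "(k, restrict B (arcs Q)) \<in> reps Q" using k B by (auto simp: reps_def rep_space_def)
  moreover have "restrict g (verts Q) \<in> rep_hom Q M (k, restrict B (arcs Q))"
    using g(1) B by (auto simp: rep_hom_def)
  then have "represents_quotient Q M U (k, restrict B (arcs Q))"
    unfolding represents_quotient_def by (rule bexI[rotated]) (use g in auto)
  ultimately show ?thesis by force
qed

text \<open>
  If the coordinate \<open>p\<close> of \<open>v\<close> is nonzero, then subtracting the multiple \<open>y\<^sub>p / v\<^sub>p\<close> of \<open>v\<close> from \<open>y\<close> kills
  the coordinate \<open>p\<close>; the remaining coordinates, renumbered by \<open>\<sigma>\<close>, define a map with kernel \<open>\<langle>v\<rangle>\<close>.
\<close>

lemma line_complement:
  fixes v :: "'k::field vec"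
  assumes v: "v \<in> carrier_vec n" "v \<noteq> 0\<^sub>v n"
  shows "\<exists>g\<in>carrier_mat (n - 1) n. mat_range g = carrier_vec (n - 1) \<and> mat_kernel g = line v"
proof -
  obtain p where p: "p < n" "v $ p \<noteq> 0" using vec_nonzero_index[OF v] by metis
  define \<sigma> where "\<sigma> k = (if k < p then k else Suc k)" for k
  define g where "g = mat (n - 1) n (\<lambda>(k, j). if j = \<sigma> k then 1 else if j = p then - (v $ \<sigma> k / v $ p) else 0)"
  have g: "g \<in> carrier_mat (n - 1) n" by (simp add: g_def)
  have \<sigma>: "\<sigma> k < n" "\<sigma> k \<noteq> p" if "k < n - 1" for k using that p(1) by (auto simp: \<sigma>_def)
  have \<sigma>_surj: "\<exists>k<n - 1. \<sigma> k = j" if j: "j < n" "j \<noteq> p" for j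
  proof (cases "j < p")
    case True then show ?thesis using p(1) by (intro exI[of _ j]) (auto simp: \<sigma>_def)
  next
    case False
    then have "\<sigma> (j - 1) = j" using j(2) by (auto simp: \<sigma>_def)
    then show ?thesis using j False by (intro exI[of _ "j - 1"]) auto
  qed
  have ap: "(g *\<^sub>v y) $ k = y $ \<sigma> k - v $ \<sigma> k / v $ p * y $ p" if k: "k < n - 1" and y: "y \<in> carrier_vec n" for y k
  proof -
    have "(g *\<^sub>v y) $ k = (\<Sum>j\<in>{0..<n}. g $$ (k, j) * y $ j)"
      using k y by (simp add: scalar_prod_def g_def)
    also have "\<dots> = (\<Sum>j\<in>{\<sigma> k, p}. g $$ (k, j) * y $ j)"
      by (rule sum.mono_neutral_right) (use \<sigma>[OF k] p(1) k in \<open>auto simp: g_def\<close>)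
    also have "\<dots> = y $ \<sigma> k - v $ \<sigma> k / v $ p * y $ p"
      using \<sigma>[OF k] k p(1) by (simp add: g_def)
    finally show ?thesis .
  qed
  have "mat_range g = carrier_vec (n - 1)"
  proof
    show "mat_range g \<subseteq> carrier_vec (n - 1)" using g by (auto simp: mat_range_def)
    show "carrier_vec (n - 1) \<subseteq> mat_range g"
    proof
      fix z :: "'k vec" assume z: "z \<in> carrier_vec (n - 1)"
      define y where "y = vec n (\<lambda>j. if j = p then 0 else z $ (if j < p then j else j - 1))"
      have y: "y \<in> carrier_vec n" by (simp add: y_def)
      have "g *\<^sub>v y = z"
      proof (rule eq_vecI)
        fix k assume "k < dim_vec z"
        then have k: "k < n - 1" using z by simp
        have "y $ \<sigma> k = z $ k" "y $ p = 0" using \<sigma>[OF k] p(1) by (auto simp: y_def \<sigma>_def)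
        then show "(g *\<^sub>v y) $ k = z $ k" using ap[OF k y] by simp
      qed (use g z in auto)
      then show "z \<in> mat_range g" using g y unfolding mat_range_def by (intro image_eqI[of _ _ y]) auto
    qed
  qed
  moreover have "mat_kernel g = line v"
  proof
    show "mat_kernel g \<subseteq> line v"
    proof
      fix y assume "y \<in> mat_kernel g"
      then have y: "y \<in> carrier_vec n" "g *\<^sub>v y = 0\<^sub>v (n - 1)" using g by (auto simp: mat_kernel_def)
      have "y = (y $ p / v $ p) \<cdot>\<^sub>v v"
      proof (rule eq_vecI)
        fix j assume "j < dim_vec ((y $ p / v $ p) \<cdot>\<^sub>v v)"
        then have j: "j < n" using v(1) by simp
        show "y $ j = ((y $ p / v $ p) \<cdot>\<^sub>v v) $ j"
        proof (cases "j = p")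
          case False
          then obtain k where k: "k < n - 1" "\<sigma> k = j" using \<sigma>_surj[OF j] by blast
          have "(g *\<^sub>v y) $ k = 0" using y(2) k(1) by simp
          then show ?thesis using ap[OF k(1) y(1)] k(2) j v(1) by simp
        qed (use p v(1) in simp)
      qed (use y v in auto)
      then show "y \<in> line v" unfolding line_def by blast
    qed
    show "line v \<subseteq> mat_kernel g"
    proof
      fix y assume "y \<in> line v"
      then obtain t where t: "y = t \<cdot>\<^sub>v v" by (auto simp: line_def)
      have y: "y \<in> carrier_vec n" using t v(1) by simp
      have "g *\<^sub>v y = 0\<^sub>v (n - 1)"
      proof (rule eq_vecI)
        fix k assume "k < dim_vec (0\<^sub>v (n - 1) :: 'k vec)"
        then have k: "k < n - 1" by simp
        show "(g *\<^sub>v y) $ k = 0\<^sub>v (n - 1) $ k"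
          using ap[OF k y] \<sigma>[OF k] p v(1) k by (simp add: t)
      qed (use g in auto)
      then show "y \<in> mat_kernel g" using y g by (auto simp: mat_kernel_def)
    qed
  qed
  ultimately show ?thesis using g by blast
qed

text \<open>
  Whether the restriction of \<open>M\<close> to \<open>U\<close> is generated at \<open>s\<close> can be decided inside \<open>M\<close>, independently of
  the matrix form \<open>A\<close>.
\<close>

lemma arrow_generated_sub_iff:
  assumes Q: "wf_digraph Q" and s: "s \<in> verts Q" and M: "(M :: ('v, 'a, 'k::field) rep) \<in> reps Q"
    and A: "A \<in> reps Q" and sub: "represents_sub Q M U A"
  shows "A \<in> arrow_generated Q s \<longleftrightarrow>
    (\<forall>W. vec_subspace (fst M s) W \<longrightarrow>
      (\<forall>a\<in>arcs Q. head Q a = s \<longrightarrow> (\<forall>x\<in>U (tail Q a). snd M a *\<^sub>v x \<in> W)) \<longrightarrow> U s \<subseteq> W)"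
proof -
  interpret wf_digraph Q by fact
  obtain f where f: "f \<in> rep_hom Q A M" and fU: "\<forall>i\<in>verts Q. mat_inj (f i) \<and> mat_range (f i) = U i"
    using sub unfolding represents_sub_def by (elim bexE)
  note fc = rep_hom_carrier[OF f]
  have U: "U i = (\<lambda>v. f i *\<^sub>v v) ` carrier_vec (fst A i)" if "i \<in> verts Q" for i
  proof -
    have "U i = mat_range (f i)" using fU that by simp
    then show ?thesis using carrier_matD(2)[OF fc[OF that]] by (simp add: mat_range_def)
  qed
  show ?thesis
  proof
    assume gen: "A \<in> arrow_generated Q s"
    show "\<forall>W. vec_subspace (fst M s) W \<longrightarrow>
      (\<forall>a\<in>arcs Q. head Q a = s \<longrightarrow> (\<forall>x\<in>U (tail Q a). snd M a *\<^sub>v x \<in> W)) \<longrightarrow> U s \<subseteq> W"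
    proof (intro allI impI)
      fix W assume W: "vec_subspace (fst M s) W"
        and im: "\<forall>a\<in>arcs Q. head Q a = s \<longrightarrow> (\<forall>x\<in>U (tail Q a). snd M a *\<^sub>v x \<in> W)"
      have "f (tail Q a) *\<^sub>v x \<in> U (tail Q a)"
        if "a \<in> arcs Q" "x \<in> carrier_vec (fst A (tail Q a))" for a x
        using U[OF tail_in_verts[OF that(1)]] that(2) by blast
      then have "f s *\<^sub>v x \<in> W" if "x \<in> carrier_vec (fst A s)" for x
        using arrow_generated_hom[OF Q s gen M f W _ that] im by blast
      then show "U s \<subseteq> W" unfolding U[OF s] by blast
    qed
  next
    assume gen: "\<forall>W. vec_subspace (fst M s) W \<longrightarrow>
      (\<forall>a\<in>arcs Q. head Q a = s \<longrightarrow> (\<forall>x\<in>U (tail Q a). snd M a *\<^sub>v x \<in> W)) \<longrightarrow> U s \<subseteq> W"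
    show "A \<in> arrow_generated Q s"
    proof (rule arrow_generatedI[OF A])
      fix W assume W: "vec_subspace (fst A s) W"
        and im: "\<And>a x. a \<in> arcs Q \<Longrightarrow> head Q a = s \<Longrightarrow> x \<in> carrier_vec (fst A (tail Q a)) \<Longrightarrow> snd A a *\<^sub>v x \<in> W"
      have "snd M a *\<^sub>v x \<in> (\<lambda>x. f s *\<^sub>v x) ` W" if a: "a \<in> arcs Q" "head Q a = s" "x \<in> U (tail Q a)" for a x
      proof -
        obtain y where y: "y \<in> carrier_vec (fst A (tail Q a))" "x = f (tail Q a) *\<^sub>v y"
          using U[OF tail_in_verts[OF a(1)]] a(3) by blast
        have "snd M a *\<^sub>v x = f s *\<^sub>v (snd A a *\<^sub>v y)"
          using rep_hom_apply[OF Q A M f a(1) y(1)] a(2) y(2) by simp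
        then show ?thesis using im[OF a(1,2) y(1)] by blast
      qed
      then have sub: "U s \<subseteq> (\<lambda>x. f s *\<^sub>v x) ` W"
        using gen vec_subspace_image[OF W fc[OF s]] by blast
      have inj: "inj_on (\<lambda>v. f s *\<^sub>v v) (carrier_vec (fst A s))"
        using fU s fc[OF s] by (auto simp: mat_inj_def)
      show "carrier_vec (fst A s) \<subseteq> W"
      proof
        fix y :: "'k vec" assume y: "y \<in> carrier_vec (fst A s)"
        then have "f s *\<^sub>v y \<in> (\<lambda>x. f s *\<^sub>v x) ` W" using sub U[OF s] by blast
        then obtain w where w: "w \<in> W" "f s *\<^sub>v y = f s *\<^sub>v w" by blast
        moreover have "w \<in> carrier_vec (fst A s)" using w(1) vec_subspaceD(1)[OF W] by blast
        ultimately show "y \<in> W" using inj_onD[OF inj, of y w] y by simp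
      qed
    qed
  qed
qed

section \<open>Products of Grassmannians\<close>

definition pluecker :: "'v set \<Rightarrow> ('v \<Rightarrow> nat) \<Rightarrow> ('v \<Rightarrow> nat) \<Rightarrow> ('v \<Rightarrow> 'k::field vec set) \<Rightarrow> ('v \<times> nat set \<Rightarrow> 'k) set" where
  "pluecker J e d U = {(\<lambda>(i, I). det (submatrix (A i) I UNIV)) | A.
     \<forall>i\<in>J. basis_matrix (e i) (d i) (U i) (A i)}"

abbreviation pluecker_index :: "'v set \<Rightarrow> ('v \<Rightarrow> nat) \<Rightarrow> ('v \<Rightarrow> nat) \<Rightarrow> ('v \<times> nat set) set" where
  "pluecker_index J e d \<equiv> {(i, I). i \<in> J \<and> I \<subseteq> {..<d i} \<and> card I = e i}"

lemma Gr_product_alt: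
  "Gr_product J e d = multiprojective_variety (pluecker_index J e d) fst (\<Pi>\<^sub>E i\<in>J. Gr (e i) (d i)) (pluecker J e d)"
  unfolding Gr_product_def pluecker_def[abs_def] ..

text \<open>
  A change of basis at \<open>i\<close> multiplies all Pluecker coordinates of the block \<open>i\<close> by its determinant.
\<close>

lemma block_scaled_pluecker:
  fixes U :: "'v \<Rightarrow> 'k::field vec set"
  assumes U: "U \<in> (\<Pi>\<^sub>E i\<in>J. Gr (e i) (d i))"
  shows "block_scaled (pluecker_index J e d) fst (pluecker J e d U)"
  unfolding block_scaled_def
proof (intro conjI ballI)
  have "\<forall>i\<in>J. \<exists>A. basis_matrix (e i) (d i) (U i) A" using U by (auto simp: Gr_def)
  from bchoice[OF this] obtain A where "\<forall>i\<in>J. basis_matrix (e i) (d i) (U i) (A i)" by (elim exE)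
  then show "pluecker J e d U \<noteq> {}" unfolding pluecker_def by blast
  fix c c' assume c: "c \<in> pluecker J e d U" "c' \<in> pluecker J e d U"
  obtain A where A: "c = (\<lambda>(i, I). det (submatrix (A i) I UNIV))"
    "\<forall>i\<in>J. basis_matrix (e i) (d i) (U i) (A i)" using c(1) unfolding pluecker_def by blast
  obtain B where B: "c' = (\<lambda>(i, I). det (submatrix (B i) I UNIV))"
    "\<forall>i\<in>J. basis_matrix (e i) (d i) (U i) (B i)" using c(2) unfolding pluecker_def by blast
  have "\<forall>i\<in>J. \<exists>g. g \<in> carrier_mat (e i) (e i) \<and> det g \<noteq> 0 \<and> B i = A i * g"
  proof
    fix i assume "i \<in> J"
    then show "\<exists>g. g \<in> carrier_mat (e i) (e i) \<and> det g \<noteq> 0 \<and> B i = A i * g"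
      using basis_matrix_change[of "e i" "d i" "U i" "A i" "B i"] A(2) B(2) by metis
  qed
  from bchoice[OF this] obtain g where
    g: "\<forall>i\<in>J. g i \<in> carrier_mat (e i) (e i) \<and> det (g i) \<noteq> 0 \<and> B i = A i * g i" by (elim exE)
  have "c' x = det (g (fst x)) * c x" if x: "x \<in> pluecker_index J e d" for x
  proof -
    obtain i I where I: "x = (i, I)" "i \<in> J" "I \<subseteq> {..<d i}" "card I = e i" using x by auto
    have "A i \<in> carrier_mat (d i) (e i)" using A(2) I(2) by (simp add: basis_matrix_def)
    from det_submatrix_mult[OF this _ I(3,4), of "g i"] g I(2) show ?thesis
      by (simp add: A(1) B(1) I(1) mult.commute)
  qed
  then show "\<exists>t. (\<forall>i. t i \<noteq> 0) \<and> (\<forall>x\<in>pluecker_index J e d. c' x = t (fst x) * c x)"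
    using g by (intro exI[of _ "\<lambda>i. if i \<in> J then det (g i) else 1"]) auto
qed

lemma det_submatrix_singleton:
  fixes A :: "'k::field mat"
  assumes A: "A \<in> carrier_mat N 1" and k: "k < N"
  shows "det (submatrix A {k} UNIV) = A $$ (k, 0)"
proof -
  have I: "{i. i < dim_row A \<and> i \<in> {k}} = {k}" "{j. j < dim_col A \<and> j \<in> UNIV} = {0}" using A k by auto
  have dim: "submatrix A {k} UNIV \<in> carrier_mat 1 1" unfolding submatrix_def I by simp
  have "submatrix A {k} UNIV $$ (0, 0) = A $$ (pick {k} 0, pick UNIV 0)"
    unfolding submatrix_def I by simp
  also have "pick {k} 0 = k" by (simp add: Least_equality)
  also have "pick UNIV 0 = 0" by (simp add: pick_UNIV)
  finally show ?thesis using det_single[OF dim] by simp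
qed

lemma det_submatrix_empty: "det (submatrix A {} UNIV) = 1" if "A \<in> carrier_mat m 0" for A :: "'k::field mat"
proof -
  have "submatrix A {} UNIV \<in> carrier_mat 0 0" unfolding submatrix_def using that by simp
  then show ?thesis by simp
qed

text \<open>
  The Pluecker coordinates of a line are its homogeneous coordinates, so the projection is given by
  variables.
\<close>

lemma morphism_projection:
  assumes J: "finite J" "j \<in> J" and j: "e j = 1" "d j = Suc n"
  shows "morphism (Gr_product J e d :: ('v \<Rightarrow> 'k::field vec set, 'k) variety) (projective_space n) (\<lambda>U. U j)"
  unfolding Gr_product_alt projective_space_alt
proof (rule morphism_subst[where J = "{()}" and D = "\<lambda>_ i. if i = j then 1 else 0" and
      q = "\<lambda>i. single (single (j, {i}) 1) 1"])
  show "block_scaled (pluecker_index J e d) fst (pluecker J e d p)"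
    if "p \<in> (\<Pi>\<^sub>E i\<in>J. Gr (e i) (d i))" for p :: "'v \<Rightarrow> 'k vec set"
    using that by (rule block_scaled_pluecker)
  show "block_scaled {..n} (\<lambda>_. ()) (hom_coords n p)" if "p \<in> Gr 1 (Suc n)" for p :: "'k vec set"
    using that by (rule block_scaled_hom_coords)
  show "U j \<in> Gr 1 (Suc n)" if "U \<in> (\<Pi>\<^sub>E i\<in>J. Gr (e i) (d i))" for U :: "'v \<Rightarrow> 'k vec set"
    using that J(2) j by (metis PiE_mem)
  show "single (single (j, {i}) 1) (1 :: 'k)
      \<in> multihomogeneous (pluecker_index J e d) fst (\<lambda>i. if i = j then 1 else 0)" if "i \<in> {..n}" for i
  proof -
    have "block_degree fst (single (j, {i}) 1) = (\<lambda>i. if i = j then 1 else 0)"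
      by (simp add: block_degree_single fun_eq_iff)
    moreover have "keys (single (j, {i}) (1 :: nat)) \<subseteq> pluecker_index J e d"
      using that J(2) j by auto
    ultimately show ?thesis
      using single_multihomogeneous[of "single (j, {i}) 1" "pluecker_index J e d" "1 :: 'k" fst] by simp
  qed
  fix U :: "'v \<Rightarrow> 'k vec set" and c
  assume U: "U \<in> (\<Pi>\<^sub>E i\<in>J. Gr (e i) (d i))" and c: "c \<in> pluecker J e d U"
  obtain A where A: "c = (\<lambda>(i, I). det (submatrix (A i) I UNIV))"
    "\<forall>i\<in>J. basis_matrix (e i) (d i) (U i) (A i)" using c unfolding pluecker_def by blast
  have Aj: "A j \<in> carrier_mat (Suc n) 1" "col (A j) 0 \<noteq> 0\<^sub>v (Suc n)" "U j = line (col (A j) 0)"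
    using A(2) J(2) j basis_matrix_1 by metis+
  show "\<exists>c'\<in>hom_coords n (U j). \<forall>y\<in>{..n}.
      c' y = mpol_eval c (single (single (j, {y}) 1) 1)"
  proof (rule bexI)
    show "(\<lambda>i. col (A j) 0 $ i) \<in> hom_coords n (U j)" unfolding Aj(3) by (rule hom_coords_line[OF Aj(2)])
    show "\<forall>y\<in>{..n}. col (A j) 0 $ y = mpol_eval c (single (single (j, {y}) 1) 1)"
      using Aj(1) by (simp add: mpol_eval_single mon_eval_single A(1) det_submatrix_singleton[OF Aj(1)])
  qed
qed auto

lemma mat_range_no_columns:
  fixes A :: "'k::field mat"
  assumes "A \<in> carrier_mat n 0"
  shows "mat_range A = {0\<^sub>v n}"
proof -
  have "A *\<^sub>v 0\<^sub>v 0 = 0\<^sub>v n" by (rule eq_vecI) (use assms in \<open>auto simp: scalar_prod_def\<close>)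
  moreover have "dim_col A = 0" using assms by simp
  ultimately show ?thesis by (simp add: mat_range_def carrier_vec_0)
qed

lemma basis_matrix_0: "basis_matrix 0 n U A \<longleftrightarrow> A \<in> carrier_mat n 0 \<and> U = {0\<^sub>v n}"
  unfolding basis_matrix_def using mat_range_no_columns
  by (auto simp: mat_inj_def carrier_vec_0)

lemma Gr_0: "Gr 0 n = {{0\<^sub>v n}}"
  unfolding Gr_def basis_matrix_0 by (auto intro: zero_carrier_mat)

lemma line_1:
  fixes v :: "'k::field vec"
  assumes v: "v \<in> carrier_vec 1" "v \<noteq> 0\<^sub>v 1"
  shows "line v = carrier_vec 1"
proof
  show "line v \<subseteq> carrier_vec 1" using line_carrier[OF v(1)] by blast
  obtain i where "i < 1" "v $ i \<noteq> 0" using vec_nonzero_index[OF v] by metis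
  then have nz: "v $ 0 \<noteq> 0" by simp
  show "carrier_vec 1 \<subseteq> line v"
  proof
    fix x :: "'k vec" assume x: "x \<in> carrier_vec 1"
    have "x = (x $ 0 / v $ 0) \<cdot>\<^sub>v v" by (rule eq_vecI) (use x v(1) nz in auto)
    then show "x \<in> line v" unfolding line_def by blast
  qed
qed

lemma one_mat_range: "mat_range (1\<^sub>m n) = carrier_vec n"
  by (auto simp: mat_range_def image_iff)

lemma basis_matrix_full: "basis_matrix n n (carrier_vec n) (1\<^sub>m n)"
  by (auto simp: basis_matrix_def one_mat_range mat_inj_def inj_on_def)

lemma Gr_1_1: "Gr 1 1 = {carrier_vec 1 :: 'k::field vec set}"
proof -
  have "carrier_vec 1 \<in> Gr 1 1" unfolding Gr_def using basis_matrix_full by blast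
  then show ?thesis using line_1 Gr_1_iff by blast
qed

section \<open>Monomials and the Veronese embedding\<close>

definition monomials :: "nat \<Rightarrow> nat \<Rightarrow> (nat \<Rightarrow>\<^sub>0 nat) set" where
  "monomials n d = {m. keys m \<subseteq> {..n} \<and> block_degree (\<lambda>_. ()) m = (\<lambda>_. d)}"

lemma block_degree_unit: "block_degree (\<lambda>_. ()) m i = (\<Sum>x\<in>keys m. lookup m x)"
  by (simp add: block_degree_def)

lemma finite_monomials: "finite (monomials n d)"
proof (rule finite_imageD)
  have "lookup ` monomials n d \<subseteq> {f. \<forall>x. (x \<in> {..n} \<longrightarrow> f x \<in> {..d}) \<and> (x \<notin> {..n} \<longrightarrow> f x = 0)}"
  proof clarify
    fix m x assume m: "m \<in> monomials n d"
    have deg: "(\<Sum>x\<in>keys m. lookup m x) = d"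
      using m block_degree_unit[of m "()"] by (simp add: monomials_def)
    have "lookup m x \<le> d"
    proof (cases "x \<in> keys m")
      case True
      then show ?thesis unfolding deg[symmetric] by (intro member_le_sum) auto
    qed (simp add: in_keys_iff)
    moreover have "lookup m x = 0" if "x \<notin> {..n}"
      using m that by (auto simp: monomials_def in_keys_iff subset_iff)
    ultimately show "(x \<in> {..n} \<longrightarrow> lookup m x \<in> {..d}) \<and> (x \<notin> {..n} \<longrightarrow> lookup m x = 0)"
      by simp
  qed
  moreover have "finite {f :: nat \<Rightarrow> nat. \<forall>x. (x \<in> {..n} \<longrightarrow> f x \<in> {..d}) \<and> (x \<notin> {..n} \<longrightarrow> f x = 0)}"
    by (rule finite_set_of_finite_funs) auto
  ultimately show "finite (lookup ` monomials n d)" by (rule finite_subset)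
  show "inj_on lookup (monomials n d)" by (auto intro: inj_onI poly_mapping_eqI)
qed

lemma single_in_monomials: "i \<le> n \<Longrightarrow> single i d \<in> monomials n d"
  by (simp add: monomials_def block_degree_single fun_eq_iff)

lemma monomials_add:
  assumes "m \<in> monomials n d" "m' \<in> monomials n e"
  shows "m + m' \<in> monomials n (d + e)"
  using assms keys_add[of m m'] by (auto simp: monomials_def fun_eq_iff block_degree_add)

lemma monomials_Suc: "m \<in> monomials n d \<Longrightarrow> i \<le> n \<Longrightarrow> m + single i 1 \<in> monomials n (Suc d)"
  using monomials_add[of m n d "single i 1" 1] single_in_monomials[of i n 1] by simp

lemma monomials_decompose:
  assumes m: "m \<in> monomials n d" and i: "i \<in> keys m"
  obtains e m' where "Suc e = d" "m' \<in> monomials n e" "m = m' + single i 1"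
proof -
  let ?m' = "m - single i 1"
  have eq: "m = ?m' + single i 1"
    by (rule poly_mapping_eqI) (use i in \<open>auto simp: lookup_add lookup_minus lookup_single when_def in_keys_iff\<close>)
  have k: "keys ?m' \<subseteq> {..n}"
    using m by (auto simp: monomials_def in_keys_iff lookup_minus subset_iff)
  have "block_degree (\<lambda>_. ()) m () = block_degree (\<lambda>_. ()) ?m' () + block_degree (\<lambda>_. ()) (single i (1::nat)) ()"
    by (subst eq) (rule block_degree_add)
  also have "block_degree (\<lambda>_. ()) (single i (1::nat)) () = 1" by (simp add: block_degree_unit)
  also have "block_degree (\<lambda>_. ()) m () = d" using m by (simp add: monomials_def)
  finally have "Suc (block_degree (\<lambda>_. ()) ?m' ()) = d" by simp
  moreover have "?m' \<in> monomials n (block_degree (\<lambda>_. ()) ?m' ())" using k by (simp add: monomials_def fun_eq_iff)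
  ultimately show thesis using eq that by blast
qed

lemma mon_eval_scale:
  fixes c c' :: "nat \<Rightarrow> 'k::comm_semiring_1"
  assumes m: "m \<in> monomials n d" and c': "\<And>i. i \<le> n \<Longrightarrow> c' i = t * c i"
  shows "mon_eval c' m = t ^ d * mon_eval c m"
proof -
  have "mon_eval c' m = (\<Prod>x\<in>keys m. t ^ lookup m x * c x ^ lookup m x)"
    unfolding mon_eval_def
    by (rule prod.cong) (use m c' in \<open>auto simp: monomials_def power_mult_distrib subset_iff\<close>)
  also have "\<dots> = t ^ (\<Sum>x\<in>keys m. lookup m x) * mon_eval c m"
    by (simp add: prod.distrib mon_eval_def power_sum)
  also have "(\<Sum>x\<in>keys m. lookup m x) = d"
    using m block_degree_unit[of m "()"] by (simp add: monomials_def)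
  finally show ?thesis .
qed

lemma mpol_eval_homogeneous:
  assumes "f \<in> homogeneous n d"
  shows "mpol_eval c f = (\<Sum>m\<in>monomials n d. lookup f m * mon_eval c m)"
  by (rule mpol_eval_superset[OF finite_monomials])
     (use assms in \<open>auto simp: multihomogeneous_def polynomials_in_def monomials_def\<close>)

definition mon_list :: "nat \<Rightarrow> nat \<Rightarrow> (nat \<Rightarrow>\<^sub>0 nat) list" where
  "mon_list n d = sorted_list_of_set (monomials n d)"

lemma mon_list: "set (mon_list n d) = monomials n d" "distinct (mon_list n d)"
  by (simp_all add: mon_list_def finite_monomials)

lemma sum_mon_list: "(\<Sum>k<length (mon_list n d). g (mon_list n d ! k)) = (\<Sum>m\<in>monomials n d. g m)"
  by (rule sum.reindex_bij_betw) (use bij_betw_nth[OF mon_list(2) refl] mon_list(1) in auto)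

text \<open>
  Vectors of the space with one basis vector for each monomial of degree \<open>d\<close> are handled as functions
  on monomials rather than on positions in a list.
\<close>

definition coeff_vec :: "nat \<Rightarrow> nat \<Rightarrow> ((nat \<Rightarrow>\<^sub>0 nat) \<Rightarrow> 'k) \<Rightarrow> 'k vec" where
  "coeff_vec n d h = vec (length (mon_list n d)) (\<lambda>k. h (mon_list n d ! k))"

lemma coeff_vec_carrier [simp]: "coeff_vec n d h \<in> carrier_vec (length (mon_list n d))"
  by (simp add: coeff_vec_def)

lemma coeff_vec_eqI:
  assumes "\<And>m. m \<in> monomials n d \<Longrightarrow> h m = h' m"
  shows "coeff_vec n d h = coeff_vec n d h'"
  unfolding coeff_vec_def using assms mon_list(1)[of n d] by (intro eq_vecI) (auto simp: set_conv_nth)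

lemma coeff_vec_smult: "coeff_vec n d (\<lambda>m. t * h m) = t \<cdot>\<^sub>v coeff_vec n d h"
  by (rule eq_vecI) (auto simp: coeff_vec_def)

lemma coeff_vec_surj:
  assumes "v \<in> carrier_vec (length (mon_list n d))"
  obtains h where "v = coeff_vec n d h"
proof
  let ?L = "mon_list n d"
  show "v = coeff_vec n d (\<lambda>m. v $ (SOME k. k < length ?L \<and> ?L ! k = m))"
  proof (rule eq_vecI)
    fix k assume "k < dim_vec (coeff_vec n d (\<lambda>m. v $ (SOME k. k < length ?L \<and> ?L ! k = m)))"
    then have k: "k < length ?L" by (simp add: coeff_vec_def)
    have "(SOME k'. k' < length ?L \<and> ?L ! k' = ?L ! k) = k"
      by (rule some_equality) (use k mon_list(2)[of n d] in \<open>auto simp: nth_eq_iff_index_eq\<close>)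
    then show "v $ k = coeff_vec n d (\<lambda>m. v $ (SOME k. k < length ?L \<and> ?L ! k = m)) $ k"
      using k by (simp add: coeff_vec_def)
  qed (use assms in \<open>simp add: coeff_vec_def\<close>)
qed

lemma coeff_vec_nonzero:
  assumes "m \<in> monomials n d" "h m \<noteq> (0 :: 'k::zero)"
  shows "coeff_vec n d h \<noteq> 0\<^sub>v (length (mon_list n d))"
proof
  assume z: "coeff_vec n d h = 0\<^sub>v (length (mon_list n d))"
  obtain k where k: "k < length (mon_list n d)" "mon_list n d ! k = m"
    using assms(1) mon_list(1) by (metis in_set_conv_nth)
  then have "coeff_vec n d h $ k = h m" by (simp add: coeff_vec_def)
  then show False using z k assms(2) by simp
qed

text \<open>
  The linear map that takes \<open>w\<close> to the vector of its coordinates at the monomials \<open>m x\<^sub>i\<close>, where \<open>m\<close> has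
  degree \<open>d - 1\<close>.
\<close>

definition contraction :: "nat \<Rightarrow> nat \<Rightarrow> (nat \<Rightarrow>\<^sub>0 nat) \<Rightarrow> 'k::field mat" where
  "contraction n d m = mat (Suc n) (length (mon_list n d))
     (\<lambda>(i, k). if mon_list n d ! k = m + single i 1 then 1 else 0)"

lemma contraction_apply:
  fixes h :: "(nat \<Rightarrow>\<^sub>0 nat) \<Rightarrow> 'k::field"
  assumes m: "m \<in> monomials n e" "Suc e = d"
  shows "contraction n d m *\<^sub>v coeff_vec n d h = vec (Suc n) (\<lambda>i. h (m + single i 1))"
proof (rule eq_vecI)
  fix i assume "i < dim_vec (vec (Suc n) (\<lambda>i. h (m + single i 1)))"
  then have i: "i < Suc n" by simp
  let ?m = "m + single i 1"
  have mem: "?m \<in> monomials n d" using monomials_Suc[OF m(1), of i] m(2) i by simp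
  have "(contraction n d m *\<^sub>v coeff_vec n d h) $ i =
      (\<Sum>k<length (mon_list n d). (if mon_list n d ! k = ?m then 1 else 0) * h (mon_list n d ! k))"
    using i by (simp add: contraction_def coeff_vec_def scalar_prod_def lessThan_atLeast0)
  also have "\<dots> = (\<Sum>m'\<in>monomials n d. (if m' = ?m then 1 else 0) * h m')"
    by (rule sum_mon_list)
  also have "\<dots> = h ?m" using mem finite_monomials[of n d] by (simp add: if_distrib[of "\<lambda>x. x * _"] cong: if_cong)
  finally show "(contraction n d m *\<^sub>v coeff_vec n d h) $ i = vec (Suc n) (\<lambda>i. h (m + single i 1)) $ i"
    using i by simp
qed (simp add: contraction_def)

definition functional :: "nat \<Rightarrow> nat \<Rightarrow> (nat, 'k::field) mpol \<Rightarrow> 'k mat" where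
  "functional n d f = mat 1 (length (mon_list n d)) (\<lambda>(_, k). lookup f (mon_list n d ! k))"

lemma functional_apply:
  "functional n d f *\<^sub>v coeff_vec n d h = vec 1 (\<lambda>_. \<Sum>m\<in>monomials n d. lookup f m * h m)"
proof (rule eq_vecI)
  fix i assume "i < dim_vec (vec 1 (\<lambda>_. \<Sum>m\<in>monomials n d. lookup f m * h m))"
  then show "(functional n d f *\<^sub>v coeff_vec n d h) $ i = vec 1 (\<lambda>_. \<Sum>m\<in>monomials n d. lookup f m * h m) $ i"
    by (simp add: functional_def coeff_vec_def scalar_prod_def flip: sum_mon_list lessThan_atLeast0)
qed (simp add: functional_def)

definition veronese :: "nat \<Rightarrow> nat \<Rightarrow> 'k::field vec \<Rightarrow> 'k vec" where
  "veronese n d v = coeff_vec n d (mon_eval (\<lambda>i. v $ i))"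

lemma veronese_carrier [simp]: "veronese n d v \<in> carrier_vec (length (mon_list n d))"
  by (simp add: veronese_def)

lemma veronese_nonzero:
  assumes "v \<in> carrier_vec (Suc n)" "v \<noteq> 0\<^sub>v (Suc n)"
  shows "veronese n d v \<noteq> 0\<^sub>v (length (mon_list n d))"
proof -
  obtain p where p: "p < Suc n" "v $ p \<noteq> 0" using vec_nonzero_index[OF assms] by metis
  show ?thesis unfolding veronese_def
    by (rule coeff_vec_nonzero[of "single p d"])
       (use p in \<open>auto simp: single_in_monomials mon_eval_single\<close>)
qed

lemma veronese_smult:
  assumes "v \<in> carrier_vec (Suc n)"
  shows "veronese n d (t \<cdot>\<^sub>v v) = t ^ d \<cdot>\<^sub>v veronese n d v"
  unfolding veronese_def coeff_vec_smult[symmetric]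
  by (rule coeff_vec_eqI, rule mon_eval_scale) (use assms in auto)

lemma functional_veronese:
  assumes "f \<in> homogeneous n d"
  shows "functional n d f *\<^sub>v veronese n d v = vec 1 (\<lambda>_. mpol_eval (\<lambda>i. v $ i) f)"
  unfolding veronese_def functional_apply mpol_eval_homogeneous[OF assms] ..

lemma contraction_veronese:
  assumes "m \<in> monomials n e" "Suc e = d" "v \<in> carrier_vec (Suc n)"
  shows "contraction n d m *\<^sub>v veronese n d v = mon_eval (\<lambda>i. v $ i) m \<cdot>\<^sub>v v"
  unfolding veronese_def contraction_apply[OF assms(1,2)]
  by (rule eq_vecI) (use assms(3) in \<open>auto simp: mon_eval_add mon_eval_single\<close>)

text \<open>
  Let \<open>h m\<close> be the coordinates of \<open>w\<close>, let \<open>x\<^sub>p \<noteq> 0\<close> and \<open>c = x / x\<^sub>p\<close>.  The hypothesis says that the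
  vector of all \<open>h (m x\<^sub>i)\<close> is proportional to \<open>x\<close>, so \<open>h (m x\<^sub>i) = c\<^sub>i h (m x\<^sub>p)\<close>.  Replacing the
  variables of a monomial by \<open>x\<^sub>p\<close> one after another yields \<open>h m = c\<^sup>m h (x\<^sub>p\<^sup>d)\<close>, whence \<open>w\<close> is a multiple
  of the vector of monomials in \<open>x\<close>.
\<close>

lemma veronese_recognition:
  fixes x w :: "'k::field vec"
  assumes x: "x \<in> carrier_vec (Suc n)" "x \<noteq> 0\<^sub>v (Suc n)"
    and w: "w \<in> carrier_vec (length (mon_list n d))" "w \<noteq> 0\<^sub>v (length (mon_list n d))"
    and con: "\<And>m e. m \<in> monomials n e \<Longrightarrow> Suc e = d \<Longrightarrow> contraction n d m *\<^sub>v w \<in> line x"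
  shows "line w = line (veronese n d x)"
proof -
  obtain p where p: "p \<le> n" "x $ p \<noteq> 0" using vec_nonzero_index[OF x] by (metis less_Suc_eq_le)
  obtain h where h: "w = coeff_vec n d h" using coeff_vec_surj[OF w(1)] .
  have step: "h (m + single i 1) = x $ i / x $ p * h (m + single p 1)"
    if m: "m \<in> monomials n e" "Suc e = d" "i \<le> n" for m e i
  proof -
    have "vec (Suc n) (\<lambda>i. h (m + single i 1)) \<in> line x"
      using con[OF m(1,2)] unfolding h contraction_apply[OF m(1,2)] .
    then obtain t where t: "vec (Suc n) (\<lambda>i. h (m + single i 1)) = t \<cdot>\<^sub>v x" by (auto simp: line_def)
    have "h (m + single k 1) = t * x $ k" if "k \<le> n" for k
    proof -
      have "vec (Suc n) (\<lambda>i. h (m + single i 1)) $ k = (t \<cdot>\<^sub>v x) $ k" by (simp only: t)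
      then show ?thesis using that x(1) by simp
    qed
    then show ?thesis using m(3) p by simp
  qed
  define c where "c i = x $ i / x $ p" for i
  \<comment> \<open>by induction on the degree of \<open>m\<close> in the variables other than \<open>p\<close>\<close>
  have key: "h m = h (single p d) * mon_eval c m" if "m \<in> monomials n d" for m
    using that
  proof (induction "d - lookup m p" arbitrary: m rule: less_induct)
    case less
    show ?case
    proof (cases "keys m \<subseteq> {p}")
      case True
      have "lookup m p = d"
      proof -
        have "d = (\<Sum>x\<in>keys m. lookup m x)"
          using less.prems block_degree_unit[of m "()"] by (simp add: monomials_def)
        also have "\<dots> = (\<Sum>x\<in>{p}. lookup m x)"
          by (rule sum.mono_neutral_left) (use True in \<open>auto simp: in_keys_iff\<close>)
        finally show ?thesis by simp
      qed
      then have "m = single p d"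
        using True by (intro poly_mapping_eqI) (auto simp: lookup_single when_def in_keys_iff subset_iff)
      moreover have "c p = 1" using p by (simp add: c_def)
      ultimately show ?thesis by (simp add: mon_eval_single)
    next
      case False
      then obtain i where i: "i \<in> keys m" "i \<noteq> p" by blast
      have "i \<le> n" using i(1) less.prems by (auto simp: monomials_def)
      obtain e m' where m': "Suc e = d" "m' \<in> monomials n e" "m = m' + single i 1"
        using monomials_decompose[OF less.prems i(1)] .
      let ?m = "m' + single p 1"
      have mem: "?m \<in> monomials n d" using monomials_Suc[OF m'(2) p(1)] m'(1) by simp
      have "lookup ?m p \<le> d"
      proof -
        have "lookup ?m p \<le> (\<Sum>x\<in>keys ?m. lookup ?m x)"
          by (intro member_le_sum) (auto simp: in_keys_iff lookup_add)
        then show ?thesis using mem block_degree_unit[of ?m "()"] by (simp add: monomials_def)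
      qed
      moreover have "lookup ?m p = Suc (lookup m p)"
        using i(2) by (simp add: m'(3) lookup_add lookup_single when_def)
      ultimately have "d - lookup ?m p < d - lookup m p" by simp
      from less.hyps[OF this mem] have "h ?m = h (single p d) * mon_eval c ?m" .
      moreover have "mon_eval c ?m = mon_eval c m'"
        using p by (simp add: mon_eval_add mon_eval_single c_def)
      moreover have "h m = c i * h ?m" unfolding m'(3) c_def using step[OF m'(2,1) \<open>i \<le> n\<close>] .
      moreover have "mon_eval c m = mon_eval c m' * c i" by (simp add: m'(3) mon_eval_add mon_eval_single)
      ultimately show ?thesis by (simp add: mult_ac)
    qed
  qed
  define t where "t = h (single p d) * (1 / x $ p) ^ d"
  have "h m = t * mon_eval (\<lambda>i. x $ i) m" if m: "m \<in> monomials n d" for m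
  proof -
    have "mon_eval c m = (1 / x $ p) ^ d * mon_eval (\<lambda>i. x $ i) m"
      by (rule mon_eval_scale[OF m]) (simp add: c_def)
    then show ?thesis unfolding key[OF m] t_def by simp
  qed
  then have w_eq: "w = t \<cdot>\<^sub>v veronese n d x"
    unfolding h veronese_def coeff_vec_smult[symmetric] by (rule coeff_vec_eqI)
  have "t \<noteq> 0"
  proof
    assume "t = 0"
    then have "w = 0\<^sub>v (length (mon_list n d))" unfolding w_eq by (intro eq_vecI) (auto simp: veronese_def coeff_vec_def)
    then show False using w(2) by simp
  qed
  then show ?thesis unfolding w_eq by (rule line_smult)
qed

section \<open>The quiver of a locally closed subset\<close>

text \<open>
  The forms \<open>F\<close> and \<open>G\<close> describe the locus where all members of \<open>F\<close> vanish and some member of \<open>G\<close>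
  does not.  The arrows of the quiver are the positions in a list that records the target and the
  matrix of each arrow; their common source is the vertex \<open>0\<close>.
\<close>

locale locally_closed_locus =
  fixes n d :: nat and F G :: "(nat, 'k::field) mpol list"
  assumes F: "set F \<subseteq> homogeneous n d" and G: "set G \<subseteq> homogeneous n d" and G_nz: "\<exists>g\<in>set G. g \<noteq> 0"
begin

text \<open>
  For \<open>d = 0\<close> there are no arrows to vertex \<open>1\<close>, and the line there is unrestricted; the space at
  vertex \<open>0\<close> then has dimension one.
\<close>

definition contracted_mons :: "(nat \<Rightarrow>\<^sub>0 nat) list" where
  "contracted_mons = (case d of 0 \<Rightarrow> [] | Suc e \<Rightarrow> mon_list n e)"

definition arrows :: "(nat \<times> 'k mat) list" where
  "arrows = map (\<lambda>m. (1, contraction n d m)) contracted_mons @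
     map (\<lambda>f. (2, functional n d f)) F @ map (\<lambda>g. (3, functional n d g)) G"

definition Q :: "(nat, nat) pre_digraph" where
  "Q = \<lparr>verts = {0, 1, 2, 3}, arcs = {..<length arrows}, tail = (\<lambda>_. 0), head = (\<lambda>a. fst (arrows ! a))\<rparr>"

definition N :: nat where "N = length (mon_list n d)"

definition dims :: "nat \<Rightarrow> nat" where
  "dims = (\<lambda>i\<in>{0, 1, 2, 3}. if i = 0 then N else if i = 1 then Suc n else 1)"

definition subdims :: "nat \<Rightarrow> nat" where
  "subdims = (\<lambda>i\<in>{0, 1, 2, 3}. if i = 2 then 0 else 1)"

definition V :: "(nat, nat, 'k) rep" where
  "V = (dims, \<lambda>a\<in>{..<length arrows}. snd (arrows ! a))"

abbreviation E :: "(nat, nat, 'k) rep set" where "E \<equiv> arrow_generated Q 3"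

lemma Q_sel [simp]: "verts Q = {0, 1, 2, 3}" "arcs Q = {..<length arrows}" "tail Q a = 0"
  by (simp_all add: Q_def)

lemma dims_simps [simp]: "dims 0 = N" "dims 1 = Suc n" "dims (Suc 0) = Suc n" "dims 2 = 1" "dims 3 = 1"
  by (simp_all add: dims_def)

lemma subdims_simps [simp]: "subdims 0 = 1" "subdims 1 = 1" "subdims (Suc 0) = 1" "subdims 2 = 0" "subdims 3 = 1"
  by (simp_all add: subdims_def)

lemma fst_V [simp]: "fst V = dims"
  by (simp add: V_def)

lemma contracted_mons_iff: "m \<in> set contracted_mons \<longleftrightarrow> (\<exists>e. Suc e = d \<and> m \<in> monomials n e)"
  unfolding contracted_mons_def by (cases d) (simp_all add: mon_list(1))

lemma all_arcs:
  "(\<forall>a\<in>arcs Q. P (head Q a) (snd V a)) \<longleftrightarrow>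
     (\<forall>m\<in>set contracted_mons. P 1 (contraction n d m)) \<and> (\<forall>f\<in>set F. P 2 (functional n d f)) \<and>
     (\<forall>g\<in>set G. P 3 (functional n d g))"
proof -
  have "(\<forall>a\<in>arcs Q. P (head Q a) (snd V a)) \<longleftrightarrow> (\<forall>x\<in>set arrows. P (fst x) (snd x))"
    by (auto simp: Q_def V_def all_set_conv_all_nth)
  also have "\<dots> \<longleftrightarrow> (\<forall>m\<in>set contracted_mons. P 1 (contraction n d m)) \<and> (\<forall>f\<in>set F. P 2 (functional n d f)) \<and>
     (\<forall>g\<in>set G. P 3 (functional n d g))"
    unfolding arrows_def by (simp add: ball_Un)
  finally show ?thesis .
qed

lemma fin_digraph_Q: "fin_digraph Q"
proof -
  have "\<forall>a\<in>arcs Q. head Q a \<in> {0, 1, 2, 3}"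
    using all_arcs[of "\<lambda>h _. h \<in> {0, 1, 2, 3}"] by simp
  then show ?thesis by unfold_locales auto
qed

lemma wf_digraph_Q: "wf_digraph Q"
  using fin_digraph_Q by (simp add: fin_digraph_def)

lemma V_reps: "V \<in> reps Q"
proof -
  have "\<forall>a\<in>arcs Q. snd V a \<in> carrier_mat (dims (head Q a)) N"
    using all_arcs[of "\<lambda>h M. M \<in> carrier_mat (dims h) N"]
    by (simp add: contraction_def functional_def N_def)
  then have "snd V \<in> rep_space Q dims" by (auto simp: V_def rep_space_def)
  moreover have "dims \<in> dim_vectors Q" by (simp add: dims_def dim_vectors_def)
  ultimately show ?thesis by (simp add: reps_def V_def)
qed

lemma subdims: "subdims \<in> dim_vectors Q" "\<forall>i\<in>verts Q. subdims i \<le> fst V i"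
proof -
  show "subdims \<in> dim_vectors Q" by (auto simp: dim_vectors_def subdims_def)
  have "N > 0" using single_in_monomials[of 0 n d] mon_list(1)[of n d] by (auto simp: N_def)
  then show "\<forall>i\<in>verts Q. subdims i \<le> fst V i" by auto
qed

text \<open>
  All arrows start at \<open>0\<close> and none ends there, so paths have length at most one.
\<close>

lemma path_algebra_finite: "finite_dimensional (path_algebra Q :: (nat \<times> nat list \<Rightarrow>\<^sub>0 'k) set)"
proof -
  have no0: "\<forall>a\<in>arcs Q. head Q a \<noteq> 0"
    using all_arcs[of "\<lambda>h _. h \<noteq> 0"] by simp
  have "quiver_paths Q \<subseteq> verts Q \<times> {p. set p \<subseteq> arcs Q \<and> length p \<le> 1}"
  proof
    fix x assume x: "x \<in> quiver_paths Q"
    obtain u p where up: "x = (u, p)" by (cases x)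
    have "(u, p) \<in> quiver_paths Q" using x up by simp
    then obtain v where p: "u \<in> verts Q" "set p \<subseteq> arcs Q" "pre_digraph.cas Q u p v"
      by (auto simp: quiver_paths_def pre_digraph.awalk_def)
    have "length p \<le> 1"
    proof (cases p)
      case (Cons a q)
      have "q = []"
      proof (cases q)
        case (Cons b r)
        then have "tail Q b = head Q a" using p(3) \<open>p = a # q\<close> by (simp add: pre_digraph.cas.simps)
        moreover have "head Q a \<noteq> 0" using bspec[OF no0, of a] p(2) \<open>p = a # q\<close> by simp
        ultimately show ?thesis by simp
      qed
      then show ?thesis using Cons by simp
    qed simp
    then show "x \<in> verts Q \<times> {p. set p \<subseteq> arcs Q \<and> length p \<le> 1}" using p up by simp
  qed
  then have fin: "finite (quiver_paths Q)"
    by (rule finite_subset) (auto intro: finite_lists_length_le)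
  let ?B = "(\<lambda>w. single w (1 :: 'k)) ` quiver_paths Q"
  show ?thesis
    unfolding finite_dimensional_def
  proof (intro exI[of _ ?B] conjI ballI)
    show "finite ?B" using fin by simp
    show "?B \<subseteq> path_algebra Q" by (auto simp: path_algebra_def)
    fix f :: "nat \<times> nat list \<Rightarrow>\<^sub>0 'k" assume f: "f \<in> path_algebra Q"
    define c where "c b = lookup f (the_elem (keys b))"
      for b :: "nat \<times> nat list \<Rightarrow>\<^sub>0 'k"
    have "(\<Sum>b\<in>?B. Poly_Mapping.map (\<lambda>t. c b * t) b) =
        (\<Sum>w\<in>quiver_paths Q. Poly_Mapping.map (\<lambda>t. c (single w 1) * t) (single w (1 :: 'k)))"
      by (rule sum.reindex_cong[of "\<lambda>w. single w (1 :: 'k)"])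
         (auto intro!: inj_onI dest: arg_cong[of _ _ keys])
    also have "\<dots> = (\<Sum>w\<in>quiver_paths Q. single w (lookup f w))"
      by (rule sum.cong) (simp_all add: c_def map_single)
    also have "\<dots> = f"
    proof (rule poly_mapping_eqI)
      fix w
      show "lookup (\<Sum>w\<in>quiver_paths Q. single w (lookup f w)) w = lookup f w"
      proof (cases "w \<in> quiver_paths Q")
        case False
        then have "w \<notin> keys f" using f by (auto simp: path_algebra_def)
        then show ?thesis using False fin by (simp add: lookup_sum lookup_single when_def in_keys_iff)
      qed (use fin in \<open>simp add: lookup_sum lookup_single when_def\<close>)
    qed
    finally have "(\<Sum>b\<in>?B. Poly_Mapping.map (\<lambda>t. c b * t) b) = f" .
    then show "\<exists>c. f = (\<Sum>b\<in>?B. Poly_Mapping.map (\<lambda>t. c b * t) b)" by (intro exI[of _ c]) (rule sym)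
  qed
qed

text \<open>
  The space at vertex \<open>3\<close> is one-dimensional, so it is spanned by the images of the arrows as soon as
  one of these is nonzero.
\<close>

lemma generated_at_sink_iff:
  "(\<forall>W. vec_subspace (fst V 3) W \<longrightarrow>
      (\<forall>a\<in>arcs Q. head Q a = 3 \<longrightarrow> (\<forall>x\<in>U (tail Q a). snd V a *\<^sub>v x \<in> W)) \<longrightarrow> carrier_vec 1 \<subseteq> W) \<longleftrightarrow>
   (\<exists>g\<in>set G. \<exists>x\<in>U 0. functional n d g *\<^sub>v x \<noteq> 0\<^sub>v 1)" (is "?L \<longleftrightarrow> ?R")
proof -
  have arcs: "(\<forall>a\<in>arcs Q. head Q a = 3 \<longrightarrow> (\<forall>x\<in>U (tail Q a). snd V a *\<^sub>v x \<in> W)) \<longleftrightarrow>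
      (\<forall>g\<in>set G. \<forall>x\<in>U 0. functional n d g *\<^sub>v x \<in> W)" for W
    using all_arcs[of "\<lambda>h M. h = 3 \<longrightarrow> (\<forall>x\<in>U 0. M *\<^sub>v x \<in> W)"] by simp
  have nz: "\<not> carrier_vec 1 \<subseteq> {0\<^sub>v 1 :: 'k vec}"
  proof
    assume "carrier_vec 1 \<subseteq> {0\<^sub>v 1 :: 'k vec}"
    then have "unit_vec 1 0 = (0\<^sub>v 1 :: 'k vec)" by (metis singletonD subsetD unit_vec_carrier)
    then have "unit_vec 1 0 $ 0 = (0\<^sub>v 1 :: 'k vec) $ 0" by simp
    then show False by simp
  qed
  have zero: "vec_subspace 1 {0\<^sub>v 1 :: 'k vec}"
    unfolding vec_subspace_def by (auto intro!: eq_vecI)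
  show ?thesis
    unfolding arcs
  proof
    assume L: "\<forall>W. vec_subspace (fst V 3) W \<longrightarrow>
      (\<forall>g\<in>set G. \<forall>x\<in>U 0. functional n d g *\<^sub>v x \<in> W) \<longrightarrow> carrier_vec 1 \<subseteq> W"
    show ?R
    proof (rule ccontr)
      assume "\<not> ?R"
      then have "\<forall>g\<in>set G. \<forall>x\<in>U 0. functional n d g *\<^sub>v x \<in> {0\<^sub>v 1}" by blast
      then have "carrier_vec 1 \<subseteq> {0\<^sub>v 1 :: 'k vec}" using L zero by simp
      then show False using nz by simp
    qed
  next
    assume ?R
    then obtain g x where g: "g \<in> set G" "x \<in> U 0" "functional n d g *\<^sub>v x \<noteq> 0\<^sub>v 1" by blast
    let ?y = "functional n d g *\<^sub>v x"
    have y: "?y \<in> carrier_vec 1" by (rule carrier_vecI) (simp add: functional_def)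
    show "\<forall>W. vec_subspace (fst V 3) W \<longrightarrow>
      (\<forall>g\<in>set G. \<forall>x\<in>U 0. functional n d g *\<^sub>v x \<in> W) \<longrightarrow> carrier_vec 1 \<subseteq> W"
    proof (intro allI impI)
      fix W assume W: "vec_subspace (fst V 3) W" and "\<forall>g\<in>set G. \<forall>x\<in>U 0. functional n d g *\<^sub>v x \<in> W"
      then have "?y \<in> W" using g by blast
      then have "line ?y \<subseteq> W" using vec_subspaceD(4)[OF W] by (auto simp: line_def)
      then show "carrier_vec 1 \<subseteq> W" using line_1[OF y g(3)] by simp
    qed
  qed
qed

lemma V_in_E: "V \<in> E"
proof -
  obtain g where g: "g \<in> set G" "g \<noteq> 0" using G_nz by blast
  then obtain m where m: "m \<in> keys g" by (metis all_not_in_conv keys_eq_empty)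
  have mem: "m \<in> monomials n d" using m g(1) G by (auto simp: multihomogeneous_def polynomials_in_def monomials_def)
  let ?x = "coeff_vec n d (\<lambda>m'. if m' = m then 1 else 0 :: 'k)"
  have "(\<Sum>m'\<in>monomials n d. lookup g m' * (if m' = m then 1 else 0)) = lookup g m"
    using mem finite_monomials[of n d] by (simp add: if_distrib cong: if_cong)
  then have "(functional n d g *\<^sub>v ?x) $ 0 \<noteq> 0" unfolding functional_apply using m by (simp add: in_keys_iff)
  then have "functional n d g *\<^sub>v ?x \<noteq> 0\<^sub>v 1" by auto
  moreover have "?x \<in> carrier_vec (fst V 0)" by (simp add: N_def)
  ultimately have "\<exists>g\<in>set G. \<exists>x\<in>carrier_vec (fst V 0). functional n d g *\<^sub>v x \<noteq> 0\<^sub>v 1" using g(1) by blast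
  then have gen: "\<forall>W. vec_subspace (fst V 3) W \<longrightarrow>
      (\<forall>a\<in>arcs Q. head Q a = 3 \<longrightarrow> (\<forall>x\<in>carrier_vec (fst V (tail Q a)). snd V a *\<^sub>v x \<in> W)) \<longrightarrow> carrier_vec 1 \<subseteq> W"
    using generated_at_sink_iff[of "\<lambda>i. carrier_vec (fst V i)"] by simp
  show ?thesis
  proof (rule arrow_generatedI[OF V_reps])
    fix W assume "vec_subspace (fst V 3) W"
      "\<And>a x. a \<in> arcs Q \<Longrightarrow> head Q a = 3 \<Longrightarrow> x \<in> carrier_vec (fst V (tail Q a)) \<Longrightarrow> snd V a *\<^sub>v x \<in> W"
    then show "carrier_vec (fst V 3) \<subseteq> W" using gen by simp
  qed
qed

text \<open>
  The subrepresentation that corresponds to the point \<open>\<langle>v\<rangle>\<close> of projective space.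
\<close>

definition line_subrep :: "'k vec \<Rightarrow> nat \<Rightarrow> 'k vec set" where
  "line_subrep v = (\<lambda>i\<in>{0, 1, 2, 3}. if i = 0 then line (veronese n d v) else if i = 1 then line v
     else if i = 2 then {0\<^sub>v 1} else carrier_vec 1)"

lemma line_subrep_simps [simp]: "line_subrep v 0 = line (veronese n d v)" "line_subrep v 1 = line v" "line_subrep v (Suc 0) = line v"
  "line_subrep v 2 = {0\<^sub>v 1}" "line_subrep v 3 = carrier_vec 1"
  by (simp_all add: line_subrep_def)

lemma line_subrep_cong:
  assumes "v \<in> carrier_vec (Suc n)" "w \<in> carrier_vec (Suc n)" "w \<noteq> 0\<^sub>v (Suc n)" "line v = line w"
  shows "line_subrep v = line_subrep w"
proof -
  obtain t where t: "t \<noteq> 0" "w = t \<cdot>\<^sub>v v" using line_eqD[OF assms(4,2,3)] .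
  have ver: "line (veronese n d w) = line (veronese n d v)"
    unfolding t(2) veronese_smult[OF assms(1)] by (rule line_smult) (use t(1) in simp)
  show ?thesis unfolding line_subrep_def ver assms(4) ..
qed

definition in_locus :: "(nat \<Rightarrow> 'k) \<Rightarrow> bool" where
  "in_locus c \<longleftrightarrow> (\<forall>f\<in>set F. mpol_eval c f = 0) \<and> (\<exists>g\<in>set G. mpol_eval c g \<noteq> 0)"

lemma line_subrep_Gr:
  assumes v: "v \<in> carrier_vec (Suc n)" "v \<noteq> 0\<^sub>v (Suc n)"
  shows "line_subrep v \<in> (\<Pi>\<^sub>E i\<in>verts Q. Gr (subdims i) (dims i))"
proof -
  have "line_subrep v 0 \<in> Gr 1 N" "line_subrep v 1 \<in> Gr 1 (Suc n)" "line_subrep v 2 \<in> Gr 0 1" "line_subrep v 3 \<in> Gr 1 1"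
    using v veronese_nonzero[OF v, of d] veronese_carrier[of n d v]
    unfolding Gr_1_1 Gr_0 unfolding Gr_1_iff N_def by auto
  then have "\<forall>i\<in>verts Q. line_subrep v i \<in> Gr (subdims i) (dims i)" by simp
  then show ?thesis by (auto simp: line_subrep_def[unfolded restrict_def] PiE_iff extensional_def)
qed

lemma subrepresentations_iff:
  "U \<in> subrepresentations Q subdims V \<longleftrightarrow> U \<in> (\<Pi>\<^sub>E i\<in>verts Q. Gr (subdims i) (dims i)) \<and>
     (\<forall>m\<in>set contracted_mons. \<forall>x\<in>U 0. contraction n d m *\<^sub>v x \<in> U 1) \<and>
     (\<forall>f\<in>set F. \<forall>x\<in>U 0. functional n d f *\<^sub>v x \<in> U 2) \<and>
     (\<forall>g\<in>set G. \<forall>x\<in>U 0. functional n d g *\<^sub>v x \<in> U 3)"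
  unfolding subrepresentations_def using all_arcs[of "\<lambda>h M. \<forall>x\<in>U 0. M *\<^sub>v x \<in> U h"] by simp

lemma sub_in_E_iff:
  assumes U: "U \<in> subrepresentations Q subdims V" and U3: "U 3 = carrier_vec 1"
  shows "(\<exists>A\<in>E. represents_sub Q V U A) \<longleftrightarrow> (\<exists>g\<in>set G. \<exists>x\<in>U 0. functional n d g *\<^sub>v x \<noteq> 0\<^sub>v 1)"
proof -
  have iff: "A \<in> E \<longleftrightarrow> (\<exists>g\<in>set G. \<exists>x\<in>U 0. functional n d g *\<^sub>v x \<noteq> 0\<^sub>v 1)"
    if "A \<in> reps Q" "represents_sub Q V U A" for A
    using arrow_generated_sub_iff[OF wf_digraph_Q _ V_reps that, of 3] generated_at_sink_iff[of U] U3 by simp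
  obtain A where "A \<in> reps Q" "represents_sub Q V U A"
    using subrepresentation_representable[OF wf_digraph_Q V_reps subdims(1) U] by blast
  moreover have "E \<subseteq> reps Q" by (auto simp: arrow_generated_def)
  ultimately show ?thesis using iff by blast
qed

lemma image_line:
  assumes "M \<in> carrier_mat k N" "w \<in> carrier_vec N" "vec_subspace k W" "M *\<^sub>v w \<in> W" "x \<in> line w"
  shows "M *\<^sub>v x \<in> W"
  using assms(5) mult_mat_vec[OF assms(1,2)] vec_subspaceD(4)[OF assms(3,4)] by (auto simp: line_def)

lemma functional_equations:
  "f \<in> set F \<Longrightarrow> functional n d f *\<^sub>v veronese n d v = vec 1 (\<lambda>_. mpol_eval (\<lambda>i. v $ i) f)"
  "f \<in> set G \<Longrightarrow> functional n d f *\<^sub>v veronese n d v = vec 1 (\<lambda>_. mpol_eval (\<lambda>i. v $ i) f)"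
  using F G by (blast intro: functional_veronese)+

text \<open>
  The quotient has dimension zero at vertex \<open>3\<close>, where it is therefore trivially generated; for the
  subrepresentation the generation at \<open>3\<close> is the nonvanishing of some \<open>g\<close>.
\<close>

lemma line_subrep_in_Grassmannian:
  assumes v: "v \<in> carrier_vec (Suc n)" "v \<noteq> 0\<^sub>v (Suc n)" and in_locus: "in_locus (\<lambda>i. v $ i)"
  shows "line_subrep v \<in> subrepresentations Q subdims V" "\<exists>A\<in>E. represents_sub Q V (line_subrep v) A"
    "\<exists>B\<in>E. represents_quotient Q V (line_subrep v) B"
proof -
  have wc: "veronese n d v \<in> carrier_vec N" by (simp add: N_def)
  have cc: "contraction n d m \<in> carrier_mat (Suc n) N" "functional n d f \<in> carrier_mat 1 N" for m f
    by (simp_all add: contraction_def functional_def N_def)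
  have sub: "vec_subspace (Suc n) (line v)" "vec_subspace 1 {0\<^sub>v 1 :: 'k vec}"
  proof -
    have "0\<^sub>v (Suc n) = 0 \<cdot>\<^sub>v v" by (rule eq_vecI) (use v(1) in auto)
    moreover have "s \<cdot>\<^sub>v v + t \<cdot>\<^sub>v v = (s + t) \<cdot>\<^sub>v v" for s t by (simp add: add_smult_distrib_vec)
    ultimately show "vec_subspace (Suc n) (line v)"
      unfolding vec_subspace_def line_def using v(1) by (auto simp: smult_smult_assoc image_iff)
    show "vec_subspace 1 {0\<^sub>v 1 :: 'k vec}" unfolding vec_subspace_def by (auto intro!: eq_vecI)
  qed
  show U: "line_subrep v \<in> subrepresentations Q subdims V"
    unfolding subrepresentations_iff
  proof (intro conjI ballI line_subrep_Gr[OF v])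
    fix m x assume m: "m \<in> set contracted_mons" and x: "x \<in> line_subrep v 0"
    obtain e where "Suc e = d" "m \<in> monomials n e" using m contracted_mons_iff by blast
    then have "contraction n d m *\<^sub>v veronese n d v \<in> line v"
      using contraction_veronese[of m n e d v] v(1) by (auto simp: line_def)
    then show "contraction n d m *\<^sub>v x \<in> line_subrep v 1" using image_line[OF cc(1) wc sub(1)] x by simp
  next
    fix f x assume f: "f \<in> set F" and x: "x \<in> line_subrep v 0"
    have "functional n d f *\<^sub>v veronese n d v = 0\<^sub>v 1"
      using f in_locus by (auto simp: functional_equations(1) in_locus_def)
    then have "functional n d f *\<^sub>v x \<in> {0\<^sub>v 1}" using image_line[OF cc(2) wc sub(2)] x by simp
    then show "functional n d f *\<^sub>v x \<in> line_subrep v 2" by simp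
  next
    fix g x assume "g \<in> set G" "x \<in> line_subrep v 0"
    have "dim_vec (functional n d g *\<^sub>v x) = 1" by (simp add: functional_def)
    then show "functional n d g *\<^sub>v x \<in> line_subrep v 3" by (auto intro: carrier_vecI)
  qed
  obtain g where g: "g \<in> set G" "mpol_eval (\<lambda>i. v $ i) g \<noteq> 0" using in_locus by (auto simp: in_locus_def)
  have "(functional n d g *\<^sub>v veronese n d v) $ 0 \<noteq> 0"
    using g by (simp add: functional_equations(2))
  then have "functional n d g *\<^sub>v veronese n d v \<noteq> 0\<^sub>v 1" by auto
  then have "\<exists>g\<in>set G. \<exists>x\<in>line_subrep v 0. functional n d g *\<^sub>v x \<noteq> 0\<^sub>v 1" using g(1) line_self by auto
  then show "\<exists>A\<in>E. represents_sub Q V (line_subrep v) A" using sub_in_E_iff[OF U] by simp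
  obtain g0 where g0: "g0 \<in> carrier_mat (N - 1) N" "mat_range g0 = carrier_vec (N - 1)"
    "mat_kernel g0 = line (veronese n d v)"
    using line_complement[of "veronese n d v" N] wc veronese_nonzero[OF v, of d] by (auto simp: N_def)
  obtain g1 where g1: "g1 \<in> carrier_mat n (Suc n)" "mat_range g1 = carrier_vec n" "mat_kernel g1 = line v"
    using line_complement[OF v] by auto
  define k where "k = (\<lambda>i\<in>verts Q. if i = 0 then N - 1 else if i = 1 then n else if i = 2 then 1 else 0)"
  define q where "q i = (if i = 0 then g0 else if i = 1 then g1 else if i = 2 then 1\<^sub>m 1 else 0\<^sub>m 0 1)" for i :: nat
  have kern: "mat_kernel (1\<^sub>m 1) = {0\<^sub>v 1 :: 'k vec}" "mat_kernel (0\<^sub>m 0 1) = (carrier_vec 1 :: 'k vec set)"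
    by (auto simp: mat_kernel_def intro!: eq_vecI)
  have range0: "mat_range (0\<^sub>m 0 1 :: 'k mat) = carrier_vec 0"
    unfolding carrier_vec_0 mat_range_def by (auto simp: image_iff intro!: eq_vecI exI[of _ "0\<^sub>v 1"] bexI[of _ "0\<^sub>v 1"])
  have "\<exists>B\<in>reps Q. fst B = k \<and> represents_quotient Q V (line_subrep v) B"
  proof (rule quotient_representable[OF wf_digraph_Q V_reps _ U, of k q])
    show "k \<in> dim_vectors Q" by (auto simp: k_def dim_vectors_def)
    fix i assume i: "i \<in> verts Q"
    show "q i \<in> carrier_mat (k i) (fst V i)" using i g0(1) g1(1) by (auto simp: q_def k_def)
    show "mat_range (q i) = carrier_vec (k i)" using i g0(2) g1(2) one_mat_range[of 1, where 'a = 'k] range0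
      by (auto simp: q_def k_def)
    show "mat_kernel (q i) = line_subrep v i" using i g0(3) g1(3) kern by (auto simp: q_def)
  qed
  then obtain B where B: "B \<in> reps Q" "fst B = k" "represents_quotient Q V (line_subrep v) B" by blast
  moreover have "B \<in> E" by (rule arrow_generated_dim_0[OF B(1)]) (simp add: B(2) k_def)
  ultimately show "\<exists>B\<in>E. represents_quotient Q V (line_subrep v) B" by blast
qed

text \<open>
  At vertices \<open>2\<close> and \<open>3\<close> the dimension leaves only one subspace, and by \<open>veronese_recognition\<close> the
  line at \<open>0\<close> is determined by the line at \<open>1\<close>.
\<close>

lemma in_GrassmannianD:
  assumes U: "U \<in> subrepresentations Q subdims V" and A: "\<exists>A\<in>E. represents_sub Q V U A"
  obtains v where "v \<in> carrier_vec (Suc n)" "v \<noteq> 0\<^sub>v (Suc n)" "U = line_subrep v" "in_locus (\<lambda>i. v $ i)"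
proof -
  have UP: "U \<in> (\<Pi>\<^sub>E i\<in>verts Q. Gr (subdims i) (dims i))"
    and con: "\<And>m x. m \<in> set contracted_mons \<Longrightarrow> x \<in> U 0 \<Longrightarrow> contraction n d m *\<^sub>v x \<in> U 1"
    and fnl: "\<And>f x. f \<in> set F \<Longrightarrow> x \<in> U 0 \<Longrightarrow> functional n d f *\<^sub>v x \<in> U 2"
    using U unfolding subrepresentations_iff by blast+
  have Ui: "U 0 \<in> Gr 1 N" "U 1 \<in> Gr 1 (Suc n)" "U 2 \<in> Gr 0 1" "U 3 \<in> Gr 1 1"
    using PiE_mem[OF UP, of 0] PiE_mem[OF UP, of 1] PiE_mem[OF UP, of 2] PiE_mem[OF UP, of 3] by simp_all
  have U2: "U 2 = {0\<^sub>v 1}" using Ui(3) unfolding Gr_0 by simp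
  have U3: "U 3 = carrier_vec 1" using Ui(4) unfolding Gr_1_1 by simp
  obtain w where w: "w \<in> carrier_vec N" "w \<noteq> 0\<^sub>v N" "U 0 = line w" using Ui(1) unfolding Gr_1_iff by blast
  obtain v where v: "v \<in> carrier_vec (Suc n)" "v \<noteq> 0\<^sub>v (Suc n)" "U 1 = line v"
    using Ui(2) unfolding Gr_1_iff by blast
  have lw: "line w = line (veronese n d v)"
  proof (rule veronese_recognition[OF v(1,2)])
    fix m e assume "m \<in> monomials n e" "Suc e = d"
    then have "m \<in> set contracted_mons" using contracted_mons_iff by blast
    then show "contraction n d m *\<^sub>v w \<in> line v" using con[of m w] w(3) v(3) by simp
  qed (use w in \<open>simp_all add: N_def\<close>)
  have U0: "U 0 = line (veronese n d v)" using w(3) lw by simp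
  have "U i = line_subrep v i" for i
  proof (cases "i \<in> verts Q")
    case True
    then show ?thesis using U0 U2 U3 v(3) by auto
  next
    case False
    then show ?thesis using PiE_arb[OF UP False] by (simp add: line_subrep_def)
  qed
  then have "U = line_subrep v" by blast
  moreover have "in_locus (\<lambda>i. v $ i)"
    unfolding in_locus_def
  proof
    show "\<forall>f\<in>set F. mpol_eval (\<lambda>i. v $ i) f = 0"
    proof
      fix f assume f: "f \<in> set F"
      have "functional n d f *\<^sub>v veronese n d v = 0\<^sub>v 1" using fnl[OF f, of "veronese n d v"] U0 U2 by simp
      then have "vec 1 (\<lambda>_. mpol_eval (\<lambda>i. v $ i) f) $ 0 = 0\<^sub>v 1 $ 0"
        by (simp only: functional_equations(1)[OF f])
      then show "mpol_eval (\<lambda>i. v $ i) f = 0" by simp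
    qed
    obtain g x where g: "g \<in> set G" "x \<in> U 0" "functional n d g *\<^sub>v x \<noteq> 0\<^sub>v 1"
      using sub_in_E_iff[OF U U3] A by blast
    have "mpol_eval (\<lambda>i. v $ i) g \<noteq> 0"
    proof
      assume z: "mpol_eval (\<lambda>i. v $ i) g = 0"
      obtain t where t: "x = t \<cdot>\<^sub>v veronese n d v" using g(2) U0 by (auto simp: line_def)
      have gc: "functional n d g \<in> carrier_mat 1 (length (mon_list n d))" by (simp add: functional_def)
      have "functional n d g *\<^sub>v x = t \<cdot>\<^sub>v (functional n d g *\<^sub>v veronese n d v)"
        unfolding t by (rule mult_mat_vec[OF gc]) simp
      also have "functional n d g *\<^sub>v veronese n d v = vec 1 (\<lambda>_. 0)"
        by (simp only: functional_equations(2)[OF g(1)] z)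
      also have "t \<cdot>\<^sub>v vec 1 (\<lambda>_. 0) = 0\<^sub>v 1" by (rule eq_vecI) auto
      finally show False using g(3) by simp
    qed
    with g(1) show "\<exists>g\<in>set G. mpol_eval (\<lambda>i. v $ i) g \<noteq> 0" by blast
  qed
  ultimately show thesis using that v by blast
qed

definition embed :: "'k vec set \<Rightarrow> nat \<Rightarrow> 'k vec set" where
  "embed L = line_subrep (SOME v. v \<in> carrier_vec (Suc n) \<and> v \<noteq> 0\<^sub>v (Suc n) \<and> L = line v)"

lemma embed_line:
  assumes v: "v \<in> carrier_vec (Suc n)" "v \<noteq> 0\<^sub>v (Suc n)"
  shows "embed (line v) = line_subrep v"
proof -
  define w where "w = (SOME w. w \<in> carrier_vec (Suc n) \<and> w \<noteq> 0\<^sub>v (Suc n) \<and> line v = line w)"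
  have "w \<in> carrier_vec (Suc n) \<and> w \<noteq> 0\<^sub>v (Suc n) \<and> line v = line w"
    unfolding w_def by (rule someI[of _ v]) (use v in simp)
  then have "line_subrep w = line_subrep v" using line_subrep_cong[of w v] v by simp
  then show ?thesis by (simp add: embed_def w_def)
qed

text \<open>
  The Pluecker coordinates are the monomials of degree \<open>d\<close> at vertex \<open>0\<close>, the coordinates themselves
  at \<open>1\<close>, and the constant \<open>1\<close> at \<open>2\<close> and \<open>3\<close>.
\<close>

lemma morphism_embed:
  "morphism (projective_space n) (Gr_product (verts Q) subdims dims) embed"
  unfolding Gr_product_alt projective_space_alt
proof (rule morphism_subst[where J = "verts Q" and
      D = "\<lambda>i _. if i = 0 then d else if i = 1 then 1 else 0" and
      q = "\<lambda>(i, I). if i = 0 then single (mon_list n d ! the_elem I) 1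
             else if i = 1 then single (single (the_elem I) 1) 1 else 1"])
  show "block_scaled {..n} (\<lambda>_. ()) (hom_coords n p)" if "p \<in> Gr 1 (Suc n)" for p :: "'k vec set"
    using that by (rule block_scaled_hom_coords)
  show "block_scaled (pluecker_index (verts Q) subdims dims) fst (pluecker (verts Q) subdims dims p)"
    if "p \<in> (\<Pi>\<^sub>E i\<in>verts Q. Gr (subdims i) (dims i))" for p :: "nat \<Rightarrow> 'k vec set"
    using that by (rule block_scaled_pluecker)
  show "embed L \<in> (\<Pi>\<^sub>E i\<in>verts Q. Gr (subdims i) (dims i))" if L: "L \<in> Gr 1 (Suc n)" for L
  proof -
    obtain v where v: "v \<in> carrier_vec (Suc n)" "v \<noteq> 0\<^sub>v (Suc n)" "L = line v"
      using L unfolding Gr_1_iff by (elim bexE conjE)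
    show ?thesis unfolding v(3) embed_line[OF v(1,2)] by (rule line_subrep_Gr[OF v(1,2)])
  qed
  have index: "(i = 0 \<and> (\<exists>k<N. I = {k})) \<or> (i = 1 \<and> (\<exists>k\<le>n. I = {k})) \<or> (i = 2 \<and> I = {}) \<or> (i = 3 \<and> I = {0})"
    if "(i, I) \<in> pluecker_index (verts Q) subdims dims" for i I
  proof -
    have "i \<in> verts Q \<and> I \<subseteq> {..<dims i} \<and> card I = subdims i"
      using that by (simp only: mem_Collect_eq prod.case)
    then have I: "i \<in> {0, 1, 2, 3}" "I \<subseteq> {..<dims i}" "card I = subdims i"
      unfolding Q_sel by simp_all
    have fin: "finite I" using I(2) by (rule finite_subset) simp
    consider "i = 0" | "i = 1" | "i = 2" | "i = 3" using I(1) by auto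
    then show ?thesis
    proof cases
      case 1
      then obtain k where "I = {k}" using I(3) by (auto simp: card_1_singleton_iff)
      then show ?thesis using I(2) 1 by auto
    next
      case 2
      then obtain k where "I = {k}" using I(3) by (auto simp: card_1_singleton_iff)
      then show ?thesis using I(2) 2 by auto
    next
      case 3
      then show ?thesis using I(3) fin by auto
    next
      case 4
      then obtain k where "I = {k}" using I(3) by (auto simp: card_1_singleton_iff)
      then show ?thesis using I(2) 4 by auto
    qed
  qed
  let ?q = "\<lambda>(i, I). if i = 0 then single (mon_list n d ! the_elem I) (1 :: 'k)
             else if i = 1 then single (single (the_elem I) 1) 1 else 1"
  show "?q y \<in> multihomogeneous {..n} (\<lambda>_. ()) (\<lambda>_. if fst y = 0 then d else if fst y = 1 then 1 else 0)"
    if yI: "y \<in> pluecker_index (verts Q) subdims dims" for y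
  proof -
    have mono: "single m (1 :: 'k) \<in> homogeneous n e" if "m \<in> monomials n e" for m e
      using that single_multihomogeneous[of m "{..n}" "1 :: 'k" "\<lambda>_. ()"] by (simp add: monomials_def)
    obtain i I where y: "y = (i, I)" by (cases y)
    consider k where "i = 0" "k < N" "I = {k}" | k where "i = 1" "k \<le> n" "I = {k}" | "i = 2 \<or> i = 3"
      using index[OF yI[unfolded y]] by blast
    then show ?thesis
    proof cases
      case 1
      have "mon_list n d ! k \<in> monomials n d"
        unfolding mon_list(1)[symmetric] using 1(2) by (simp add: N_def)
      from mono[OF this] show ?thesis using 1 y by simp
    next
      case 2
      then show ?thesis using mono[OF single_in_monomials[of k n 1]] y by simp
    next
      case 3
      then show ?thesis using one_multihomogeneous[of "{..n}" "\<lambda>_. ()"] y by auto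
    qed
  qed
  fix L :: "'k vec set" and c assume L: "L \<in> Gr 1 (Suc n)" and c: "c \<in> hom_coords n L"
  obtain v where v: "v \<in> carrier_vec (Suc n)" "v \<noteq> 0\<^sub>v (Suc n)" "L = line v" "c = (\<lambda>i. v $ i)"
    using hom_coordsE[OF L c] .
  define A where "A i = (if i = 0 then mat N 1 (\<lambda>(k, _). veronese n d v $ k) else
     if i = 1 then mat (Suc n) 1 (\<lambda>(k, _). v $ k) else if i = 2 then 0\<^sub>m 1 0 else 1\<^sub>m 1)" for i :: nat
  have A: "\<forall>i\<in>verts Q. basis_matrix (subdims i) (dims i) (line_subrep v i) (A i)"
  proof -
    have "basis_matrix 1 N (line_subrep v 0) (A 0)"
      using basis_matrix_line[of "veronese n d v" N] veronese_nonzero[OF v(1,2), of d] by (simp add: A_def N_def)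
    moreover have "basis_matrix 1 (Suc n) (line_subrep v 1) (A 1)"
      using basis_matrix_line[OF v(1,2)] by (simp add: A_def)
    moreover have "basis_matrix 0 1 (line_subrep v 2) (A 2)" unfolding basis_matrix_0 by (simp add: A_def)
    moreover have "basis_matrix 1 1 (line_subrep v 3) (A 3)" using basis_matrix_full[of 1] by (simp add: A_def)
    ultimately show ?thesis by simp
  qed
  show "\<exists>c'\<in>pluecker (verts Q) subdims dims (embed L). \<forall>y\<in>pluecker_index (verts Q) subdims dims. c' y = mpol_eval c (?q y)"
  proof (rule bexI)
    show "(\<lambda>(i, I). det (submatrix (A i) I UNIV)) \<in> pluecker (verts Q) subdims dims (embed L)"
      unfolding v(3) embed_line[OF v(1,2)] pluecker_def using A by blast
    show "\<forall>y\<in>pluecker_index (verts Q) subdims dims. (case y of (i, I) \<Rightarrow> det (submatrix (A i) I UNIV)) = mpol_eval c (?q y)"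
    proof
      fix y assume yI: "y \<in> pluecker_index (verts Q) subdims dims"
      obtain i I where y: "y = (i, I)" by (cases y)
      consider k where "i = 0" "k < N" "I = {k}" | k where "i = 1" "k \<le> n" "I = {k}" |
        "i = 2" "I = {}" | "i = 3" "I = {0}"
        using index[OF yI[unfolded y]] by blast
      then show "(case y of (i, I) \<Rightarrow> det (submatrix (A i) I UNIV)) = mpol_eval c (?q y)"
      proof cases
        case 1
        have "A 0 \<in> carrier_mat N 1" by (simp add: A_def)
        from det_submatrix_singleton[OF this 1(2)] show ?thesis
          using 1 y by (simp add: A_def mpol_eval_single v(4) veronese_def coeff_vec_def N_def)
      next
        case 2
        have "A 1 \<in> carrier_mat (Suc n) 1" "k < Suc n" using 2 by (simp_all add: A_def)
        from det_submatrix_singleton[OF this] show ?thesis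
          using 2 y by (simp add: A_def mpol_eval_single mon_eval_single v(4))
      next
        case 3
        have "A 2 \<in> carrier_mat 1 0" by (simp add: A_def)
        from det_submatrix_empty[OF this] show ?thesis using 3 y by simp
      next
        case 4
        have "A 3 \<in> carrier_mat 1 1" by (simp add: A_def)
        from det_submatrix_singleton[OF this, of 0] show ?thesis using 4 y by (simp add: A_def)
      qed
    qed
  qed
qed auto

theorem isomorphic_E_Grassmannian:
  assumes Z: "\<And>L c. L \<in> Gr 1 (Suc n) \<Longrightarrow> c \<in> hom_coords n L \<Longrightarrow> L \<in> Z \<longleftrightarrow> in_locus c"
  shows "isomorphic_varieties (subvariety (projective_space n) Z) (E_Grassmannian Q E subdims V)"
  unfolding E_Grassmannian_def fst_V
proof (rule isomorphic_subvarieties)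
  show "morphism (projective_space n) (Gr_product (verts Q) subdims dims) embed" by (rule morphism_embed)
  show "morphism (Gr_product (verts Q) subdims dims :: (_, 'k) variety) (projective_space n) (\<lambda>U. U 1)"
    by (rule morphism_projection) simp_all
  let ?T = "{U \<in> subrepresentations Q subdims V.
      (\<exists>A\<in>E. represents_sub Q V U A) \<and> (\<exists>B\<in>E. represents_quotient Q V U B)}"
  fix L :: "'k vec set" assume L: "L \<in> topspace (zariski (projective_space n)) \<inter> Z"
  then have "L \<in> Gr 1 (Suc n)" unfolding topspace_projective_space by blast
  then obtain v where v: "v \<in> carrier_vec (Suc n)" "v \<noteq> 0\<^sub>v (Suc n)" "L = line v"
    using Gr_1_iff by blast
  have "in_locus (\<lambda>i. v $ i)"
    using Z[of L "\<lambda>i. v $ i"] L hom_coords_line[OF v(2)] v(3) unfolding topspace_projective_space by blast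
  then have "line_subrep v \<in> ?T" using line_subrep_in_Grassmannian[OF v(1,2)] by blast
  then show "embed L \<in> ?T \<and> embed L 1 = L" using embed_line[OF v(1,2)] v(3) by simp
next
  fix U :: "nat \<Rightarrow> 'k vec set"
  assume "U \<in> topspace (zariski (Gr_product (verts Q) subdims dims)) \<inter> {U \<in> subrepresentations Q subdims V.
      (\<exists>A\<in>E. represents_sub Q V U A) \<and> (\<exists>B\<in>E. represents_quotient Q V U B)}"
  then have "U \<in> subrepresentations Q subdims V" "\<exists>A\<in>E. represents_sub Q V U A" by simp_all
  then obtain v where v: "v \<in> carrier_vec (Suc n)" "v \<noteq> 0\<^sub>v (Suc n)" "U = line_subrep v" "in_locus (\<lambda>i. v $ i)"
    by (rule in_GrassmannianD)
  have "line v \<in> Gr 1 (Suc n)" using v(1,2) Gr_1_iff by blast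
  then have "line v \<in> Z" using Z hom_coords_line[OF v(2)] v(4) by blast
  then show "U 1 \<in> Z \<and> embed (U 1) = U" using embed_line[OF v(1,2)] v(3) by simp
qed

end

text \<open>
  Transporting the open subset along the isomorphism with a closed subvariety of projective space.
\<close>

lemma quasi_projective_locally_closed:
  fixes Y :: "('p, 'k::field) variety"
  assumes "quasi_projective_variety Y"
  shows "\<exists>n C U. closedin (zariski (projective_space n :: (_, 'k) variety)) C \<and>
    openin (zariski (projective_space n :: (_, 'k) variety)) U \<and>
    isomorphic_varieties Y (subvariety (projective_space n) (C \<inter> U))"
proof -
  obtain X :: "('k vec set, 'k) variety" and W where X: "projective_variety X"
    and W: "openin (zariski X) W" and Y: "isomorphic_varieties Y (subvariety X W)"
    using assms unfolding quasi_projective_variety_def by blast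
  obtain n C where C: "closedin (zariski (projective_space n :: (_, 'k) variety)) C"
    and "isomorphic_varieties X (subvariety (projective_space n) C)"
    using X unfolding projective_variety_def by blast
  then obtain \<phi> \<psi> where iso: "morphism X (subvariety (projective_space n) C) \<phi>"
    "morphism (subvariety (projective_space n) C) X \<psi>"
    "\<forall>p\<in>topspace (zariski X). \<psi> (\<phi> p) = p"
    "\<forall>q\<in>topspace (zariski (subvariety (projective_space n) C)). \<phi> (\<psi> q) = q"
    unfolding isomorphic_varieties_def by blast
  let ?P = "subvariety (projective_space n :: (_, 'k) variety) C"
  define W' where "W' = {q \<in> topspace (zariski ?P). \<psi> q \<in> W}"
  have "openin (zariski ?P) W'"
    unfolding W'_def using iso(2) W by (auto simp: morphism_def intro: openin_continuous_map_preimage)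
  then obtain U where U: "openin (zariski (projective_space n :: (_, 'k) variety)) U" "W' = U \<inter> C"
    by (auto simp: subvariety_def openin_subtopology)
  have "isomorphic_varieties (subvariety X W) (subvariety ?P W')"
  proof (rule isomorphic_subvarieties[OF iso(1,2)])
    fix p assume p: "p \<in> topspace (zariski X) \<inter> W"
    then have "\<phi> p \<in> topspace (zariski ?P)" using iso(1) by (auto simp: morphism_def continuous_map_def)
    then show "\<phi> p \<in> W' \<and> \<psi> (\<phi> p) = p" using p iso(3) by (simp add: W'_def)
  next
    fix q assume "q \<in> topspace (zariski ?P) \<inter> W'"
    then show "\<psi> q \<in> W \<and> \<phi> (\<psi> q) = q" using iso(4) by (simp add: W'_def)
  qed
  moreover have "isomorphic_varieties (subvariety ?P W') (subvariety (projective_space n) (C \<inter> W'))"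
    unfolding projective_space_alt by (rule subvariety_subvariety_iso)
  moreover have "C \<inter> W' = C \<inter> U" using U(2) by blast
  ultimately have "isomorphic_varieties Y (subvariety (projective_space n) (C \<inter> U))"
    using isomorphic_varieties_trans Y by metis
  with C U(1) show ?thesis by blast
qed

theorem theorem1p1:
  fixes Y :: "('p, 'k::alg_closed_field) variety"
  assumes "quasi_projective_variety Y"
  shows "\<exists>(Q :: (nat, nat) pre_digraph) (E :: (nat, nat, 'k) rep set) V e.
           fin_digraph Q \<and>
           finite_dimensional (path_algebra Q :: (nat \<times> nat list \<Rightarrow>\<^sub>0 'k) set) \<and>
           open_fully_exact Q E \<and>
           V \<in> E \<and>
           e \<in> dim_vectors Q \<and> (\<forall>i\<in>verts Q. e i \<le> fst V i) \<and>
           isomorphic_varieties Y (E_Grassmannian Q E e V)"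
proof -
  obtain n C U where C: "closedin (zariski (projective_space n :: (_, 'k) variety)) C"
    and U: "openin (zariski (projective_space n :: (_, 'k) variety)) U"
    and Y: "isomorphic_varieties Y (subvariety (projective_space n) (C \<inter> U))"
    using quasi_projective_locally_closed[OF assms] by (elim exE conjE)
  obtain d F G where "set F \<subseteq> homogeneous n d" "set G \<subseteq> homogeneous n d" "\<exists>g\<in>set G. g \<noteq> 0"
    and Z: "\<forall>L\<in>Gr 1 (Suc n). \<forall>c\<in>hom_coords n L. L \<in> C \<inter> U \<longleftrightarrow>
       (\<forall>f\<in>set F. mpol_eval c f = 0) \<and> (\<exists>g\<in>set G. mpol_eval c g \<noteq> 0)"
    using locally_closed_presentation[OF C U] by (elim exE conjE)
  then interpret locally_closed_locus n d F G by unfold_locales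
  have "isomorphic_varieties (subvariety (projective_space n) (C \<inter> U)) (E_Grassmannian Q E subdims V)"
    by (rule isomorphic_E_Grassmannian) (use Z in \<open>simp add: in_locus_def\<close>)
  then have "isomorphic_varieties Y (E_Grassmannian Q E subdims V)"
    by (rule isomorphic_varieties_trans[OF Y])
  moreover have "open_fully_exact Q E" by (rule open_fully_exact_arrow_generated[OF fin_digraph_Q]) simp
  ultimately show ?thesis
    using fin_digraph_Q path_algebra_finite V_in_E subdims by blast
qed

end
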